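(* For every planar graph $G$ with maximum degree at most $3$, $\chi'_{inj}(G)\le 6$.
   Context: All graphs are finite and simple. An edge coloring of a graph $G$ (not necessarily proper) is \emph{injective} if any two distinct edges $e,f$ receive distinct colors whenever either (i) $e$ and $f$ share no vertex and some edge of $G$ joins an endpoint of $e$ to an endpoint of $f$, or (ii) $e$ and $f$ lie in a common triangle of $G$. The injective chromatic index $\chi'_{inj}(G)$ is the minimum number of colors in an injective edge coloring of $G$. *)

theory Defs
  imports "HOL-Analysis.Analysis"
begin

definition simple_graph :: "'a set \<Rightarrow> 'a set set \<Rightarrow> bool" where
  "simple_graph V E \<longleftrightarrow> finite V \<and>
     (\<forall>e\<in>E. \<exists>u v. u \<in> V \<and> v \<in> V \<and> u \<noteq> v \<and> e = {u, v})"

definition degree :: "'a set set \<Rightarrow> 'a \<Rightarrow> nat" where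
  "degree E v = card {e\<in>E. v \<in> e}"

definition max_degree_le :: "'a set \<Rightarrow> 'a set set \<Rightarrow> nat \<Rightarrow> bool" where
  "max_degree_le V E d \<longleftrightarrow> (\<forall>v\<in>V. degree E v \<le> d)"

definition planar :: "'a set \<Rightarrow> 'a set set \<Rightarrow> bool" where
  "planar V E \<longleftrightarrow> (\<exists>(p :: 'a \<Rightarrow> complex) (\<gamma> :: 'a set \<Rightarrow> real \<Rightarrow> complex).
     inj_on p V \<and>
     (\<forall>e\<in>E. \<forall>u v. e = {u, v} \<longrightarrow>
         arc (\<gamma> e) \<and> {pathstart (\<gamma> e), pathfinish (\<gamma> e)} = {p u, p v}) \<and>
     (\<forall>e\<in>E. path_image (\<gamma> e) \<inter> p ` V = p ` e) \<and>
     (\<forall>e\<in>E. \<forall>f\<in>E. e \<noteq> f \<longrightarrow> path_image (\<gamma> e) \<inter> path_image (\<gamma> f) \<subseteq> p ` (e \<inter> f)))"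

definition inj_conflict :: "'a set set \<Rightarrow> 'a set \<Rightarrow> 'a set \<Rightarrow> bool" where
  "inj_conflict E e f \<longleftrightarrow> e \<noteq> f \<and>
     ((e \<inter> f = {} \<and> (\<exists>x\<in>e. \<exists>y\<in>f. {x, y} \<in> E)) \<or>
      (\<exists>a b c. a \<noteq> b \<and> b \<noteq> c \<and> a \<noteq> c \<and> {a, b} \<in> E \<and> {b, c} \<in> E \<and> {a, c} \<in> E
              \<and> e \<subseteq> {a, b, c} \<and> f \<subseteq> {a, b, c}))"

definition injective_edge_coloring :: "'a set set \<Rightarrow> ('a set \<Rightarrow> nat) \<Rightarrow> nat \<Rightarrow> bool" where
  "injective_edge_coloring E c k \<longleftrightarrow>
     (\<forall>e\<in>E. c e < k) \<and> (\<forall>e\<in>E. \<forall>f\<in>E. inj_conflict E e f \<longrightarrow> c e \<noteq> c f)"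

definition inj_chromatic_index :: "'a set set \<Rightarrow> nat" where
  "inj_chromatic_index E = (LEAST k. \<exists>c. injective_edge_coloring E c k)"

end

theory Submission
  imports Defs "HOL-Complex_Analysis.Winding_Numbers"
begin

text \<open>
  A diamond (two triangles with a common edge) can be deleted, and a colouring of the rest extends to
  it. Otherwise let \<open>B\<close> be an independent set such that \<open>G - B\<close> has an injective edge
  colouring with two colours; a linear forest \<open>G - B\<close> exists, and \<open>B\<close> is chosen of
  minimum size. The edges inside \<open>G - B\<close> get these two colours. Every other edge \<open>a b\<close> with
  \<open>b\<close> in \<open>B\<close> gets the colour of \<open>a\<close> in a 4-colouring of the graph \<open>H\<close> on
  \<open>V - B\<close> in which vertices are adjacent if they are adjacent in \<open>G\<close> or have a common neighbour
  in \<open>B\<close>. Minimality of \<open>B\<close> makes \<open>H\<close> 4-degenerate, so the four colour theorem can be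
  avoided: a vertex of degree 4 is handled by Kempe chains. The planarity used there is that two
  theta curves which agree near their ends, except for an exchange of two arcs at one end, cannot
  both exist.
\<close>

section \<open>Theta curves\<close>

text \<open>The graph H is planar, since it replaces vertices of degree at most 3 by edges among
  their neighbours. Planarity alone bounds its degeneracy by 5, where Kempe's argument breaks down;
  the minimal choice of \<open>B\<close> gains the one unit that makes it work. Kempe's step usually
  relies on the cyclic order of the four neighbours, which a drawing by arcs does not provide. Here
  all six pairs of neighbours are linked by chains, so both ways of pairing across a contracted path
  are present, and no order has to be known. Colouring an edge by its end outside \<open>B\<close>
  is sound because \<open>B\<close> is independent: two such edges in conflict cannot be joined by
  their ends in \<open>B\<close>, so their other ends are distinct and adjacent in H. The total is 4
  + 2 colours. Diamonds obstruct the choice of \<open>B\<close>: in a complete graph on four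
  vertices every independent set leaves a triangle, which needs three colours.\<close>

definition arc_between :: "complex \<Rightarrow> complex \<Rightarrow> (real \<Rightarrow> complex) \<Rightarrow> bool" where
  "arc_between x y g \<longleftrightarrow> arc g \<and> pathstart g = x \<and> pathfinish g = y"

lemma arc_between_join:
  assumes "arc_between x y g" "arc_between y z h" "path_image g \<inter> path_image h \<subseteq> {y}"
  shows "arc_between x z (g +++ h)"
  using assms by (auto simp: arc_between_def intro!: arc_join)

lemma arc_between_loop:
  assumes "arc_between p q a" "arc_between p q b" "path_image a \<inter> path_image b = {p, q}"
  shows "simple_path (a +++ reversepath b)" "pathfinish (a +++ reversepath b) = pathstart (a +++ reversepath b)"
    "path_image (a +++ reversepath b) = path_image a \<union> path_image b"
  using assms by (auto simp: arc_between_def simple_path_join_loop_eq arc_reversepath path_image_join)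

lemma winding_number_loop:
  assumes "arc_between p q a" "arc_between p q b" "z \<notin> path_image a" "z \<notin> path_image b"
  shows "winding_number (a +++ reversepath b) z = winding_number a z - winding_number b z"
  using assms by (simp add: arc_between_def winding_number_join winding_number_reversepath arc_imp_path)

text \<open>The two arcs form a Jordan curve, run along \<open>a\<close> and back along
  \<open>b\<close>, whose index is 1 or -1 inside and 0 outside. Writing it as a difference of arcs
  lets three arcs with common ends be compared two at a time.\<close>

lemma winding_number_loop_inside:
  assumes ab: "arc_between p q a" "arc_between p q b" "path_image a \<inter> path_image b = {p, q}"
    and z: "z \<notin> path_image a" "z \<notin> path_image b"
  shows "winding_number a z - winding_number b z \<noteq> 0 \<longleftrightarrow> z \<in> inside (path_image a \<union> path_image b)"
proof -
  let ?g = "a +++ reversepath b"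
  note l = arc_between_loop[OF ab]
  have w: "winding_number ?g z = winding_number a z - winding_number b z"
    using winding_number_loop[OF ab(1,2) z] .
  show ?thesis
  proof (cases "z \<in> inside (path_image a \<union> path_image b)")
    case True
    then have "z \<in> inside (path_image ?g)" by (simp add: l)
    with simple_closed_path_winding_number_inside[OF l(1)] l(2)
    have "winding_number ?g z = 1 \<or> winding_number ?g z = -1" by metis
    then show ?thesis using w True by auto
  next
    case False
    then have "z \<in> outside (path_image ?g)"
      using z by (metis ComplI Un_iff inside_Un_outside l(3))
    then have "winding_number ?g z = 0"
      using winding_number_zero_in_outside l(1,2) simple_path_imp_path by blast
    then show ?thesis using w False by auto
  qed
qed

lemma not_in_inside: "x \<in> inside S \<Longrightarrow> x \<notin> S"
  using inside_no_overlap[of S] by blast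

text \<open>If \<open>a1\<close> enters the inside of \<open>a0\<close>, \<open>a2\<close>, it cuts
  this region in two, and one part is the inside of \<open>a0\<close>, \<open>a1\<close>. The larger
  region misses \<open>a2\<close>, which belongs to its boundary.\<close>

lemma theta_inside_exclusive:
  assumes a: "arc_between p q a0" "arc_between p q a1" "arc_between p q a2"
    and i: "path_image a0 \<inter> path_image a1 = {p, q}" "path_image a0 \<inter> path_image a2 = {p, q}"
      "path_image a1 \<inter> path_image a2 = {p, q}"
    and z: "z1 \<in> path_image a1" "z2 \<in> path_image a2" "z1 \<in> inside (path_image a0 \<union> path_image a2)"
  shows "z2 \<notin> inside (path_image a0 \<union> path_image a1)"
proof
  assume z2: "z2 \<in> inside (path_image a0 \<union> path_image a1)"
  have pq: "p \<noteq> q" using a(1) by (auto simp: arc_between_def dest: arc_distinct_ends)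
  have sp: "simple_path a0" "simple_path a1" "simple_path a2"
    using a by (auto simp: arc_between_def arc_imp_simple_path)
  have "inside (path_image a0 \<union> path_image a1) \<union> inside (path_image a2 \<union> path_image a1) \<union>
           (path_image a1 - {p,q}) = inside (path_image a0 \<union> path_image a2)"
    by (rule split_inside_simple_closed_curve[of a0 p q a2 a1])
       (use sp a i pq z in \<open>auto simp: arc_between_def\<close>)
  then have "z2 \<in> inside (path_image a0 \<union> path_image a2)" using z2 by blast
  then show False using z(2) not_in_inside by blast
qed

text \<open>Each region is connected and misses the boundary of the other, so a common point makes
  them equal. Equal regions have equal frontiers, which leaves no room for the interior of
  \<open>a1\<close>.\<close>

lemma theta_faces_equal:
  assumes a: "arc_between p q a0" "arc_between p q a1" "arc_between p q a2"
    and i: "path_image a0 \<inter> path_image a1 = {p, q}" "path_image a0 \<inter> path_image a2 = {p, q}"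
      "path_image a1 \<inter> path_image a2 = {p, q}"
    and d: "path_image a2 \<inter> inside (path_image a0 \<union> path_image a1) = {}"
      "path_image a1 \<inter> inside (path_image a0 \<union> path_image a2) = {}"
    and z: "z \<in> inside (path_image a0 \<union> path_image a1)"
      "z \<in> inside (path_image a0 \<union> path_image a2)"
  shows False
proof -
  have sub: "inside (path_image a0 \<union> path_image b) \<subseteq> inside (path_image a0 \<union> path_image c)"
    if b: "arc_between p q b" and i: "path_image a0 \<inter> path_image b = {p, q}"
      and d: "path_image c \<inter> inside (path_image a0 \<union> path_image b) = {}"
      and z: "z \<in> inside (path_image a0 \<union> path_image b)" "z \<in> inside (path_image a0 \<union> path_image c)" for b c
  proof
    fix y assume y: "y \<in> inside (path_image a0 \<union> path_image b)"
    have con: "connected (inside (path_image a0 \<union> path_image b))"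
      using Jordan_inside_outside[OF arc_between_loop(1,2)[OF a(1) b i]] arc_between_loop(3)[OF a(1) b i] by simp
    have "v \<notin> path_image a0 \<union> path_image c" if v: "v \<in> inside (path_image a0 \<union> path_image b)" for v
      using d v not_in_inside[OF v] by auto
    then have "inside (path_image a0 \<union> path_image b) \<subseteq> - (path_image a0 \<union> path_image c)" by blast
    then have "connected_component (- (path_image a0 \<union> path_image c)) z y"
      using con y z(1) unfolding connected_component_def by blast
    then show "y \<in> inside (path_image a0 \<union> path_image c)"
      using inside_same_component z(2) by blast
  qed
  have eq: "inside (path_image a0 \<union> path_image a1) = inside (path_image a0 \<union> path_image a2)"
    using sub[OF a(2) i(1) d(1) z] sub[OF a(3) i(2) d(2) z(2,1)] by blast
  have fr: "frontier (inside (path_image a0 \<union> path_image b)) = path_image a0 \<union> path_image b"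
    if b: "arc_between p q b" and i: "path_image a0 \<inter> path_image b = {p, q}" for b
    using Jordan_inside_outside[OF arc_between_loop(1,2)[OF a(1) b i]] arc_between_loop(3)[OF a(1) b i] by simp
  have same: "path_image a0 \<union> path_image a1 = path_image a0 \<union> path_image a2"
    by (rule trans[OF fr[OF a(2) i(1), unfolded eq, symmetric] fr[OF a(3) i(2)]])
  have "path_image a1 \<subseteq> {p, q}"
  proof
    fix x assume x: "x \<in> path_image a1"
    then have "x \<in> path_image a0 \<union> path_image a1" by simp
    then have "x \<in> path_image a0 \<or> x \<in> path_image a2" unfolding same by simp
    then have "x \<in> path_image a0 \<inter> path_image a1 \<or> x \<in> path_image a1 \<inter> path_image a2" using x by simp
    then show "x \<in> {p, q}" unfolding i by simp
  qed
  moreover have "path_image a1 - {pathstart a1, pathfinish a1} \<noteq> {}"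
    using a(2) nonempty_simple_path_endless arc_imp_simple_path by (auto simp: arc_between_def)
  ultimately show False using a(2) by (auto simp: arc_between_def)
qed

text \<open>Exactly one arc of a theta curve lies inside the closed curve formed by the other two.\<close>

lemma theta_winding_nonzero:
  assumes a: "arc_between p q a0" "arc_between p q a1" "arc_between p q a2"
    and i: "path_image a0 \<inter> path_image a1 = {p, q}" "path_image a0 \<inter> path_image a2 = {p, q}"
      "path_image a1 \<inter> path_image a2 = {p, q}"
    and z: "z0 \<in> path_image a0 - {p, q}" "z1 \<in> path_image a1 - {p, q}" "z2 \<in> path_image a2 - {p, q}"
  shows "(winding_number a2 z1 - winding_number a0 z1) + (winding_number a0 z2 - winding_number a1 z2)
       + (winding_number a1 z0 - winding_number a2 z0) \<noteq> 0"
proof -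
  have zn: "z0 \<notin> path_image a1" "z0 \<notin> path_image a2" "z1 \<notin> path_image a0" "z1 \<notin> path_image a2"
    "z2 \<notin> path_image a0" "z2 \<notin> path_image a1" using z i by auto
  have i': "path_image a1 \<inter> path_image a0 = {p, q}" "path_image a2 \<inter> path_image a0 = {p, q}"
    "path_image a2 \<inter> path_image a1 = {p, q}" using i by auto
  let ?P1 = "z1 \<in> inside (path_image a2 \<union> path_image a0)"
  let ?P2 = "z2 \<in> inside (path_image a0 \<union> path_image a1)"
  let ?P0 = "z0 \<in> inside (path_image a1 \<union> path_image a2)"
  have w: "winding_number a2 z1 - winding_number a0 z1 \<noteq> 0 \<longleftrightarrow> ?P1"
    "winding_number a0 z2 - winding_number a1 z2 \<noteq> 0 \<longleftrightarrow> ?P2"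
    "winding_number a1 z0 - winding_number a2 z0 \<noteq> 0 \<longleftrightarrow> ?P0"
    by (rule winding_number_loop_inside[OF a(3) a(1) i'(2) zn(4,3)]
             winding_number_loop_inside[OF a(1) a(2) i(1) zn(5,6)]
             winding_number_loop_inside[OF a(2) a(3) i(3) zn(1,2)])+
  have e12: "\<not> (?P1 \<and> ?P2)"
    using theta_inside_exclusive[OF a(1) a(2) a(3) i, of z1 z2] z by (auto simp: Un_commute)
  have e10: "\<not> (?P1 \<and> ?P0)"
    using theta_inside_exclusive[OF a(3) a(2) a(1) i'(3) i'(2) i'(1), of z1 z0] z by (auto simp: Un_commute)
  have e20: "\<not> (?P2 \<and> ?P0)"
    using theta_inside_exclusive[OF a(2) a(3) a(1) i(3) i'(1) i'(2), of z2 z0] z by (auto simp: Un_commute)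
  \<comment> \<open>If no arc enters the region of the other two, take a point \<open>x\<close>
    inside \<open>a0\<close>, \<open>a1\<close>. The index differences of the three pairs at
    \<open>x\<close> are linearly related, so a second one is nonzero as well, and two of the three
    regions overlap.\<close>
  have some: "?P1 \<or> ?P2 \<or> ?P0"
  proof (rule ccontr)
    assume none: "\<not> (?P1 \<or> ?P2 \<or> ?P0)"
    \<comment> \<open>An arc without its ends is connected, so a single point decides on which side
      the whole arc lies.\<close>
    have d: "path_image c \<inter> inside (path_image b \<union> path_image b') = {}"
      if c: "arc_between p q c" "y \<in> path_image c - {p, q}" "y \<notin> inside (path_image b \<union> path_image b')"
       and i: "path_image c \<inter> path_image b = {p, q}" "path_image c \<inter> path_image b' = {p, q}" for c b b' y
    proof (rule ccontr)
      assume "\<not> ?thesis"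
      then obtain x where x: "x \<in> path_image c" "x \<in> inside (path_image b \<union> path_image b')" by auto
      have "x \<notin> path_image b \<union> path_image b'"
        using x(2) not_in_inside by blast
      then have x': "x \<in> path_image c - {p, q}" using x i by auto
      have "connected (path_image c - {p, q})"
        using connected_simple_path_endless[of c] c arc_imp_simple_path by (auto simp: arc_between_def)
      moreover have "path_image c - {p, q} \<subseteq> - (path_image b \<union> path_image b')" using i by auto
      ultimately have "connected_component (- (path_image b \<union> path_image b')) x y"
        using x' c unfolding connected_component_def by blast
      then show False using inside_same_component x c by blast
    qed
    have d2: "path_image a2 \<inter> inside (path_image a0 \<union> path_image a1) = {}"
      by (rule d[OF a(3) z(3) _ i'(2) i'(3)]) (use none in auto)
    have d1: "path_image a1 \<inter> inside (path_image a2 \<union> path_image a0) = {}"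
      by (rule d[OF a(2) z(2) _ i(3) i'(1)]) (use none in auto)
    have d0: "path_image a0 \<inter> inside (path_image a1 \<union> path_image a2) = {}"
      by (rule d[OF a(1) z(1) _ i(1) i(2)]) (use none in auto)
    have "inside (path_image a0 \<union> path_image a1) \<noteq> {}"
      using Jordan_inside_outside[OF arc_between_loop(1,2)[OF a(1,2) i(1)]] arc_between_loop(3)[OF a(1,2) i(1)] by simp
    then obtain x where x: "x \<in> inside (path_image a0 \<union> path_image a1)" by blast
    have xn: "x \<notin> path_image a0" "x \<notin> path_image a1" "x \<notin> path_image a2"
      using not_in_inside[OF x] x d2 by auto
    have "winding_number a0 x - winding_number a1 x \<noteq> 0"
      using winding_number_loop_inside[OF a(1,2) i(1) xn(1,2)] x by blast
    then have "winding_number a0 x - winding_number a2 x \<noteq> 0 \<or> winding_number a1 x - winding_number a2 x \<noteq> 0"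
      by auto
    then have "x \<in> inside (path_image a0 \<union> path_image a2) \<or> x \<in> inside (path_image a1 \<union> path_image a2)"
      using winding_number_loop_inside[OF a(1,3) i(2) xn(1,3)] winding_number_loop_inside[OF a(2,3) i(3) xn(2,3)] by blast
    then show False
    proof
      assume "x \<in> inside (path_image a0 \<union> path_image a2)"
      then show False using theta_faces_equal[OF a i d2 _ x] d1 by (simp add: Un_commute)
    next
      assume "x \<in> inside (path_image a1 \<union> path_image a2)"
      then show False
        using theta_faces_equal[OF a(2) a(1) a(3) i'(1) i(3) i(2) _ _ _ , of x] d0 d2 x by (simp add: Un_commute)
    qed
  qed
  have three: "(u::complex) + v + s \<noteq> 0" if h: "u \<noteq> 0 \<longleftrightarrow> ?P1" "v \<noteq> 0 \<longleftrightarrow> ?P2" "s \<noteq> 0 \<longleftrightarrow> ?P0" for u v s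
  proof -
    consider "u \<noteq> 0 \<and> v = 0 \<and> s = 0" | "u = 0 \<and> v \<noteq> 0 \<and> s = 0" | "u = 0 \<and> v = 0 \<and> s \<noteq> 0"
      using h e12 e10 e20 some by blast
    then show ?thesis by cases auto
  qed
  show ?thesis by (rule three[OF w])
qed

text \<open>The index of an open path varies with the point, but the difference for two paths with
  the same ends is the index of a closed curve, hence constant on connected sets off that curve.
  Test points can therefore be moved along arcs.\<close>

lemma winding_number_difference_eq:
  assumes "path g" "path h" "pathstart g = pathstart h" "pathfinish g = pathfinish h"
    and "connected S" "u \<in> S" "v \<in> S" "S \<inter> path_image g = {}" "S \<inter> path_image h = {}"
  shows "winding_number g u - winding_number h u = winding_number g v - winding_number h v"
proof -
  have w: "winding_number (g +++ reversepath h) x = winding_number g x - winding_number h x" if "x \<in> S" for x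
  proof -
    have "x \<notin> path_image g" "x \<notin> path_image h" using that assms by auto
    then show ?thesis using assms by (simp add: winding_number_join winding_number_reversepath)
  qed
  have "winding_number (g +++ reversepath h) u = winding_number (g +++ reversepath h) v"
    by (rule winding_number_eq[of _ _ S]) (use assms in \<open>auto simp: path_image_join\<close>)
  then show ?thesis using w assms by simp
qed

lemma arc_between_connected_minus:
  assumes "arc_between x y g"
  shows "connected (path_image g - {x, y})" "connected (path_image g - {y})" "connected (path_image g - {x})"
    "x \<in> path_image g" "y \<in> path_image g" "x \<noteq> y" "path_image g - {x, y} \<noteq> {}"
proof -
  have sp: "simple_path g" and ends: "pathstart g = x" "pathfinish g = y"
    using assms by (auto simp: arc_between_def arc_imp_simple_path)
  show 1: "connected (path_image g - {x, y})" and 2: "path_image g - {x, y} \<noteq> {}"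
    using connected_simple_path_endless[OF sp] nonempty_simple_path_endless[OF sp] ends by auto
  have cont: "continuous_on {0..1} g" using sp by (simp add: simple_path_def path_def)
  have inj: "inj_on g {0..1}" and g01: "g 0 = x" "g 1 = y"
    using assms by (auto simp: arc_between_def arc_def pathstart_def pathfinish_def)
  have "path_image g - {y} = g ` {0..<1}"
  proof -
    have "g u \<noteq> y" if "u \<in> {0..<1}" for u
      using inj_onD[OF inj, of u 1] g01 that by auto
    moreover have "{0..1} = insert 1 {0..<1::real}" by auto
    ultimately show ?thesis using g01 unfolding path_image_def by auto
  qed
  moreover have "connected (g ` {0..<1})"
    by (rule connected_continuous_image) (auto intro: continuous_on_subset[OF cont])
  ultimately show "connected (path_image g - {y})" by simp
  have "path_image g - {x} = g ` {0<..1}"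
  proof -
    have "g u \<noteq> x" if "u \<in> {0<..1}" for u
      using inj_onD[OF inj, of u 0] g01 that by auto
    moreover have "{0..1} = insert 0 {0<..1::real}" by auto
    ultimately show ?thesis using g01 unfolding path_image_def by auto
  qed
  moreover have "connected (g ` {0<..1})"
    by (rule connected_continuous_image) (auto intro: continuous_on_subset[OF cont])
  ultimately show "connected (path_image g - {x})" by simp
  show "x \<in> path_image g" "y \<in> path_image g" using ends by auto
  show "x \<noteq> y" using assms by (auto simp: arc_between_def dest: arc_distinct_ends)
qed

text \<open>The theta curve formed by \<open>a0\<close>, \<open>et m2 ez\<close>, \<open>es m1 ey\<close> and the one formed by
  \<open>a0\<close>, \<open>et m4 ey\<close>, \<open>es m3 ez\<close> have the same orientation near \<open>p\<close> and opposite orientations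
  near \<open>q\<close>; the orientation is the nonzero winding number sum of the previous lemma.\<close>

lemma crossing_theta_curves:
  assumes a0: "arc_between p q a0"
    and e: "arc_between p s es" "arc_between p t et" "arc_between y q ey" "arc_between z q ez"
    and m: "arc_between s y m1" "arc_between t z m2" "arc_between s z m3" "arc_between t y m4"
    and A1: "arc_between p q (et +++ (m2 +++ ez))" and A2: "arc_between p q (es +++ (m1 +++ ey))"
    and B1: "arc_between p q (et +++ (m4 +++ ey))" and B2: "arc_between p q (es +++ (m3 +++ ez))"
    and i: "path_image a0 \<inter> path_image (et +++ (m2 +++ ez)) = {p, q}"
      "path_image a0 \<inter> path_image (es +++ (m1 +++ ey)) = {p, q}"
      "path_image a0 \<inter> path_image (et +++ (m4 +++ ey)) = {p, q}"
      "path_image a0 \<inter> path_image (es +++ (m3 +++ ez)) = {p, q}"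
      "path_image (et +++ (m2 +++ ez)) \<inter> path_image (es +++ (m1 +++ ey)) = {p, q}"
      "path_image (et +++ (m4 +++ ey)) \<inter> path_image (es +++ (m3 +++ ez)) = {p, q}"
  shows False
proof -
  define A1' where "A1' = et +++ (m2 +++ ez)"
  define A2' where "A2' = es +++ (m1 +++ ey)"
  define B1' where "B1' = et +++ (m4 +++ ey)"
  define B2' where "B2' = es +++ (m3 +++ ez)"
  have ends: "pathstart es = p" "pathfinish es = s" "pathstart et = p" "pathfinish et = t"
    "pathstart ey = y" "pathfinish ey = q" "pathstart ez = z" "pathfinish ez = q"
    "pathstart m1 = s" "pathfinish m1 = y" "pathstart m2 = t" "pathfinish m2 = z"
    "pathstart m3 = s" "pathfinish m3 = z" "pathstart m4 = t" "pathfinish m4 = y"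
    "pathstart a0 = p" "pathfinish a0 = q"
    using e m a0 by (auto simp: arc_between_def)
  have arcs: "arc es" "arc et" "arc ey" "arc ez" "arc m1" "arc m2" "arc m3" "arc m4" "arc a0"
    using e m a0 by (auto simp: arc_between_def)
  then have paths: "path es" "path et" "path ey" "path ez" "path m1" "path m2" "path m3" "path m4" "path a0"
    by (auto simp: arc_imp_path)
  have im: "path_image A1' = path_image et \<union> (path_image m2 \<union> path_image ez)"
    "path_image A2' = path_image es \<union> (path_image m1 \<union> path_image ey)"
    "path_image B1' = path_image et \<union> (path_image m4 \<union> path_image ey)"
    "path_image B2' = path_image es \<union> (path_image m3 \<union> path_image ez)"
    unfolding A1'_def A2'_def B1'_def B2'_def by (simp_all add: path_image_join ends)
  have pA: "path A1'" "path A2'" "path B1'" "path B2'"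
    unfolding A1'_def A2'_def B1'_def B2'_def using paths ends by auto
  have eA: "pathstart A1' = p" "pathstart A2' = p" "pathstart B1' = p" "pathstart B2' = p"
    "pathfinish A1' = q" "pathfinish A2' = q" "pathfinish B1' = q" "pathfinish B2' = q"
    unfolding A1'_def A2'_def B1'_def B2'_def using ends by auto
  note i' = i[folded A1'_def A2'_def B1'_def B2'_def]
  note AB = A1[folded A1'_def] A2[folded A2'_def] B1[folded B1'_def] B2[folded B2'_def]
  have meet: "path_image g \<inter> (path_image h \<union> path_image k) \<subseteq> {pathstart h} \<and> path_image h \<inter> path_image k \<subseteq> {pathstart k}"
    if "arc (g +++ (h +++ k))" "pathfinish g = pathstart h" "pathfinish h = pathstart k"
    for g h k :: "real \<Rightarrow> complex"
    using that by (simp add: arc_join_eq path_image_join)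
  have mt: "path_image et \<inter> (path_image m2 \<union> path_image ez) \<subseteq> {t}" "path_image m2 \<inter> path_image ez \<subseteq> {z}"
    "path_image es \<inter> (path_image m1 \<union> path_image ey) \<subseteq> {s}" "path_image m1 \<inter> path_image ey \<subseteq> {y}"
    "path_image et \<inter> (path_image m4 \<union> path_image ey) \<subseteq> {t}" "path_image m4 \<inter> path_image ey \<subseteq> {y}"
    "path_image es \<inter> (path_image m3 \<union> path_image ez) \<subseteq> {s}" "path_image m3 \<inter> path_image ez \<subseteq> {z}"
    using meet[of et m2 ez] meet[of es m1 ey] meet[of et m4 ey] meet[of es m3 ez] A1 A2 B1 B2 ends
    by (simp_all add: arc_between_def)
  note ce = arc_between_connected_minus
  have mem: "p \<in> path_image es" "p \<in> path_image et" "s \<in> path_image es" "t \<in> path_image et"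
    "q \<in> path_image ey" "q \<in> path_image ez" "y \<in> path_image ey" "z \<in> path_image ez"
    "p \<in> path_image a0" "q \<in> path_image a0"
    "s \<in> path_image m1" "y \<in> path_image m1" "t \<in> path_image m2" "z \<in> path_image m2"
    "s \<in> path_image m3" "z \<in> path_image m3" "t \<in> path_image m4" "y \<in> path_image m4"
    using e m a0 ce(4,5) by blast+
  have neq: "p \<noteq> q" "p \<noteq> s" "p \<noteq> t" "y \<noteq> q" "z \<noteq> q" "s \<noteq> y" "t \<noteq> z"
    using ce(6)[OF a0] ce(6)[OF e(1)] ce(6)[OF e(2)] ce(6)[OF e(3)] ce(6)[OF e(4)] ce(6)[OF m(1)] ce(6)[OF m(2)] by auto
  have npq: "p \<notin> path_image m1" "p \<notin> path_image m2" "p \<notin> path_image m3" "p \<notin> path_image m4"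
     "p \<notin> path_image ey" "p \<notin> path_image ez"
     "q \<notin> path_image m1" "q \<notin> path_image m2" "q \<notin> path_image m3" "q \<notin> path_image m4"
  proof -
    show "p \<notin> path_image m1" "p \<notin> path_image ey" using mt(3) mem(1) neq(2) by auto
    show "p \<notin> path_image m2" "p \<notin> path_image ez" using mt(1) mem(2) neq(3) by auto
    show "p \<notin> path_image m3" using mt(7) mem(1) neq(2) by auto
    show "p \<notin> path_image m4" using mt(5) mem(2) neq(3) by auto
    show "q \<notin> path_image m1" using mt(4) mem(5) neq(4) by auto
    show "q \<notin> path_image m4" using mt(6) mem(5) neq(4) by auto
    show "q \<notin> path_image m2" using mt(2) mem(6) neq(5) by auto
    show "q \<notin> path_image m3" using mt(8) mem(6) neq(5) by auto
  qed
  have "s \<noteq> q" "t \<noteq> q" using npq(7,8) mem(11,13) by auto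
  then have nq: "q \<notin> path_image es" "q \<notin> path_image et"
    using mt(3) mt(1) mem(5,6) by auto
  have sep: "U \<inter> W = {}" if "X \<inter> Y = {p, q}" "U \<subseteq> X" "W \<subseteq> Y" "p \<notin> U \<or> p \<notin> W" "q \<notin> U \<or> q \<notin> W" for U W X Y :: "complex set"
  proof -
    have "U \<inter> W \<subseteq> {p, q}" unfolding that(1)[symmetric] using that(2,3) by auto
    then show ?thesis using that(4,5) by auto
  qed
  have sub: "path_image et \<subseteq> path_image A1'" "path_image m2 \<union> path_image ez \<subseteq> path_image A1'"
     "path_image et \<union> path_image m2 \<subseteq> path_image A1'" "path_image ez \<subseteq> path_image A1'"
     "path_image es \<subseteq> path_image A2'" "path_image m1 \<union> path_image ey \<subseteq> path_image A2'"
     "path_image es \<union> path_image m1 \<subseteq> path_image A2'" "path_image ey \<subseteq> path_image A2'"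
     "path_image et \<subseteq> path_image B1'" "path_image m4 \<union> path_image ey \<subseteq> path_image B1'"
     "path_image et \<union> path_image m4 \<subseteq> path_image B1'" "path_image ey \<subseteq> path_image B1'"
     "path_image es \<subseteq> path_image B2'" "path_image m3 \<union> path_image ez \<subseteq> path_image B2'"
     "path_image es \<union> path_image m3 \<subseteq> path_image B2'" "path_image ez \<subseteq> path_image B2'"
    unfolding im by auto
  have i'': "path_image A2' \<inter> path_image A1' = {p, q}" "path_image B2' \<inter> path_image B1' = {p, q}"
    using i'(5,6) by auto
  have dj: "path_image et \<inter> (path_image m3 \<union> path_image ez) = {}" "path_image et \<inter> (path_image m1 \<union> path_image ey) = {}"
    "path_image es \<inter> (path_image m4 \<union> path_image ey) = {}" "path_image es \<inter> (path_image m2 \<union> path_image ez) = {}"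
    "path_image ez \<inter> (path_image es \<union> path_image m1) = {}" "path_image ez \<inter> (path_image et \<union> path_image m4) = {}"
    "path_image ey \<inter> (path_image es \<union> path_image m3) = {}" "path_image ey \<inter> (path_image et \<union> path_image m2) = {}"
    by (rule sep[OF i'(6) sub(9,14)] sep[OF i'(5) sub(1,6)] sep[OF i''(2) sub(13,10)] sep[OF i''(1) sub(5,2)]
             sep[OF i'(5) sub(4,7)] sep[OF i''(2) sub(16,11)] sep[OF i'(6) sub(12,15)] sep[OF i''(1) sub(8,3)];
        use npq nq in simp)+
  have sep0: "(a - {z}) \<inter> W = {}" if "a \<inter> Y = {p, q}" "W \<subseteq> Y" "z = p \<and> q \<notin> W \<or> z = q \<and> p \<notin> W" for a W Y :: "complex set" and z
  proof -
    have "a \<inter> W \<subseteq> {p, q}" unfolding that(1)[symmetric] using that(2) by auto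
    then show ?thesis using that(3) by auto
  qed
  have dj0: "(path_image a0 - {q}) \<inter> (path_image m3 \<union> path_image ez) = {}" "(path_image a0 - {q}) \<inter> (path_image m1 \<union> path_image ey) = {}"
    "(path_image a0 - {q}) \<inter> (path_image m4 \<union> path_image ey) = {}" "(path_image a0 - {q}) \<inter> (path_image m2 \<union> path_image ez) = {}"
    "(path_image a0 - {p}) \<inter> (path_image es \<union> path_image m1) = {}" "(path_image a0 - {p}) \<inter> (path_image et \<union> path_image m4) = {}"
    "(path_image a0 - {p}) \<inter> (path_image es \<union> path_image m3) = {}" "(path_image a0 - {p}) \<inter> (path_image et \<union> path_image m2) = {}"
    by (rule sep0[OF i'(4) sub(14)] sep0[OF i'(2) sub(6)] sep0[OF i'(3) sub(10)] sep0[OF i'(1) sub(2)]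
             sep0[OF i'(2) sub(7)] sep0[OF i'(3) sub(11)] sep0[OF i'(4) sub(15)] sep0[OF i'(1) sub(3)];
        use npq nq in simp)+
  \<comment> \<open>One test point inside each of the four end pieces, and the reference point
    \<open>\<beta>\<close> on the common arc \<open>a0\<close>.\<close>
  obtain \<tau> where \<tau>: "\<tau> \<in> path_image et - {p, t}" using ce(7)[OF e(2)] by blast
  obtain \<sigma> where \<sigma>: "\<sigma> \<in> path_image es - {p, s}" using ce(7)[OF e(1)] by blast
  obtain \<upsilon> where \<upsilon>: "\<upsilon> \<in> path_image ey - {y, q}" using ce(7)[OF e(3)] by blast
  obtain \<zeta> where \<zeta>: "\<zeta> \<in> path_image ez - {z, q}" using ce(7)[OF e(4)] by blast
  obtain \<beta> where \<beta>: "\<beta> \<in> path_image a0 - {p, q}" using ce(7)[OF a0] by blast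
  have pts: "\<tau> \<noteq> q" "\<sigma> \<noteq> q" "\<upsilon> \<noteq> p" "\<zeta> \<noteq> p" using \<tau> \<sigma> \<upsilon> \<zeta> nq npq by auto
  have split: "winding_number (g +++ (h +++ k)) x = winding_number g x + winding_number h x + winding_number k x"
    "winding_number (g +++ h) x = winding_number g x + winding_number h x"
    "winding_number (h +++ k) x = winding_number h x + winding_number k x"
    if "path g" "path h" "path k" "pathfinish g = pathstart h" "pathfinish h = pathstart k"
     "x \<notin> path_image g" "x \<notin> path_image h" "x \<notin> path_image k" for g h k x
    using that by (simp_all add: winding_number_join path_image_join)
  have off: "\<beta> \<notin> path_image es" "\<beta> \<notin> path_image et" "\<beta> \<notin> path_image ey" "\<beta> \<notin> path_image ez"
    "\<beta> \<notin> path_image m1" "\<beta> \<notin> path_image m2" "\<beta> \<notin> path_image m3" "\<beta> \<notin> path_image m4"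
    using \<beta> dj0 by blast+
  have off\<tau>: "\<tau> \<notin> path_image es" "\<tau> \<notin> path_image ey" "\<tau> \<notin> path_image ez"
    "\<tau> \<notin> path_image m1" "\<tau> \<notin> path_image m3" "\<tau> \<notin> path_image a0"
    using \<tau> pts(1) dj(1,2) sub(1,5) i'(1) i'(5) by blast+
  have off\<sigma>: "\<sigma> \<notin> path_image et" "\<sigma> \<notin> path_image ey" "\<sigma> \<notin> path_image ez"
    "\<sigma> \<notin> path_image m2" "\<sigma> \<notin> path_image m4" "\<sigma> \<notin> path_image a0"
    using \<sigma> pts(2) dj(3,4) sub(1,5) i'(2) i'(5) by blast+
  have off\<upsilon>: "\<upsilon> \<notin> path_image et" "\<upsilon> \<notin> path_image es" "\<upsilon> \<notin> path_image ez"
    "\<upsilon> \<notin> path_image m2" "\<upsilon> \<notin> path_image m3" "\<upsilon> \<notin> path_image a0"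
    using \<upsilon> pts(3) dj(7,8) sub(4,8) i'(2) i'(5) by blast+
  have off\<zeta>: "\<zeta> \<notin> path_image et" "\<zeta> \<notin> path_image es" "\<zeta> \<notin> path_image ey"
    "\<zeta> \<notin> path_image m1" "\<zeta> \<notin> path_image m4" "\<zeta> \<notin> path_image a0"
    using \<zeta> pts(4) dj(5,6) sub(4,8) i'(1) i'(5) by blast+
  have c0: "connected (path_image A1' - {p, q})" "connected (path_image A2' - {p, q})"
    "connected (path_image B1' - {p, q})" "connected (path_image B2' - {p, q})"
    using ce(1) AB by blast+
  have cp: "connected ((path_image et - {t}) \<union> (path_image a0 - {q}))"
      "connected ((path_image es - {s}) \<union> (path_image a0 - {q}))"
      "connected ((path_image ez - {z}) \<union> (path_image a0 - {p}))"
      "connected ((path_image ey - {y}) \<union> (path_image a0 - {p}))"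
    by (rule connected_Un[OF ce(2)[OF e(2)] ce(2)[OF a0]] connected_Un[OF ce(2)[OF e(1)] ce(2)[OF a0]]
             connected_Un[OF ce(3)[OF e(4)] ce(3)[OF a0]] connected_Un[OF ce(3)[OF e(3)] ce(3)[OF a0]];
        use mem neq in blast)+
  let ?W = winding_number
  let ?e1 = "(?W A2' \<tau> - ?W a0 \<tau>) + (?W a0 \<sigma> - ?W A1' \<sigma>) + (?W A1' \<beta> - ?W A2' \<beta>)"
  let ?e2 = "(?W B2' \<tau> - ?W a0 \<tau>) + (?W a0 \<sigma> - ?W B1' \<sigma>) + (?W B1' \<beta> - ?W B2' \<beta>)"
  have nz: "?e1 \<noteq> 0"
    by (rule theta_winding_nonzero[OF a0 AB(1,2) i'(1,2,5)]) (use \<tau> \<sigma> \<beta> pts im in simp_all)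
  \<comment> \<open>In the first curve \<open>\<tau>\<close> and \<open>\<zeta>\<close> lie on the
    same arc \<open>A1'\<close>, so the test point slides from the end at \<open>p\<close> to the
    end at \<open>q\<close>. In the second curve \<open>\<tau>\<close> slides to
    \<open>\<upsilon>\<close> instead: this is the exchange at \<open>q\<close>.\<close>
  have r1: "?W A2' \<tau> - ?W a0 \<tau> = ?W A2' \<zeta> - ?W a0 \<zeta>"
    by (rule winding_number_difference_eq[OF _ _ _ _ c0(1)]) (use pA paths(9) eA ends(17,18) \<tau> \<zeta> pts im i'(1) i'(5) in \<open>simp_all, blast+\<close>)
  have r2: "?W a0 \<sigma> - ?W A1' \<sigma> = ?W a0 \<upsilon> - ?W A1' \<upsilon>"
    by (rule winding_number_difference_eq[OF _ _ _ _ c0(2)]) (use pA paths(9) eA ends(17,18) \<sigma> \<upsilon> pts im i'(2) i'(5) in \<open>simp_all, blast+\<close>)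
  have r3: "?W B2' \<tau> - ?W a0 \<tau> = ?W B2' \<upsilon> - ?W a0 \<upsilon>"
    by (rule winding_number_difference_eq[OF _ _ _ _ c0(3)]) (use pA paths(9) eA ends(17,18) \<tau> \<upsilon> pts im i'(3) i'(6) in \<open>simp_all, blast+\<close>)
  have r4: "?W a0 \<sigma> - ?W B1' \<sigma> = ?W a0 \<zeta> - ?W B1' \<zeta>"
    by (rule winding_number_difference_eq[OF _ _ _ _ c0(4)]) (use pA paths(9) eA ends(17,18) \<sigma> \<zeta> pts im i'(4) i'(6) in \<open>simp_all, blast+\<close>)
  \<comment> \<open>\<open>A2'\<close> and \<open>B2'\<close> share \<open>es\<close>, so comparing
    them at \<open>\<tau>\<close> involves only their parts from \<open>s\<close> to
    \<open>q\<close>. These avoid the connected set formed by \<open>et\<close> and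
    \<open>a0\<close> near \<open>p\<close>, along which \<open>\<tau>\<close> moves to
    \<open>\<beta>\<close>. The facts \<open>k3\<close> and \<open>k4\<close> do the same near
    \<open>q\<close>.\<close>
  have k1: "?W (m3 +++ ez) \<tau> - ?W (m1 +++ ey) \<tau> = ?W (m3 +++ ez) \<beta> - ?W (m1 +++ ey) \<beta>"
    by (rule winding_number_difference_eq[OF _ _ _ _ cp(1)])
       (use paths ends \<tau> \<beta> dj(1,2) dj0(1,2) in \<open>simp_all add: path_image_join Int_Un_distrib2\<close>, blast+)
  have k2: "?W (m4 +++ ey) \<sigma> - ?W (m2 +++ ez) \<sigma> = ?W (m4 +++ ey) \<beta> - ?W (m2 +++ ez) \<beta>"
    by (rule winding_number_difference_eq[OF _ _ _ _ cp(2)])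
       (use paths ends \<sigma> \<beta> dj(3,4) dj0(3,4) in \<open>simp_all add: path_image_join Int_Un_distrib2\<close>, blast+)
  have k3: "?W (es +++ m1) \<zeta> - ?W (et +++ m4) \<zeta> = ?W (es +++ m1) \<beta> - ?W (et +++ m4) \<beta>"
    by (rule winding_number_difference_eq[OF _ _ _ _ cp(3)])
       (use paths ends \<zeta> \<beta> dj(5,6) dj0(5,6) in \<open>simp_all add: path_image_join Int_Un_distrib2\<close>, blast+)
  have k4: "?W (es +++ m3) \<upsilon> - ?W (et +++ m2) \<upsilon> = ?W (es +++ m3) \<beta> - ?W (et +++ m2) \<beta>"
    by (rule winding_number_difference_eq[OF _ _ _ _ cp(4)])
       (use paths ends \<upsilon> \<beta> dj(7,8) dj0(7,8) in \<open>simp_all add: path_image_join Int_Un_distrib2\<close>, blast+)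
  have j1: "?W B2' \<tau> - ?W A2' \<tau> = ?W B2' \<beta> - ?W A2' \<beta>"
    using k1 off off\<tau> paths ends unfolding B2'_def A2'_def by (simp add: split) (simp add: algebra_simps)?
  have j2: "?W B1' \<sigma> - ?W A1' \<sigma> = ?W B1' \<beta> - ?W A1' \<beta>"
    using k2 off off\<sigma> paths ends unfolding B1'_def A1'_def by (simp add: split) (simp add: algebra_simps)?
  have j3: "?W A2' \<zeta> - ?W B1' \<zeta> = ?W A2' \<beta> - ?W B1' \<beta>"
    using k3 off off\<zeta> paths ends unfolding B1'_def A2'_def by (simp add: split) (simp add: algebra_simps)?
  have j4: "?W B2' \<upsilon> - ?W A1' \<upsilon> = ?W B2' \<beta> - ?W A1' \<beta>"
    using k4 off off\<upsilon> paths ends unfolding A1'_def B2'_def by (simp add: split) (simp add: algebra_simps)?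
  \<comment> \<open>The comparison near \<open>p\<close> makes the two orientation sums equal, the
    comparison near \<open>q\<close> makes them negatives of each other, so both would
    vanish.\<close>
  have h1: "?e2 - ?e1 = (?W B2' \<tau> - ?W A2' \<tau>) - (?W B1' \<sigma> - ?W A1' \<sigma>) + (?W B1' \<beta> - ?W A1' \<beta>) - (?W B2' \<beta> - ?W A2' \<beta>)"
    by (simp add: algebra_simps)
  have "?e2 - ?e1 = 0" unfolding h1 j1 j2 by simp
  then have s1: "?e2 = ?e1" by (simp only: right_minus_eq)
  have h2: "?e1 + ?e2 = (?W A2' \<zeta> - ?W B1' \<zeta>) + (?W B2' \<upsilon> - ?W A1' \<upsilon>) - (?W A2' \<beta> - ?W B1' \<beta>) - (?W B2' \<beta> - ?W A1' \<beta>)"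
    unfolding r1 r2 r3 r4 by (simp add: algebra_simps)
  have "?e1 + ?e2 = 0" unfolding h2 j3 j4 by simp
  then have "?e1 + ?e1 = 0" unfolding s1 .
  moreover have "x = 0" if "x + x = 0" for x :: complex using that by (simp flip: mult_2)
  ultimately show False using nz by blast
qed

section \<open>Crossing paths in plane graphs\<close>

text \<open>The body of \<open>planar\<close> with the vertex positions and arcs as parameters, so
  that one drawing can be fixed throughout an argument.\<close>

definition drawing :: "'a set \<Rightarrow> 'a set set \<Rightarrow> ('a \<Rightarrow> complex) \<Rightarrow> ('a set \<Rightarrow> real \<Rightarrow> complex) \<Rightarrow> bool" where
  "drawing V E p \<gamma> \<longleftrightarrow> inj_on p V \<and>
     (\<forall>e\<in>E. \<forall>u v. e = {u, v} \<longrightarrow>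
         arc (\<gamma> e) \<and> {pathstart (\<gamma> e), pathfinish (\<gamma> e)} = {p u, p v}) \<and>
     (\<forall>e\<in>E. path_image (\<gamma> e) \<inter> p ` V = p ` e) \<and>
     (\<forall>e\<in>E. \<forall>f\<in>E. e \<noteq> f \<longrightarrow> path_image (\<gamma> e) \<inter> path_image (\<gamma> f) \<subseteq> p ` (e \<inter> f))"

lemma planar_drawing: "planar V E \<longleftrightarrow> (\<exists>p \<gamma>. drawing V E p \<gamma>)"
  unfolding planar_def drawing_def ..

lemma drawing_arc:
  "drawing V E p \<gamma> \<Longrightarrow> {u, v} \<in> E \<Longrightarrow> arc (\<gamma> {u, v})"
  "drawing V E p \<gamma> \<Longrightarrow> {u, v} \<in> E \<Longrightarrow>
     {pathstart (\<gamma> {u, v}), pathfinish (\<gamma> {u, v})} = {p u, p v}"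
  by (simp_all add: drawing_def)

lemma drawing_meet:
  "drawing V E p \<gamma> \<Longrightarrow> e \<in> E \<Longrightarrow> f \<in> E \<Longrightarrow> e \<noteq> f \<Longrightarrow>
     path_image (\<gamma> e) \<inter> path_image (\<gamma> f) \<subseteq> p ` (e \<inter> f)"
  by (simp add: drawing_def)

definition gpath :: "'a set set \<Rightarrow> 'a \<Rightarrow> 'a \<Rightarrow> 'a list \<Rightarrow> bool" where
  "gpath E x y xs \<longleftrightarrow> xs \<noteq> [] \<and> hd xs = x \<and> last xs = y \<and> distinct xs \<and> successively (\<lambda>u v. {u, v} \<in> E) xs"

lemma gpath_ends: "gpath E x y xs \<Longrightarrow> x \<in> set xs" "gpath E x y xs \<Longrightarrow> y \<in> set xs"
  by (auto simp: gpath_def)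

definition edge_image :: "('a set \<Rightarrow> real \<Rightarrow> complex) \<Rightarrow> 'a set set \<Rightarrow> complex set" where
  "edge_image \<gamma> F = (\<Union>e\<in>F. path_image (\<gamma> e))"

definition edges_within :: "'a set set \<Rightarrow> 'a set \<Rightarrow> 'a set set" where
  "edges_within E X = {e \<in> E. e \<subseteq> X}"

lemma edge_image_meet:
  assumes d: "drawing V E p \<gamma>" and "F \<subseteq> E" "F' \<subseteq> E"
    and ef: "\<And>e f. e \<in> F \<Longrightarrow> f \<in> F' \<Longrightarrow> e \<noteq> f \<and> e \<inter> f \<subseteq> S"
  shows "edge_image \<gamma> F \<inter> edge_image \<gamma> F' \<subseteq> p ` S"
proof
  fix x assume "x \<in> edge_image \<gamma> F \<inter> edge_image \<gamma> F'"
  then obtain e f where e: "e \<in> F" "x \<in> path_image (\<gamma> e)" and f: "f \<in> F'" "x \<in> path_image (\<gamma> f)"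
    unfolding edge_image_def by auto
  have "path_image (\<gamma> e) \<inter> path_image (\<gamma> f) \<subseteq> p ` (e \<inter> f)"
    using drawing_meet[OF d] e(1) f(1) ef[OF e(1) f(1)] assms(2,3) by blast
  then show "x \<in> p ` S" using e f ef[OF e(1) f(1)] by blast
qed

text \<open>A drawing leaves the direction of the arc of an edge open; reversing it if necessary
  settles this.\<close>

lemma drawing_edge_arc:
  assumes d: "drawing V E p \<gamma>" and e: "{u, v} \<in> E"
  obtains g where "arc_between (p u) (p v) g" "path_image g = path_image (\<gamma> {u, v})"
proof -
  have a: "arc (\<gamma> {u, v})" "{pathstart (\<gamma> {u, v}), pathfinish (\<gamma> {u, v})} = {p u, p v}"
    using drawing_arc[OF d e] by auto
  show ?thesis
  proof (cases "pathstart (\<gamma> {u, v}) = p u \<and> pathfinish (\<gamma> {u, v}) = p v")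
    case True
    then show ?thesis using a that by (auto simp: arc_between_def)
  next
    case False
    then have "pathstart (\<gamma> {u, v}) = p v" "pathfinish (\<gamma> {u, v}) = p u"
      using a(2) by (auto simp: doubleton_eq_iff)
    then show ?thesis using a that[of "reversepath (\<gamma> {u, v})"]
      by (auto simp: arc_between_def arc_reversepath)
  qed
qed

text \<open>The image is bounded by all edges spanned by the vertices of the path, since paths will
  be kept apart by disjoint vertex sets only. As \<open>x\<close> does not recur, the first edge
  meets the remaining arc only in its end.\<close>

lemma gpath_arc:
  assumes d: "drawing V E p \<gamma>"
  shows "gpath E x y xs \<Longrightarrow> x \<noteq> y \<Longrightarrow>
    \<exists>g. arc_between (p x) (p y) g \<and> path_image g \<subseteq> edge_image \<gamma> (edges_within E (set xs))"
proof (induction xs arbitrary: x)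
  case Nil
  then show ?case by (simp add: gpath_def)
next
  case (Cons a xs)
  then have a: "a = x" and "xs \<noteq> []" by (auto simp: gpath_def)
  then obtain b ys where xs: "xs = b # ys" by (cases xs) auto
  have e: "{x, b} \<in> E" and tail: "gpath E b y xs" and x: "x \<notin> set xs"
    using Cons.prems a xs by (auto simp: gpath_def)
  obtain g where g: "arc_between (p x) (p b) g" "path_image g = path_image (\<gamma> {x, b})"
    using drawing_edge_arc[OF d e] .
  have gE: "path_image g = edge_image \<gamma> {{x, b}}" using g by (simp add: edge_image_def)
  have sub: "edge_image \<gamma> {{x, b}} \<subseteq> edge_image \<gamma> (edges_within E (set (a # xs)))"
    using e a xs unfolding edge_image_def edges_within_def by auto
  show ?case
  proof (cases "b = y")
    case True
    then show ?thesis using g gE sub by auto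
  next
    case False
    then obtain h where h: "arc_between (p b) (p y) h" "path_image h \<subseteq> edge_image \<gamma> (edges_within E (set xs))"
      using Cons.IH[OF tail] by blast
    have "edge_image \<gamma> {{x, b}} \<inter> edge_image \<gamma> (edges_within E (set xs)) \<subseteq> p ` {b}"
      by (rule edge_image_meet[OF d]) (use e x in \<open>auto simp: edges_within_def\<close>)
    then have "path_image g \<inter> path_image h \<subseteq> {p b}" using gE h by auto
    then have "arc_between (p x) (p y) (g +++ h)" using arc_between_join g h by blast
    moreover have "path_image (g +++ h) \<subseteq> edge_image \<gamma> (edges_within E (set (a # xs)))"
    proof -
      have "path_image (g +++ h) \<subseteq> path_image g \<union> path_image h" by (rule path_image_join_subset)
      moreover have "edge_image \<gamma> (edges_within E (set xs)) \<subseteq> edge_image \<gamma> (edges_within E (set (a # xs)))"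
        unfolding edge_image_def edges_within_def by auto
      ultimately show ?thesis using gE h sub by blast
    qed
    ultimately show ?thesis by blast
  qed
qed

text \<open>Supplies one arc of a theta curve with ends \<open>P\<close> and \<open>Q\<close>: an
  edge at each end and a chain in between. As \<open>P\<close> and \<open>Q\<close> lie outside
  \<open>X\<close>, consecutive pieces meet only where they are joined.\<close>

lemma drawing_strand:
  assumes d: "drawing V E p \<gamma>" and e: "{P, s} \<in> E" "{y, Q} \<in> E"
    and es: "arc_between (p P) (p s) es" "path_image es = path_image (\<gamma> {P, s})"
    and ey: "arc_between (p y) (p Q) ey" "path_image ey = path_image (\<gamma> {y, Q})"
    and m: "arc_between (p s) (p y) m" "path_image m \<subseteq> edge_image \<gamma> (edges_within E X)"
    and X: "s \<in> X" "y \<in> X" "P \<notin> X" "Q \<notin> X" "P \<noteq> Q" "s \<noteq> y"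
  shows "arc_between (p P) (p Q) (es +++ (m +++ ey))"
    "path_image (es +++ (m +++ ey)) \<subseteq> edge_image \<gamma> ({{P, s}, {y, Q}} \<union> edges_within E X)"
    "{p P, p Q} \<subseteq> path_image (es +++ (m +++ ey))"
proof -
  have i1: "path_image es = edge_image \<gamma> {{P, s}}" "path_image ey = edge_image \<gamma> {{y, Q}}"
    using es ey by (auto simp: edge_image_def)
  have "edge_image \<gamma> (edges_within E X) \<inter> edge_image \<gamma> {{y, Q}} \<subseteq> p ` {y}"
    by (rule edge_image_meet[OF d]) (use e X in \<open>auto simp: edges_within_def\<close>)
  then have "path_image m \<inter> path_image ey \<subseteq> {p y}" using m i1 by auto
  then have my: "arc_between (p s) (p Q) (m +++ ey)" using arc_between_join m ey by blast
  have im: "path_image (m +++ ey) = path_image m \<union> path_image ey"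
    using m ey by (auto simp: path_image_join arc_between_def)
  have "edge_image \<gamma> {{P, s}} \<inter> edge_image \<gamma> (insert {y, Q} (edges_within E X)) \<subseteq> p ` {s}"
    by (rule edge_image_meet[OF d]) (use e X in \<open>auto simp: edges_within_def\<close>)
  moreover have "path_image (m +++ ey) \<subseteq> edge_image \<gamma> (insert {y, Q} (edges_within E X))"
    unfolding im i1 using m by (auto simp: edge_image_def)
  ultimately have "path_image es \<inter> path_image (m +++ ey) \<subseteq> {p s}" using i1 by auto
  then show A: "arc_between (p P) (p Q) (es +++ (m +++ ey))" using arc_between_join es my by blast
  have "path_image (es +++ (m +++ ey)) = path_image es \<union> (path_image m \<union> path_image ey)"
    using es my im by (auto simp: path_image_join arc_between_def)
  then show "path_image (es +++ (m +++ ey)) \<subseteq> edge_image \<gamma> ({{P, s}, {y, Q}} \<union> edges_within E X)"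
    using m i1 by (auto simp: edge_image_def)
  show "{p P, p Q} \<subseteq> path_image (es +++ (m +++ ey))"
    using arc_between_connected_minus(4,5)[OF A] by simp
qed

text \<open>Contract the path \<open>ws\<close> to a point: its four neighbours \<open>s\<close>, \<open>t\<close>, \<open>y\<close>, \<open>z\<close> then cannot be
  linked disjointly both as \<open>s y | t z\<close> and as \<open>s z | t y\<close>.\<close>

lemma planar_crossing:
  assumes pl: "planar V E" and nE: "{} \<notin> E" and W: "gpath E P Q ws" "P \<noteq> Q"
    and e: "{P, s} \<in> E" "{P, t} \<in> E" "{y, Q} \<in> E" "{z, Q} \<in> E"
    and x: "gpath E s y xs1" "gpath E t z xs2" "gpath E s z xs3" "gpath E t y xs4"
    and dj: "set xs1 \<inter> set xs2 = {}" "set xs3 \<inter> set xs4 = {}"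
      "(set xs1 \<union> set xs2 \<union> set xs3 \<union> set xs4) \<inter> set ws = {}"
  shows False
proof -
  obtain p \<gamma> where d: "drawing V E p \<gamma>" using pl unfolding planar_drawing by blast
  have m: "s \<in> set xs1" "y \<in> set xs1" "t \<in> set xs2" "z \<in> set xs2" "s \<in> set xs3" "z \<in> set xs3"
    "t \<in> set xs4" "y \<in> set xs4" "P \<in> set ws" "Q \<in> set ws"
    using x W gpath_ends by metis+
  have ne: "s \<noteq> y" "t \<noteq> z" "s \<noteq> z" "t \<noteq> y" "s \<noteq> t" "y \<noteq> z" using m dj by auto
  have PQ: "P \<notin> set xs1" "Q \<notin> set xs1" "P \<notin> set xs2" "Q \<notin> set xs2"
     "P \<notin> set xs3" "Q \<notin> set xs3" "P \<notin> set xs4" "Q \<notin> set xs4" using m dj by auto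
  obtain es where es: "arc_between (p P) (p s) es" "path_image es = path_image (\<gamma> {P, s})"
    using drawing_edge_arc[OF d e(1)] .
  obtain et where et: "arc_between (p P) (p t) et" "path_image et = path_image (\<gamma> {P, t})"
    using drawing_edge_arc[OF d e(2)] .
  obtain ey where ey: "arc_between (p y) (p Q) ey" "path_image ey = path_image (\<gamma> {y, Q})"
    using drawing_edge_arc[OF d e(3)] .
  obtain ez where ez: "arc_between (p z) (p Q) ez" "path_image ez = path_image (\<gamma> {z, Q})"
    using drawing_edge_arc[OF d e(4)] .
  obtain a0 where a0: "arc_between (p P) (p Q) a0" "path_image a0 \<subseteq> edge_image \<gamma> (edges_within E (set ws))"
    using gpath_arc[OF d W] by blast
  obtain m1 where m1: "arc_between (p s) (p y) m1" "path_image m1 \<subseteq> edge_image \<gamma> (edges_within E (set xs1))"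
    using gpath_arc[OF d x(1) ne(1)] by blast
  obtain m2 where m2: "arc_between (p t) (p z) m2" "path_image m2 \<subseteq> edge_image \<gamma> (edges_within E (set xs2))"
    using gpath_arc[OF d x(2) ne(2)] by blast
  obtain m3 where m3: "arc_between (p s) (p z) m3" "path_image m3 \<subseteq> edge_image \<gamma> (edges_within E (set xs3))"
    using gpath_arc[OF d x(3) ne(3)] by blast
  obtain m4 where m4: "arc_between (p t) (p y) m4" "path_image m4 \<subseteq> edge_image \<gamma> (edges_within E (set xs4))"
    using gpath_arc[OF d x(4) ne(4)] by blast
  note A2 = drawing_strand[OF d e(1,3) es ey m1 m(1,2) PQ(1,2) W(2) ne(1)]
  note A1 = drawing_strand[OF d e(2,4) et ez m2 m(3,4) PQ(3,4) W(2) ne(2)]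
  note B2 = drawing_strand[OF d e(1,4) es ez m3 m(5,6) PQ(5,6) W(2) ne(3)]
  note B1 = drawing_strand[OF d e(2,3) et ey m4 m(7,8) PQ(7,8) W(2) ne(4)]
  have ends: "{p P, p Q} \<subseteq> path_image a0" using arc_between_connected_minus(4,5)[OF a0(1)] by simp
  have meet: "path_image g \<inter> path_image h = {p P, p Q}"
    if g: "path_image g \<subseteq> edge_image \<gamma> F" "{p P, p Q} \<subseteq> path_image g" and h: "path_image h \<subseteq> edge_image \<gamma> F'" "{p P, p Q} \<subseteq> path_image h"
    and F: "F \<subseteq> E" "F' \<subseteq> E" and ef: "\<And>e f. e \<in> F \<Longrightarrow> f \<in> F' \<Longrightarrow> e \<noteq> f \<and> e \<inter> f \<subseteq> {P, Q}" for g h F F'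
    using edge_image_meet[OF d F ef] g h by fastforce
  \<comment> \<open>An edge spanned by \<open>X\<close> has an end in \<open>X\<close>, so disjoint
    vertex sets span disjoint sets of edges.\<close>
  have ex: "\<exists>v\<in>X. v \<in> g" if "g \<in> edges_within E X" for g X
  proof -
    have "g \<noteq> {}" "g \<subseteq> X" using that nE unfolding edges_within_def by auto
    then show ?thesis by auto
  qed
  have i0: "e \<noteq> f \<and> e \<inter> f \<subseteq> {P, Q}" if "e \<in> edges_within E (set ws)" "f \<in> {{P, a}, {b, Q}} \<union> edges_within E X"
    "X \<inter> set ws = {}" "a \<in> X" "b \<in> X" for e f a b X
  proof -
    have "\<exists>v\<in>X. v \<in> f" using ex[of f X] that(2,4,5) by auto
    then show ?thesis using that m(9,10) unfolding edges_within_def by auto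
  qed
  have i1: "e \<noteq> f \<and> e \<inter> f \<subseteq> {P, Q}" if "e \<in> {{P, a}, {b, Q}} \<union> edges_within E X" "f \<in> {{P, a'}, {b', Q}} \<union> edges_within E X'"
    "X \<inter> X' = {}" "a \<in> X" "b \<in> X" "a' \<in> X'" "b' \<in> X'" "P \<notin> X" "Q \<notin> X" "P \<notin> X'" "Q \<notin> X'" for e f a b X a' b' X'
  proof -
    have "\<exists>v\<in>X. v \<in> e" using ex[of e X] that(1,4,5) by auto
    moreover have "f \<subseteq> X' \<union> {P, Q}" "e \<subseteq> X \<union> {P, Q}" using that unfolding edges_within_def by auto
    ultimately show ?thesis using that(3,8,9) by auto
  qed
  have wE: "edges_within E X \<subseteq> E" for X by (auto simp: edges_within_def)
  have meet0: "path_image a0 \<inter> path_image h = {p P, p Q}"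
    if h: "path_image h \<subseteq> edge_image \<gamma> ({{P, a}, {b, Q}} \<union> edges_within E X)" "{p P, p Q} \<subseteq> path_image h"
      and X: "X \<inter> set ws = {}" "a \<in> X" "b \<in> X" and ab: "{P, a} \<in> E" "{b, Q} \<in> E" for h a b X
  proof (rule meet[OF a0(2) ends h wE])
    show "{{P, a}, {b, Q}} \<union> edges_within E X \<subseteq> E" using ab wE by auto
    fix e f assume "e \<in> edges_within E (set ws)" "f \<in> {{P, a}, {b, Q}} \<union> edges_within E X"
    then show "e \<noteq> f \<and> e \<inter> f \<subseteq> {P, Q}" by (rule i0) (fact X)+
  qed
  have meet1: "path_image g \<inter> path_image h = {p P, p Q}"
    if g: "path_image g \<subseteq> edge_image \<gamma> ({{P, a}, {b, Q}} \<union> edges_within E X)" "{p P, p Q} \<subseteq> path_image g"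
      and h: "path_image h \<subseteq> edge_image \<gamma> ({{P, a'}, {b', Q}} \<union> edges_within E X')" "{p P, p Q} \<subseteq> path_image h"
      and X: "X \<inter> X' = {}" "a \<in> X" "b \<in> X" "a' \<in> X'" "b' \<in> X'" "P \<notin> X" "Q \<notin> X" "P \<notin> X'" "Q \<notin> X'"
      and ab: "{P, a} \<in> E" "{b, Q} \<in> E" "{P, a'} \<in> E" "{b', Q} \<in> E" for g h a b X a' b' X'
  proof (rule meet[OF g h])
    show "{{P, a}, {b, Q}} \<union> edges_within E X \<subseteq> E" "{{P, a'}, {b', Q}} \<union> edges_within E X' \<subseteq> E"
      using ab wE by auto
    fix e f assume "e \<in> {{P, a}, {b, Q}} \<union> edges_within E X" "f \<in> {{P, a'}, {b', Q}} \<union> edges_within E X'"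
    then show "e \<noteq> f \<and> e \<inter> f \<subseteq> {P, Q}" by (rule i1) (fact X)+
  qed
  have dw: "set xs1 \<inter> set ws = {}" "set xs2 \<inter> set ws = {}" "set xs3 \<inter> set ws = {}" "set xs4 \<inter> set ws = {}"
    "set xs2 \<inter> set xs1 = {}" "set xs4 \<inter> set xs3 = {}" using dj by auto
  show False
    by (rule crossing_theta_curves[OF a0(1) es(1) et(1) ey(1) ez(1) m1(1) m2(1) m3(1) m4(1) A1(1) A2(1) B1(1) B2(1)
          meet0[OF A1(2,3) dw(2) m(3,4) e(2,4)] meet0[OF A2(2,3) dw(1) m(1,2) e(1,3)]
          meet0[OF B1(2,3) dw(4) m(7,8) e(2,3)] meet0[OF B2(2,3) dw(3) m(5,6) e(1,4)]
          meet1[OF A1(2,3) A2(2,3) dw(5) m(3,4,1,2) PQ(3,4,1,2) e(2,4,1,3)]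
          meet1[OF B1(2,3) B2(2,3) dw(6) m(7,8,5,6) PQ(7,8,5,6) e(2,3,1,4)]])
qed

section \<open>Kempe chains\<close>

definition nb :: "'a set set \<Rightarrow> 'a \<Rightarrow> 'a set" where
  "nb E v = {u. {v, u} \<in> E}"

locale subcubic_graph =
  fixes V :: "'a set" and E :: "'a set set"
  assumes finV: "finite V"
    and edgeE: "e \<in> E \<Longrightarrow> \<exists>u v. u \<in> V \<and> v \<in> V \<and> u \<noteq> v \<and> e = {u, v}"
    and deg3: "card (nb E v) \<le> 3"
begin

lemma nb_sym: "u \<in> nb E v \<longleftrightarrow> v \<in> nb E u"
  by (simp add: nb_def insert_commute)

lemma nb_irrefl [simp]: "v \<notin> nb E v"
  using edgeE[of "{v}"] by (auto simp: nb_def)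

lemma nb_subset: "nb E v \<subseteq> V"
  using edgeE by (fastforce simp: nb_def doubleton_eq_iff)

lemma nb_V: "u \<in> nb E v \<Longrightarrow> u \<in> V \<and> v \<in> V"
  using nb_subset nb_sym by blast

lemma fin_nb [simp]: "finite (nb E v)"
  using nb_subset finV finite_subset by blast

lemma empty_notin_E: "{} \<notin> E"
  using edgeE by fastforce

lemma nb_card_le: "X \<subseteq> nb E v \<Longrightarrow> card X \<le> 3"
  using card_mono[OF fin_nb] deg3 le_trans by blast

lemma nb_le_3: "\<lbrakk>a \<in> nb E v; b \<in> nb E v; c \<in> nb E v; d \<in> nb E v; a \<noteq> b; a \<noteq> c; b \<noteq> c\<rbrakk> \<Longrightarrow> d = a \<or> d = b \<or> d = c"
  using nb_card_le[of "{a, b, c, d}" v] by (auto simp: card_insert_if split: if_splits)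

end

text \<open>The neighbourhood of \<open>v\<close> in H. For independent \<open>B\<close>, passing
  from G to H replaces each vertex of \<open>B\<close> by edges between all its neighbours.\<close>

definition hnb :: "'a set set \<Rightarrow> 'a set \<Rightarrow> 'a \<Rightarrow> 'a set" where
  "hnb E B v = (nb E v - B) \<union> (\<Union>b \<in> nb E v \<inter> B. nb E b) - {v}"

definition grel :: "'a set set \<Rightarrow> 'a set \<Rightarrow> ('a \<times> 'a) set" where
  "grel E X = {(u, w). u \<in> X \<and> w \<in> X \<and> {u, w} \<in> E}"

lemma grel_gpath:
  assumes "(x, y) \<in> (grel E X)\<^sup>*" "x \<in> X"
  shows "\<exists>xs. gpath E x y xs \<and> set xs \<subseteq> X"
  using assms
proof (induction rule: converse_rtrancl_induct)
  case base
  then show ?case by (intro exI[of _ "[y]"]) (simp add: gpath_def)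
next
  case (step x z)
  then have xz: "x \<in> X" "z \<in> X" "{x, z} \<in> E" by (auto simp: grel_def)
  then obtain xs where xs: "gpath E z y xs" "set xs \<subseteq> X" using step by blast
  show ?case
  proof (cases "x \<in> set xs")
    case True
    then obtain as bs where "xs = as @ x # bs" by (meson split_list)
    then have "gpath E x y (x # bs)" "set (x # bs) \<subseteq> X"
      using xs by (auto simp: gpath_def successively_append_iff)
    then show ?thesis by blast
  next
    case False
    then have "gpath E x y (x # xs)" "set (x # xs) \<subseteq> X"
      using xs xz by (auto simp: gpath_def successively_Cons)
    then show ?thesis by blast
  qed
qed

section \<open>Colourings of H and their Kempe chains, realised in G\<close>

definition hcoloring :: "'a set set \<Rightarrow> 'a set \<Rightarrow> 'a set \<Rightarrow> ('a \<Rightarrow> nat) \<Rightarrow> bool" where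
  "hcoloring E B K \<phi> \<longleftrightarrow> (\<forall>v\<in>K. \<phi> v < 4) \<and> (\<forall>v\<in>K. \<forall>u\<in>hnb E B v \<inter> K. \<phi> u \<noteq> \<phi> v)"

context subcubic_graph
begin

lemma hnb_sym: "u \<in> hnb E B v \<Longrightarrow> u \<notin> B \<Longrightarrow> v \<notin> B \<Longrightarrow> v \<in> hnb E B u"
  unfolding hnb_def using nb_sym by blast

lemma hcoloring_extend:
  assumes \<phi>: "hcoloring E B C \<phi>" and C: "C \<inter> B = {}" "v \<notin> B" "v \<notin> C"
    and i: "i < 4" "\<forall>u\<in>hnb E B v \<inter> C. \<phi> u \<noteq> i"
  shows "hcoloring E B (insert v C) (\<phi>(v := i))"
proof -
  have "v \<notin> hnb E B v" by (simp add: hnb_def)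
  moreover have "\<phi> u \<noteq> i" if "u \<in> C" "v \<in> hnb E B u" for u
    using hnb_sym[of v B u] that i C by blast
  ultimately show ?thesis using \<phi> i C unfolding hcoloring_def by auto
qed

text \<open>\<open>T\<close> is a union of components of the subgraph of H on the colours
  \<open>i\<close> and \<open>j\<close>, so an edge of H leaving \<open>T\<close> ends in a third
  colour.\<close>

lemma kempe_swap:
  assumes \<phi>: "hcoloring E B C \<phi>" and C: "C \<inter> B = {}" and "i < 4" "j < 4"
    and T: "T \<subseteq> {u \<in> C. \<phi> u = i \<or> \<phi> u = j}"
    and closed: "\<And>a b. a \<in> T \<Longrightarrow> b \<in> hnb E B a \<inter> C \<Longrightarrow> \<phi> b = i \<or> \<phi> b = j \<Longrightarrow> b \<in> T"
  shows "hcoloring E B C (\<lambda>u. if u \<in> T then if \<phi> u = i then j else i else \<phi> u)"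
proof -
  let ?\<psi> = "\<lambda>u. if u \<in> T then if \<phi> u = i then j else i else \<phi> u"
  have "?\<psi> u \<noteq> ?\<psi> v" if v: "v \<in> C" and u: "u \<in> hnb E B v \<inter> C" for u v
  proof -
    have vu: "v \<in> hnb E B u \<inter> C" using hnb_sym[of u B v] u v C by blast
    have ne: "\<phi> u \<noteq> \<phi> v" using \<phi> u v unfolding hcoloring_def by blast
    have "u \<in> T \<Longrightarrow> v \<notin> T \<Longrightarrow> \<phi> v \<noteq> i \<and> \<phi> v \<noteq> j" "v \<in> T \<Longrightarrow> u \<notin> T \<Longrightarrow> \<phi> u \<noteq> i \<and> \<phi> u \<noteq> j"
      using closed[OF _ vu] closed[OF _ u] by blast+
    moreover have "u \<in> T \<Longrightarrow> \<phi> u = i \<or> \<phi> u = j" "v \<in> T \<Longrightarrow> \<phi> v = i \<or> \<phi> v = j" using T by blast+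
    ultimately show ?thesis using ne by (cases "u \<in> T"; cases "v \<in> T") auto
  qed
  moreover have "?\<psi> v < 4" if "v \<in> C" for v using that \<phi> assms(3,4) unfolding hcoloring_def by auto
  ultimately show ?thesis unfolding hcoloring_def by blast
qed

text \<open>The vertices of G through which a chain of H in the colours \<open>i\<close> and
  \<open>j\<close> can run. If two consecutive vertices of the chain are adjacent in H only through
  some \<open>b \<in> B\<close>, the chain runs through \<open>b\<close> in G, and \<open>b\<close>
  sees both colours.\<close>

definition chain_region :: "'a set \<Rightarrow> 'a set \<Rightarrow> ('a \<Rightarrow> nat) \<Rightarrow> nat \<Rightarrow> nat \<Rightarrow> 'a set" where
  "chain_region B C \<phi> i j = {u \<in> C. \<phi> u = i \<or> \<phi> u = j} \<union>
     {b \<in> B. (\<exists>u\<in>nb E b \<inter> C. \<phi> u = i) \<and> (\<exists>u\<in>nb E b \<inter> C. \<phi> u = j)}"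

text \<open>A common vertex in \<open>B\<close> would have four neighbours of four different
  colours.\<close>

lemma chain_region_disjoint:
  assumes "C \<inter> B = {}" "distinct [i, j, k, l]"
  shows "chain_region B C \<phi> i j \<inter> chain_region B C \<phi> k l = {}"
proof -
  have False if "{a, b, c, d} \<subseteq> nb E x" "\<phi> a = i" "\<phi> b = j" "\<phi> c = k" "\<phi> d = l" for x a b c d
  proof -
    have "distinct [a, b, c, d]" using that(2-5) assms(2) by auto
    then have "card {a, b, c, d} = 4" by simp
    then show False using nb_card_le[OF that(1)] by simp
  qed
  then have F: "\<lbrakk>a \<in> nb E x; b \<in> nb E x; c \<in> nb E x; d \<in> nb E x; \<phi> a = i; \<phi> b = j; \<phi> c = k; \<phi> d = l\<rbrakk> \<Longrightarrow> False" for x a b c d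
    by blast
  show ?thesis
  proof (rule ccontr)
    assume "\<not> ?thesis"
    then obtain x where x: "x \<in> chain_region B C \<phi> i j" "x \<in> chain_region B C \<phi> k l" by blast
    show False
    proof (cases "x \<in> B")
      case True
      then have "x \<notin> C" using assms(1) by blast
      then show False using x F[of _ x] unfolding chain_region_def by auto
    next
      case False
      then show False using x assms(2) unfolding chain_region_def by auto
    qed
  qed
qed

text \<open>When an edge of H comes from a vertex \<open>d\<close> of \<open>B\<close>, properness
  gives the two neighbours of \<open>d\<close> different colours, and this puts \<open>d\<close>
  into the region.\<close>

lemma chain_connected:
  assumes \<phi>: "hcoloring E B C \<phi>" and C: "C \<inter> B = {}"
    and st: "(a, b) \<in> {(a, b). a \<in> C \<and> b \<in> C \<and> b \<in> hnb E B a \<and> \<phi> a \<in> {i, j} \<and> \<phi> b \<in> {i, j}}\<^sup>*"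
  shows "(a, b) \<in> (grel E (chain_region B C \<phi> i j))\<^sup>*"
  using st
proof (induction rule: rtrancl_induct)
  case (step b c)
  then have bc: "b \<in> C" "c \<in> C" "c \<in> hnb E B b" "\<phi> b \<in> {i, j}" "\<phi> c \<in> {i, j}" by auto
  let ?X = "chain_region B C \<phi> i j"
  have X: "b \<in> ?X" "c \<in> ?X" using bc by (auto simp: chain_region_def)
  have "(b, c) \<in> (grel E ?X)\<^sup>*"
  proof (cases "c \<in> nb E b")
    case True
    then show ?thesis using X by (auto simp: grel_def nb_def)
  next
    case False
    then obtain d where d: "d \<in> nb E b" "d \<in> B" "c \<in> nb E d" using bc unfolding hnb_def by blast
    have "\<phi> b \<noteq> \<phi> c" using \<phi> bc unfolding hcoloring_def by (metis IntI)
    then have "d \<in> ?X" using d bc nb_sym[of d b] unfolding chain_region_def by auto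
    then have "(b, d) \<in> grel E ?X" "(d, c) \<in> grel E ?X" using X d by (auto simp: grel_def nb_def)
    then show ?thesis by (meson converse_rtrancl_into_rtrancl r_into_rtrancl)
  qed
  then show ?case using step.IH by (rule rtrancl_trans[rotated])
qed simp

text \<open>The edges at \<open>v\<close> and at its neighbours in \<open>B\<close> split the four differently coloured
  \<open>H\<close>-neighbours of \<open>v\<close> into two pairs. If no Kempe swap frees a colour, then all four chains
  between different pairs exist, contrary to \<open>planar_crossing\<close>. As vertices of \<open>B\<close> have degree at
  most 3, chains with disjoint colour pairs are disjoint also in \<open>G\<close>.\<close>

lemma kempe_extend:
  assumes pl: "planar V E" and B: "\<forall>b\<in>B. nb E b \<inter> B = {}"
    and \<phi>: "hcoloring E B C \<phi>" and C: "C \<inter> B = {}" "v \<notin> B" "v \<notin> C" "finite C"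
    and c4: "card (hnb E B v \<inter> C) \<le> 4"
  shows "\<exists>\<psi>. hcoloring E B (insert v C) \<psi>"
proof (rule ccontr)
  assume contra: "\<not> ?thesis"
  define N where "N = hnb E B v \<inter> C"
  have finN: "finite N" using C by (simp add: N_def)
  \<comment> \<open>A colour missing among the neighbours would be free for \<open>v\<close>. As
    this holds for every colouring, it also applies after a swap.\<close>
  have all: "\<exists>u\<in>N. \<psi> u = i" if "hcoloring E B C \<psi>" "i < 4" for \<psi> i
    using hcoloring_extend[OF that(1) C(1-3) that(2)] contra unfolding N_def by blast
  have "{..<4} \<subseteq> \<phi> ` N" using all[OF \<phi>] by force
  then have img: "card {..<4::nat} \<le> card (\<phi> ` N)" using finN by (intro card_mono) auto
  then have cN: "card N = 4" and inj: "inj_on \<phi> N"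
    using c4 card_image_le[OF finN, of \<phi>] finN unfolding N_def[symmetric] by (auto intro: eq_card_imp_inj_on)
  have NC: "u \<in> C \<and> \<phi> u < 4" if "u \<in> N" for u using that \<phi> unfolding N_def hcoloring_def by auto
  have chain: "(s, y) \<in> (grel E (chain_region B C \<phi> (\<phi> s) (\<phi> y)))\<^sup>*" if sy: "s \<in> N" "y \<in> N" "s \<noteq> y" for s y
  proof -
    let ?R = "{(a, b). a \<in> C \<and> b \<in> C \<and> b \<in> hnb E B a \<and> \<phi> a \<in> {\<phi> s, \<phi> y} \<and> \<phi> b \<in> {\<phi> s, \<phi> y}}"
    define T where "T = {u. (s, u) \<in> ?R\<^sup>*}"
    \<comment> \<open>Otherwise swapping the chain of \<open>s\<close> takes the colour
      \<open>\<phi> s\<close> away from \<open>s\<close> without giving it to \<open>y\<close>, the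
      only other neighbour that could receive it, and that colour becomes free.\<close>
    have "y \<in> T"
    proof (rule ccontr)
      assume y: "y \<notin> T"
      have T: "T \<subseteq> {u \<in> C. \<phi> u = \<phi> s \<or> \<phi> u = \<phi> y}"
      proof
        fix u assume "u \<in> T"
        then have "(s, u) \<in> ?R\<^sup>*" by (simp add: T_def)
        then show "u \<in> {u \<in> C. \<phi> u = \<phi> s \<or> \<phi> u = \<phi> y}"
          by (cases rule: rtranclE) (use NC[OF sy(1)] in auto)
      qed
      have closed: "b \<in> T" if "a \<in> T" "b \<in> hnb E B a \<inter> C" "\<phi> b = \<phi> s \<or> \<phi> b = \<phi> y" for a b
      proof -
        have "(a, b) \<in> ?R" using that T by auto
        then show ?thesis using that(1) unfolding T_def by (auto intro: rtrancl_into_rtrancl)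
      qed
      let ?\<psi> = "\<lambda>u. if u \<in> T then if \<phi> u = \<phi> s then \<phi> y else \<phi> s else \<phi> u"
      have "hcoloring E B C ?\<psi>"
        by (rule kempe_swap[OF \<phi> C(1) _ _ T closed]) (use NC sy in auto)
      then obtain u where u: "u \<in> N" "?\<psi> u = \<phi> s" using all[of ?\<psi> "\<phi> s"] NC[OF sy(1)] by blast
      have sT: "s \<in> T" by (simp add: T_def)
      have neq: "\<phi> s \<noteq> \<phi> y" using inj sy by (auto dest: inj_onD)
      show False
      proof (cases "u \<in> T")
        case True
        then have "\<phi> u \<noteq> \<phi> s" using u neq by auto
        then have "\<phi> u = \<phi> y" using T True by auto
        then have "u = y" using inj u sy by (auto dest: inj_onD)
        then show False using y True by simp
      next
        case False
        then have "u = s" using u inj sy by (auto dest: inj_onD)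
        then show False using False sT by simp
      qed
    qed
    then show ?thesis using chain_connected[OF \<phi> C(1), of s y "\<phi> s" "\<phi> y"] by (simp add: T_def)
  qed
  \<comment> \<open>\<open>S n\<close> holds the H-neighbours that \<open>v\<close> owes to its
    neighbour \<open>n\<close>. Three such sets cover four vertices, so some \<open>n3\<close>
    contributes two; it lies in \<open>B\<close>, and its neighbours are exactly \<open>v\<close>,
    \<open>y\<close>, \<open>z\<close>.\<close>
  define S where "S n = (if n \<in> B then nb E n \<inter> C else {n} \<inter> C)" for n
  have NS: "N = (\<Union>n\<in>nb E v. S n)"
    unfolding N_def hnb_def S_def using C by auto
  have card_other: "card (S n) \<le> 1" if "n \<notin> B" for n
    using that card_mono[of "{n}" "{n} \<inter> C"] by (simp add: S_def)
  have "\<exists>n\<in>nb E v. card (S n) \<ge> 2"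
  proof (rule ccontr)
    assume "\<not> ?thesis"
    then have "\<forall>n\<in>nb E v. card (S n) \<le> 1" by auto
    then have "(\<Sum>n\<in>nb E v. card (S n)) \<le> card (nb E v) * 1" using sum_bounded_above[of "nb E v" "\<lambda>n. card (S n)" 1] by auto
    moreover have "card N \<le> (\<Sum>n\<in>nb E v. card (S n))" unfolding NS by (rule card_UN_le) simp
    ultimately show False using cN deg3[of v] by simp
  qed
  then obtain n3 where n3: "n3 \<in> nb E v" "card (S n3) \<ge> 2" by blast
  then have n3B: "n3 \<in> B" using card_other[of n3] by fastforce
  then obtain y z where yz: "y \<in> S n3" "z \<in> S n3" "y \<noteq> z"
    using n3(2) by (metis card_le_Suc0_iff_eq finite_Int fin_nb S_def not_less_eq_eq numeral_2_eq_2)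
  have S3: "S n3 = {y, z}" and nb3: "nb E n3 = {v, y, z}"
  proof -
    have vyz: "v \<in> nb E n3" "y \<in> nb E n3" "z \<in> nb E n3" "y \<noteq> v" "z \<noteq> v"
      using n3 yz n3B C nb_sym[of v n3] by (auto simp: S_def)
    then show "nb E n3 = {v, y, z}" using nb_le_3[of v n3 y z] yz(3) by blast
    then show "S n3 = {y, z}" using yz C n3B by (auto simp: S_def)
  qed
  have yzN: "y \<in> N" "z \<in> N" using n3 yz NS by auto
  have "card (N - {y, z}) = 2" using cN finN yzN yz(3) by (simp add: card_Diff_subset)
  then obtain s t where st: "N - {y, z} = {s, t}" "s \<noteq> t" by (auto simp: card_2_iff)
  then have stN: "s \<in> N" "t \<in> N" and dist: "s \<noteq> y" "s \<noteq> z" "t \<noteq> y" "t \<noteq> z" by auto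
  obtain n1 where n1: "n1 \<in> nb E v" "s \<in> S n1" using stN NS by auto
  obtain n2 where n2: "n2 \<in> nb E v" "t \<in> S n2" using stN NS by auto
  have n13: "n1 \<noteq> n3" "n2 \<noteq> n3" using n1 n2 S3 dist by auto
  have cd: "\<phi> s \<noteq> \<phi> t" "\<phi> s \<noteq> \<phi> y" "\<phi> s \<noteq> \<phi> z" "\<phi> t \<noteq> \<phi> y" "\<phi> t \<noteq> \<phi> z" "\<phi> y \<noteq> \<phi> z"
    using inj stN yzN st(2) dist yz(3) by (auto dest: inj_onD)
  let ?X = "\<lambda>a b. chain_region B C \<phi> (\<phi> a) (\<phi> b)"
  have d1: "?X s y \<inter> ?X t z = {}" and d2: "?X s z \<inter> ?X t y = {}"
    using cd by (auto intro!: chain_region_disjoint C)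
  have vX: "v \<notin> ?X a b" for a b using C by (auto simp: chain_region_def)
  have endX: "a \<in> ?X a b" if "a \<in> N" for a b using NC[OF that] by (simp add: chain_region_def)
  have n3X: "n3 \<notin> ?X s y" "n3 \<notin> ?X t z" "n3 \<notin> ?X s z" "n3 \<notin> ?X t y"
    using nb3 cd C n3B by (auto simp: chain_region_def)
  show False
  \<comment> \<open>If \<open>s\<close> and \<open>t\<close> come through one vertex
    \<open>n1\<close>, the path to contract is \<open>n1\<close>, \<open>v\<close>,
    \<open>n3\<close>. Otherwise it is \<open>v\<close>, \<open>n3\<close>, and the chains starting
    at \<open>s\<close> and \<open>t\<close> are prolonged back to the neighbours \<open>n1\<close>
    and \<open>n2\<close> of \<open>v\<close>.\<close>
  proof (cases "n1 = n2")
    case True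
    have n1B: "n1 \<in> B" using True n1 n2 st(2) by (auto simp: S_def split: if_splits)
    have sC: "s \<in> nb E n1" "t \<in> nb E n1" "v \<in> nb E n1" "s \<noteq> v" "t \<noteq> v"
      using n1 n2 True n1B C nb_sym[of v n1] by (auto simp: S_def)
    then have nb1: "nb E n1 = {v, s, t}" using nb_le_3[of v n1 s t] st(2) by blast
    have n1X: "n1 \<notin> ?X s y" "n1 \<notin> ?X t z" "n1 \<notin> ?X s z" "n1 \<notin> ?X t y"
      using nb1 cd C n1B by (auto simp: chain_region_def)
    obtain xs1 where xs1: "gpath E s y xs1" "set xs1 \<subseteq> ?X s y"
      using grel_gpath[OF chain endX] stN yzN dist by blast
    obtain xs2 where xs2: "gpath E t z xs2" "set xs2 \<subseteq> ?X t z"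
      using grel_gpath[OF chain endX] stN yzN dist by blast
    obtain xs3 where xs3: "gpath E s z xs3" "set xs3 \<subseteq> ?X s z"
      using grel_gpath[OF chain endX] stN yzN dist by blast
    obtain xs4 where xs4: "gpath E t y xs4" "set xs4 \<subseteq> ?X t y"
      using grel_gpath[OF chain endX] stN yzN dist by blast
    have "v \<noteq> n1" "v \<noteq> n3" using n1 n3 by auto
    then have W: "gpath E n1 n3 [n1, v, n3]"
      using n1 n3 n13 by (auto simp: gpath_def nb_def insert_commute)
    have e: "{n1, s} \<in> E" "{n1, t} \<in> E" "{y, n3} \<in> E" "{z, n3} \<in> E"
      using nb1 nb3 by (auto simp: nb_def insert_commute)
    show False
      by (rule planar_crossing[OF pl empty_notin_E W n13(1) e xs1(1) xs2(1) xs3(1) xs4(1)])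
         (use xs1 xs2 xs3 xs4 d1 d2 n1X n3X vX in auto)
  next
    case False
    have att: "{n, a} \<in> E \<and> n \<in> B \<and> nb E n \<supseteq> {v, a} \<or> n = a" if "n \<in> nb E v" "a \<in> S n" for n a
      using that nb_sym[of n v] by (auto simp: S_def nb_def split: if_splits)
    have reach: "\<exists>xs. gpath E n b xs \<and> set xs \<subseteq> insert n (?X a b)"
      if n: "n \<in> nb E v" "a \<in> S n" and ab: "a \<in> N" "b \<in> N" "a \<noteq> b" for n a b
    proof -
      have mono: "(grel E (?X a b))\<^sup>* \<subseteq> (grel E (insert n (?X a b)))\<^sup>*"
        by (rule rtrancl_mono) (auto simp: grel_def)
      have "(n, a) \<in> (grel E (insert n (?X a b)))\<^sup>*"
        using att[OF n] endX[OF ab(1), of b] by (auto simp: grel_def)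
      then have "(n, b) \<in> (grel E (insert n (?X a b)))\<^sup>*"
        using chain[OF ab] mono by (meson rtrancl_trans subsetD)
      then show ?thesis by (rule grel_gpath) simp
    qed
    \<comment> \<open>If \<open>n\<close> lies in \<open>B\<close>, two of its at most three
      neighbours are \<open>v\<close> and \<open>a\<close>, so it cannot see two further
      colours.\<close>
    have off: "n \<notin> ?X b c" if n: "n \<in> nb E v" "a \<in> S n" and c: "\<phi> a \<noteq> \<phi> b" "\<phi> a \<noteq> \<phi> c" "\<phi> b \<noteq> \<phi> c" for n a b c
    proof
      assume nX: "n \<in> ?X b c"
      have aC: "a \<in> C" using n(2) by (auto simp: S_def split: if_splits)
      show False
      proof (cases "n = a")
        case True
        then show False using nX c aC C by (auto simp: chain_region_def)
      next
        case False
        then have nB: "n \<in> B" "v \<in> nb E n" "a \<in> nb E n" using att[OF n] by auto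
        then obtain b' c' where b': "b' \<in> nb E n \<inter> C" "\<phi> b' = \<phi> b" and c': "c' \<in> nb E n \<inter> C" "\<phi> c' = \<phi> c"
          using nX C by (auto simp: chain_region_def)
        have "v \<noteq> a" "v \<noteq> b'" "c' \<noteq> v" using b' c' aC C by auto
        moreover have "a \<noteq> b'" "c' \<noteq> a" "c' \<noteq> b'" using b'(2) c'(2) c by metis+
        ultimately show False using nb_le_3[of v n a b' c'] nB b'(1) c'(1) by blast
      qed
    qed
    obtain xs1 where xs1: "gpath E n1 y xs1" "set xs1 \<subseteq> insert n1 (?X s y)"
      using reach[OF n1 stN(1) yzN(1) dist(1)] by blast
    obtain xs2 where xs2: "gpath E n2 z xs2" "set xs2 \<subseteq> insert n2 (?X t z)"
      using reach[OF n2 stN(2) yzN(2) dist(4)] by blast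
    obtain xs3 where xs3: "gpath E n1 z xs3" "set xs3 \<subseteq> insert n1 (?X s z)"
      using reach[OF n1 stN(1) yzN(2) dist(2)] by blast
    obtain xs4 where xs4: "gpath E n2 y xs4" "set xs4 \<subseteq> insert n2 (?X t y)"
      using reach[OF n2 stN(2) yzN(1) dist(3)] by blast
    have o: "n1 \<notin> ?X t z" "n1 \<notin> ?X t y" "n2 \<notin> ?X s y" "n2 \<notin> ?X s z"
      using off[OF n1] off[OF n2] cd by auto
    have vn: "v \<noteq> n3" "v \<noteq> n1" "v \<noteq> n2" using n1 n2 n3 by auto
    then have W: "gpath E v n3 [v, n3]"
      using n3 by (auto simp: gpath_def nb_def)
    have e: "{v, n1} \<in> E" "{v, n2} \<in> E" "{y, n3} \<in> E" "{z, n3} \<in> E"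
      using n1 n2 nb3 by (auto simp: nb_def insert_commute)
    show False
    proof (rule planar_crossing[OF pl empty_notin_E W vn(1) e xs1(1) xs2(1) xs3(1) xs4(1)])
      show "set xs1 \<inter> set xs2 = {}" using xs1 xs2 d1 o False by blast
      show "set xs3 \<inter> set xs4 = {}" using xs3 xs4 d2 o False by blast
      show "(set xs1 \<union> set xs2 \<union> set xs3 \<union> set xs4) \<inter> set [v, n3] = {}"
        using xs1 xs2 xs3 xs4 n3X vX vn n13 by auto
    qed
  qed
qed

lemma degenerate_hcoloring:
  assumes pl: "planar V E" and B: "\<forall>b\<in>B. nb E b \<inter> B = {}"
    and K: "finite K" "K \<inter> B = {}"
    and degen: "\<And>L. L \<subseteq> K \<Longrightarrow> L \<noteq> {} \<Longrightarrow> \<exists>v\<in>L. card (hnb E B v \<inter> L) \<le> 4"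
  shows "\<exists>\<phi>. hcoloring E B K \<phi>"
  using K degen
proof (induction "card K" arbitrary: K)
  case 0
  then show ?case by (simp add: hcoloring_def)
next
  case (Suc n)
  then have "K \<noteq> {}" by auto
  then obtain v where v: "v \<in> K" "card (hnb E B v \<inter> K) \<le> 4" using Suc.prems(3)[of K] by auto
  have "\<exists>\<phi>. hcoloring E B (K - {v}) \<phi>"
  proof (rule Suc.hyps(1))
    show "n = card (K - {v})" using Suc.hyps(2) v Suc.prems(1) by simp
    show "\<exists>v\<in>L. card (hnb E B v \<inter> L) \<le> 4" if "L \<subseteq> K - {v}" "L \<noteq> {}" for L
      using that Suc.prems(3)[of L] by blast
  qed (use Suc.prems in auto)
  then obtain \<phi> where \<phi>: "hcoloring E B (K - {v}) \<phi>" by blast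
  have "card (hnb E B v \<inter> (K - {v})) \<le> 4"
    by (rule le_trans[OF card_mono v(2)]) (use Suc.prems(1) in auto)
  then have "\<exists>\<psi>. hcoloring E B (insert v (K - {v})) \<psi>"
    by (intro kempe_extend[OF pl B \<phi>]) (use Suc.prems v in auto)
  then show ?case using v by (simp add: insert_absorb)
qed

end

section \<open>Minimal good sets\<close>

lemma inj_conflict_sym:
  assumes "inj_conflict F e f"
  shows "inj_conflict F f e"
proof -
  have ne: "f \<noteq> e" using assms by (auto simp: inj_conflict_def)
  have "(f \<inter> e = {} \<and> (\<exists>x\<in>f. \<exists>y\<in>e. {x, y} \<in> F)) \<or>
      (\<exists>a b c. a \<noteq> b \<and> b \<noteq> c \<and> a \<noteq> c \<and> {a, b} \<in> F \<and> {b, c} \<in> F \<and> {a, c} \<in> F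
              \<and> f \<subseteq> {a, b, c} \<and> e \<subseteq> {a, b, c})"
    using conjunct2[OF assms[unfolded inj_conflict_def]]
  proof
    assume a: "e \<inter> f = {} \<and> (\<exists>x\<in>e. \<exists>y\<in>f. {x, y} \<in> F)"
    then obtain x y where "x \<in> e" "y \<in> f" "{y, x} \<in> F" by (auto simp: insert_commute)
    then show ?thesis using a by (intro disjI1) (auto simp: Int_commute)
  qed (intro disjI2, elim exE conjE, intro exI conjI)
  then show ?thesis using ne unfolding inj_conflict_def by (rule conjI[rotated])
qed

context subcubic_graph
begin

lemma nbI: "{u, v} \<in> E \<Longrightarrow> v \<in> nb E u"
  by (simp add: nb_def)

lemma edge_nb: "e \<in> E \<Longrightarrow> v \<in> e \<Longrightarrow> \<exists>u. e = {v, u} \<and> u \<in> nb E v \<and> u \<noteq> v"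
  using edgeE[of e] by (auto simp: nb_def insert_commute)

lemma edge_subset_V: "e \<in> E \<Longrightarrow> e \<subseteq> V"
  using edgeE[of e] by auto

text \<open>Two distinct sides of a triangle share a vertex, so a conflict of the second kind is
  recorded by this vertex \<open>a\<close> and the third side.\<close>

lemma inj_conflict_cases:
  assumes "inj_conflict F e f" "e \<in> F" "f \<in> F" "F \<subseteq> E"
  obtains (far) x y where "e \<inter> f = {}" "x \<in> e" "y \<in> f" "{x, y} \<in> F"
    | (triangle) a b c where "e = {a, b}" "f = {a, c}" "{b, c} \<in> F" "a \<noteq> b" "b \<noteq> c" "a \<noteq> c"
proof -
  have ef: "e \<noteq> f" using assms(1) by (simp add: inj_conflict_def)
  have eE: "e \<in> E" "f \<in> E" using assms(2-4) by auto
  obtain u v where uv: "e = {u, v}" "u \<noteq> v" using edgeE[OF eE(1)] by blast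
  obtain u' v' where uv': "f = {u', v'}" "u' \<noteq> v'" using edgeE[OF eE(2)] by blast
  have two: "g = {a, b} \<or> g = {a, c} \<or> g = {b, c}" if "g = {u, v}" "u \<noteq> v" "g \<subseteq> {a, b, c}" for g u v a b c
    using that by auto
  show ?thesis
    using conjunct2[OF assms(1)[unfolded inj_conflict_def]]
  proof (elim disjE exE conjE)
    assume "e \<inter> f = {}" "\<exists>x\<in>e. \<exists>y\<in>f. {x, y} \<in> F"
    then show ?thesis using far by blast
  next
    fix a b c assume t: "a \<noteq> b" "b \<noteq> c" "a \<noteq> c" "{a, b} \<in> F" "{b, c} \<in> F" "{a, c} \<in> F" "e \<subseteq> {a, b, c}" "f \<subseteq> {a, b, c}"
    have "e = {a, b} \<or> e = {a, c} \<or> e = {b, c}" "f = {a, b} \<or> f = {a, c} \<or> f = {b, c}"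
      using two[OF uv t(7)] two[OF uv' t(8)] by auto
    then show ?thesis
      using ef t(1-6) triangle[of a b c] triangle[of b a c] triangle[of a c b]
        triangle[of c a b] triangle[of b c a] triangle[of c b a]
      by (elim disjE) (simp_all add: insert_commute)
  qed
qed

lemma inj_conflict_far:
  "\<lbrakk>e \<inter> f = {}; x \<in> e; y \<in> f; {x, y} \<in> F; e \<noteq> {}\<rbrakk> \<Longrightarrow> inj_conflict F e f"
  unfolding inj_conflict_def by blast

lemma inj_conflict_triangle:
  "\<lbrakk>{a, b} \<in> F; {a, c} \<in> F; {b, c} \<in> F; a \<noteq> b; b \<noteq> c; a \<noteq> c\<rbrakk> \<Longrightarrow> inj_conflict F {a, b} {a, c}"
  unfolding inj_conflict_def by (auto simp: doubleton_eq_iff)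

text \<open>The edge that witnesses a conflict has its ends on \<open>e\<close> and
  \<open>f\<close>, so it survives in an induced subgraph containing both. For this reason partial
  colourings always live on induced subgraphs.\<close>

lemma inj_conflict_within:
  assumes "inj_conflict F e f" "F \<subseteq> E" "e \<in> edges_within F A" "f \<in> edges_within F A"
  shows "inj_conflict (edges_within F A) e f"
proof -
  have ef: "e \<in> F" "f \<in> F" "e \<subseteq> A" "f \<subseteq> A" using assms by (auto simp: edges_within_def)
  show ?thesis
    using assms(1) ef(1,2) assms(2)
  proof (cases rule: inj_conflict_cases)
    case (far x y)
    then show ?thesis using ef by (intro inj_conflict_far[of e f x y]) (auto simp: edges_within_def)
  next
    case (triangle a b c)
    then show ?thesis using ef by (auto intro!: inj_conflict_triangle simp: edges_within_def)
  qed
qed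

definition good :: "'a set \<Rightarrow> bool" where
  "good B \<longleftrightarrow> B \<subseteq> V \<and> (\<forall>b\<in>B. nb E b \<inter> B = {}) \<and>
     (\<exists>\<psi>. injective_edge_coloring (edges_within E (V - B)) \<psi> 2)"

definition diamond_free :: bool where
  "diamond_free \<longleftrightarrow> (\<forall>x y b c. y \<in> nb E x \<longrightarrow> b \<in> nb E x \<inter> nb E y \<longrightarrow> c \<in> nb E x \<inter> nb E y \<longrightarrow> b = c)"

text \<open>Back in \<open>G - B\<close>, the vertex \<open>b\<close> is the centre of a spider with
  legs of length at most two: by \<open>pend\<close> its neighbours come from components with at
  most two vertices, and by \<open>nadj\<close> no triangle arises. The edges at \<open>b\<close>
  get colour 0 and the outer edges colour 1.\<close>

lemma good_remove:
  assumes B: "good B" and b: "b \<in> B"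
    and nadj: "\<And>x y. x \<in> nb E b \<Longrightarrow> y \<in> nb E b \<Longrightarrow> y \<notin> nb E x"
    and pend: "\<And>a w. a \<in> nb E b \<Longrightarrow> w \<in> nb E a - B \<Longrightarrow> nb E a - B = {w} \<and> nb E w - B = {a}"
  shows "good (B - {b})"
proof -
  obtain \<psi> where \<psi>: "injective_edge_coloring (edges_within E (V - B)) \<psi> 2"
    using B unfolding good_def by blast
  have BV: "B \<subseteq> V" and ind: "\<And>x. x \<in> B \<Longrightarrow> nb E x \<inter> B = {}" using B unfolding good_def by auto
  define A where "A = V - B"
  define F where "F = edges_within E (V - (B - {b}))"
  have FE: "F \<subseteq> E" by (auto simp: F_def edges_within_def)
  have F_sub: "e \<subseteq> insert b A" if "e \<in> F" for e using that by (auto simp: F_def A_def edges_within_def)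
  have FA: "e \<in> edges_within F A" "e \<in> edges_within E A" if "e \<in> F" "b \<notin> e" for e
    using that F_sub[OF that(1)] FE by (auto simp: edges_within_def)
  have eqA: "edges_within F A = edges_within E A"
    using BV by (auto simp: F_def A_def edges_within_def)
  define \<psi>' where "\<psi>' e = (if b \<in> e then 0 else if e \<inter> nb E b \<noteq> {} then 1 else \<psi> e)" for e
  have notb: "a \<notin> B" if "a \<in> nb E b" for a using ind[OF b] that by auto
  have star: "\<exists>a. e = {b, a} \<and> a \<in> nb E b" if "e \<in> F" "b \<in> e" for e
    using edge_nb[of e b] that FE by auto
  have pendant: "\<exists>a w. e = {a, w} \<and> a \<in> nb E b \<and> nb E a - B = {w} \<and> nb E w - B = {a} \<and> w \<notin> nb E b"
    if e: "e \<in> F" "b \<notin> e" "e \<inter> nb E b \<noteq> {}" for e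
  proof -
    obtain a where a: "a \<in> e" "a \<in> nb E b" using e by auto
    then obtain w where w: "e = {a, w}" "w \<in> nb E a" using edge_nb[of e a] e FE by auto
    then have "w \<notin> B" using FA[OF e(1,2)] by (auto simp: edges_within_def A_def)
    then show ?thesis using pend[OF a(2), of w] w a nadj[OF a(2), of w] by blast
  qed
  have fnb: "y \<in> nb E x - B \<or> x = b \<or> y = b" if "{x, y} \<in> F" for x y
    using that F_sub[OF that] FE nbI[of x y] by (auto simp: A_def)
  \<comment> \<open>\<open>ord\<close> ranks the edges at \<open>b\<close> before the outer edges
    and these before the rest. Conflict is symmetric, so it suffices to treat pairs in this
    order.\<close>
  have main: "\<psi>' e \<noteq> \<psi>' f" if ef: "e \<in> F" "f \<in> F" "inj_conflict F e f" and ord: "b \<in> e \<or> b \<notin> f \<and> (e \<inter> nb E b \<noteq> {} \<or> f \<inter> nb E b = {})" for e f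
  proof (cases "b \<in> e")
    case True
    then obtain a where a: "e = {b, a}" "a \<in> nb E b" using star[OF ef(1)] by blast
    have "b \<notin> f \<and> f \<inter> nb E b \<noteq> {}"
      using ef(3,1,2) FE
    proof (cases rule: inj_conflict_cases)
      case (far x y)
      then have bf: "b \<notin> f" and yb: "y \<noteq> b" using True by auto
      have "f \<inter> nb E b \<noteq> {}"
      proof (cases "x = b")
        case True
        then show ?thesis using far nbI[of b y] FE by auto
      next
        case False
        then have xa: "x = a" using far a by auto
        then have y: "y \<in> nb E a - B" using fnb[OF far(4)] False yb by auto
        obtain z where z: "f = {y, z}" "z \<in> nb E y" using edge_nb[of f y] far ef FE by auto
        have "z \<notin> B" using FA[OF ef(2) bf] z by (auto simp: A_def edges_within_def)
        then have "z = a" using pend[OF a(2) y] z by auto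
        then show ?thesis using z a by auto
      qed
      then show ?thesis using bf by blast
    next
      case (triangle p q r)
      have "p \<noteq> b"
      proof
        assume "p = b"
        then show False using triangle a nadj[of a r] star[OF ef(2)] nbI[of q r] FE by (auto simp: doubleton_eq_iff)
      qed
      then have "p = a" "q = b" using a triangle by (auto simp: doubleton_eq_iff)
      then have "r \<in> nb E b" "r \<in> nb E a" using triangle ef FE nbI[of a r] nbI[of b r] by auto
      then show ?thesis using nadj[OF a(2), of r] by blast
    qed
    then show ?thesis using True by (auto simp: \<psi>'_def)
  next
    case False
    then have bf: "b \<notin> f" using ord by auto
    show ?thesis
    proof (cases "e \<inter> nb E b = {}")
      case True
      then have "f \<inter> nb E b = {}" using ord False by auto
      moreover have "inj_conflict (edges_within E A) e f"
        using inj_conflict_within[OF ef(3) FE FA(1)[OF ef(1) False] FA(1)[OF ef(2) bf]] eqA by simp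
      then have "\<psi> e \<noteq> \<psi> f" using \<psi> FA(2)[OF ef(1) False] FA(2)[OF ef(2) bf]
        unfolding injective_edge_coloring_def A_def by blast
      ultimately show ?thesis using True False bf by (simp add: \<psi>'_def)
    next
      \<comment> \<open>The ends of an outer edge have no further neighbours outside
        \<open>B\<close>, so a conflict could only involve an edge at \<open>b\<close>.\<close>
      case ne: False
      obtain a w where a: "e = {a, w}" "a \<in> nb E b" "nb E a - B = {w}" "nb E w - B = {a}" "w \<notin> nb E b"
        using pendant[OF ef(1) False ne] by blast
      show ?thesis
        using ef(3,1,2) FE
      proof (cases rule: inj_conflict_cases)
        case (far x y)
        then have "y \<in> nb E x - B" using fnb[OF far(4)] False bf by auto
        then have "y \<in> e" using far(2) a by auto
        then show ?thesis using far by auto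
      next
        case (triangle p q r)
        have r: "r \<noteq> b" using bf triangle by auto
        have "q \<noteq> b" "p \<noteq> b" using False triangle by auto
        then have "r \<in> nb E q - B" "r \<in> nb E p - B" using fnb[OF triangle(3)] fnb[of p r] r triangle ef by auto
        then have "r \<in> e" using triangle(1) a by (auto simp: doubleton_eq_iff)
        then show ?thesis using triangle by auto
      qed
    qed
  qed
  have "injective_edge_coloring F \<psi>' 2"
    unfolding injective_edge_coloring_def
  proof (intro conjI ballI impI)
    fix e assume "e \<in> F"
    then show "\<psi>' e < 2" using \<psi> FA(2)[of e] unfolding \<psi>'_def injective_edge_coloring_def A_def by auto
  next
    fix e f assume ef: "e \<in> F" "f \<in> F" "inj_conflict F e f"
    show "\<psi>' e \<noteq> \<psi>' f"
      using main[OF ef] main[OF ef(2,1) inj_conflict_sym[OF ef(3)]] by metis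
  qed
  then have "\<exists>\<psi>. injective_edge_coloring (edges_within E (V - (B - {b}))) \<psi> 2" unfolding F_def by (rule exI[where x = \<psi>'])
  moreover have "B - {b} \<subseteq> V" "\<forall>x\<in>B - {b}. nb E x \<inter> (B - {b}) = {}" using BV ind by auto
  ultimately show ?thesis unfolding good_def by simp
qed

text \<open>If all degrees in \<open>H[K]\<close> were at least 5, then \<open>K\<close> would consist of components of \<open>G - B\<close>
  with at most two vertices. Removing from \<open>B\<close> a vertex with all its neighbours in \<open>K\<close> keeps \<open>B\<close>
  good unless it forms a triangle with such a component; counting then yields a diamond.\<close>

lemma minimal_good_degenerate:
  assumes df: diamond_free and B: "good B" and min: "\<And>C. good C \<Longrightarrow> card B \<le> card C"
    and K: "K \<subseteq> V - B" "K \<noteq> {}"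
  shows "\<exists>v\<in>K. card (hnb E B v \<inter> K) \<le> 4"
proof (rule ccontr)
  assume "\<not> ?thesis"
  then have ge5: "card (hnb E B v \<inter> K) \<ge> 5" if "v \<in> K" for v using that by force
  have BV: "B \<subseteq> V" and ind: "\<And>x. x \<in> B \<Longrightarrow> nb E x \<inter> B = {}" using B unfolding good_def by auto
  have finB: "finite B" and finK: "finite K" using BV K finV finite_subset by blast+
  define full where "full b \<longleftrightarrow> b \<in> B \<and> nb E b \<subseteq> K \<and> card (nb E b) = 3" for b
  have part: "card (nb E v - B) + card (nb E v \<inter> B) \<le> 3" for v
    using deg3[of v] card_Diff_subset_Int[of "nb E v" B] card_mono[of "nb E v" "nb E v \<inter> B"] by simp
  \<comment> \<open>Through \<open>b\<close>, the vertex \<open>v\<close> reaches at most two other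
    vertices of \<open>K\<close>, and two only if all three neighbours of \<open>b\<close> are in
    \<open>K\<close>.\<close>
  have mate2: "card (nb E b \<inter> K - {v}) \<le> 2" "card (nb E b \<inter> K - {v}) = 2 \<Longrightarrow> full b"
    if v: "v \<in> K" "b \<in> nb E v \<inter> B" for v b
  proof -
    have vb: "v \<in> nb E b \<inter> K" using v nb_sym[of v b] by auto
    then have c: "card (nb E b \<inter> K) = Suc (card (nb E b \<inter> K - {v}))" by (metis card_Suc_Diff1 fin_nb finite_Int)
    have le: "card (nb E b \<inter> K) \<le> card (nb E b)" by (rule card_mono) auto
    show "card (nb E b \<inter> K - {v}) \<le> 2" using c le deg3[of b] by simp
    assume "card (nb E b \<inter> K - {v}) = 2"
    then have eq: "card (nb E b \<inter> K) = card (nb E b)" "card (nb E b) = 3" using c le deg3[of b] by auto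
    then have "nb E b \<inter> K = nb E b" by (intro card_subset_eq) auto
    then show "full b" using eq v unfolding full_def by auto
  qed
  have cnt: "5 \<le> card ((nb E v - B) \<inter> K) + (\<Sum>b\<in>nb E v \<inter> B. card (nb E b \<inter> K - {v}))" if v: "v \<in> K" for v
  proof -
    have "hnb E B v \<inter> K \<subseteq> ((nb E v - B) \<inter> K) \<union> (\<Union>b\<in>nb E v \<inter> B. nb E b \<inter> K - {v})"
      unfolding hnb_def by auto
    then have "card (hnb E B v \<inter> K) \<le> card (((nb E v - B) \<inter> K) \<union> (\<Union>b\<in>nb E v \<inter> B. nb E b \<inter> K - {v}))"
      by (intro card_mono) auto
    also have "\<dots> \<le> card ((nb E v - B) \<inter> K) + card (\<Union>b\<in>nb E v \<inter> B. nb E b \<inter> K - {v})" by (rule card_Un_le)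
    also have "card (\<Union>b\<in>nb E v \<inter> B. nb E b \<inter> K - {v}) \<le> (\<Sum>b\<in>nb E v \<inter> B. card (nb E b \<inter> K - {v}))"
      by (rule card_UN_le) auto
    finally show ?thesis using ge5[OF v] by linarith
  qed
  have bound: "(\<Sum>b\<in>S. card (nb E b \<inter> K - {v})) \<le> 2 * card S" if "v \<in> K" "S \<subseteq> nb E v \<inter> B" for v S
    using sum_bounded_above[of S "\<lambda>b. card (nb E b \<inter> K - {v})" 2] mate2(1)[OF that(1)] that(2) by (auto simp: mult.commute)
  have inK: "card ((nb E v - B) \<inter> K) \<le> card (nb E v - B)" for v by (rule card_mono) auto
  \<comment> \<open>With at most one neighbour in \<open>B\<close>, the degree in H would be at most
    4, reached as 2 + 2.\<close>
  have two: "card (nb E v \<inter> B) \<ge> 2" if v: "v \<in> K" for v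
    using cnt[OF v] bound[OF v order_refl] inK[of v] part[of v] by linarith
  \<comment> \<open>For these vertices degree 5 leaves no slack: it must arise as 1 + 2 + 2, so both
    neighbours in \<open>B\<close> are full and the third neighbour lies in
    \<open>K\<close>.\<close>
  define L where "L = {v \<in> K. card (nb E v \<inter> B) = 2}"
  have leaf_full: "full b" if v: "v \<in> L" and b: "b \<in> nb E v \<inter> B" for v b
  proof -
    have v': "v \<in> K" "card (nb E v \<inter> B) = 2" using v by (auto simp: L_def)
    have "(\<Sum>b\<in>nb E v \<inter> B. card (nb E b \<inter> K - {v})) = card (nb E b \<inter> K - {v}) + (\<Sum>b\<in>nb E v \<inter> B - {b}. card (nb E b \<inter> K - {v}))"
      using b by (intro sum.remove) auto
    moreover have "(\<Sum>b\<in>nb E v \<inter> B - {b}. card (nb E b \<inter> K - {v})) \<le> 2 * card (nb E v \<inter> B - {b})"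
      by (rule bound[OF v'(1)]) auto
    moreover have "card (nb E v \<inter> B - {b}) = 1" using v'(2) b by simp
    ultimately have "card (nb E b \<inter> K - {v}) \<ge> 2" using cnt[OF v'(1)] inK[of v] part[of v] v'(2) by linarith
    then show ?thesis using mate2[OF v'(1) b] by linarith
  qed
  have leaf_mate: "\<exists>w\<in>K. nb E v - B = {w}" if v: "v \<in> L" for v
  proof -
    have v': "v \<in> K" "card (nb E v \<inter> B) = 2" using v by (auto simp: L_def)
    have "card ((nb E v - B) \<inter> K) \<ge> 1" using cnt[OF v'(1)] bound[OF v'(1) order_refl] v'(2) by linarith
    moreover have "card (nb E v - B) \<le> 1" using part[of v] v'(2) by linarith
    ultimately have "card (nb E v - B) = 1" "(nb E v - B) \<inter> K \<noteq> {}" using inK[of v] by auto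
    then show ?thesis by (metis Int_iff card_1_singletonE ex_in_conv singletonD)
  qed
  \<comment> \<open>A vertex outside \<open>L\<close> has three neighbours in \<open>B\<close>, and
    1 + 1 + 1 is less than 5.\<close>
  have some_full: "\<exists>b. full b" if v: "v \<in> K" for v
  proof (cases "v \<in> L")
    case True
    then have "nb E v \<inter> B \<noteq> {}" unfolding L_def by auto
    then show ?thesis using leaf_full[OF True] by blast
  next
    case False
    then have c3: "card (nb E v \<inter> B) \<ge> 3" using two[OF v] v unfolding L_def by auto
    show ?thesis
    proof (rule ccontr)
      assume none: "\<nexists>b. full b"
      then have "card (nb E b \<inter> K - {v}) \<le> 1" if "b \<in> nb E v \<inter> B" for b
        using mate2[OF v that] none by (metis le_SucE numeral_2_eq_2 One_nat_def)
      then have "(\<Sum>b\<in>nb E v \<inter> B. card (nb E b \<inter> K - {v})) \<le> card (nb E v \<inter> B) * 1"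
        using sum_bounded_above[of "nb E v \<inter> B" "\<lambda>b. card (nb E b \<inter> K - {v})" 1] by auto
      then show False using cnt[OF v] inK[of v] part[of v] c3 by linarith
    qed
  qed
  have inL: "x \<in> L" if "x \<in> K" "y \<in> nb E x - B" for x y
  proof -
    have "nb E x - B \<noteq> {}" using that by auto
    then have "card (nb E x - B) \<ge> 1" by (simp add: Suc_leI card_gt_0_iff)
    then show ?thesis using part[of x] two[OF that(1)] that(1) unfolding L_def by auto
  qed
  \<comment> \<open>A vertex of \<open>K\<close> with a neighbour outside \<open>B\<close> lies in
    \<open>L\<close> and has only this one; the same holds for the neighbour. So the two form a
    component of \<open>G - B\<close>.\<close>
  have mutual: "nb E a - B = {w} \<and> nb E w - B = {a}" if "a \<in> K" "w \<in> nb E a - B" for a w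
  proof -
    have aL: "a \<in> L" using inL that .
    then obtain w' where "w' \<in> K" "nb E a - B = {w'}" using leaf_mate[OF aL] by blast
    moreover have "w' = w" using calculation(2) that(2) by simp
    ultimately have aw: "nb E a - B = {w}" "w \<in> K" by simp_all
    have a: "a \<in> nb E w - B" using that K nb_sym[of a w] by auto
    obtain a' where "nb E w - B = {a'}" using leaf_mate[OF inL[OF aw(2) a]] by blast
    moreover have "a' = a" using calculation a by simp
    ultimately show ?thesis using aw by simp
  qed
  have pair: "\<exists>x y. x \<in> nb E b \<and> y \<in> nb E b \<and> y \<in> nb E x" if b: "full b" for b
  proof (rule ccontr)
    assume none: "\<nexists>x y. x \<in> nb E b \<and> y \<in> nb E b \<and> y \<in> nb E x"
    have bB: "b \<in> B" and bK: "nb E b \<subseteq> K" using b unfolding full_def by auto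
    have "good (B - {b})"
      by (rule good_remove[OF B bB]) (use none mutual bK in blast)+
    then show False using min[of "B - {b}"] bB finB by (metis card_Diff1_less not_le)
  qed
  \<comment> \<open>The side opposite to \<open>b\<close> of a triangle at \<open>b\<close>. Its two
    ends are a whole component of \<open>G - B\<close>.\<close>
  define P where "P b = (SOME p. \<exists>x y. p = {x, y} \<and> x \<in> nb E b \<and> y \<in> nb E b \<and> y \<in> nb E x)" for b
  have P: "\<exists>x y. P b = {x, y} \<and> x \<in> nb E b \<and> y \<in> nb E b \<and> y \<in> nb E x" if "full b" for b
    unfolding P_def by (rule someI_ex) (use pair[OF that] in blast)
  define Fb where "Fb = {b. full b}"
  have finF: "finite Fb" using finB unfolding Fb_def full_def by auto
  have finL: "finite L" using finK unfolding L_def by auto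
  have PL: "P b \<subseteq> L \<and> card (P b) = 2" if "b \<in> Fb" for b
  proof -
    have fb: "full b" using that unfolding Fb_def by simp
    then obtain x y where xy: "P b = {x, y}" "x \<in> nb E b" "y \<in> nb E b" "y \<in> nb E x" using P by blast
    have "x \<in> K" "y \<in> K" using fb xy unfolding full_def by auto
    then have "x \<in> L" "y \<in> L" using inL[of x y] inL[of y x] xy K nb_sym[of x y] by auto
    moreover have "x \<noteq> y" using xy by auto
    ultimately show ?thesis using xy by simp
  qed
  \<comment> \<open>Pairs that meet coincide by \<open>mutual\<close>, and then their edge forms
    triangles with both \<open>b\<close> and \<open>c\<close>, a diamond.\<close>
  have Pdis: "P b \<inter> P c = {}" if bc: "b \<in> Fb" "c \<in> Fb" "b \<noteq> c" for b c
  proof (rule ccontr)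
    assume "P b \<inter> P c \<noteq> {}"
    then obtain x where x: "x \<in> P b" "x \<in> P c" by blast
    have other: "\<exists>y. y \<in> nb E x - B \<and> x \<in> nb E d \<and> y \<in> nb E d \<and> x \<in> K" if d: "d \<in> Fb" "x \<in> P d" for d
    proof -
      have fd: "full d" using d unfolding Fb_def by simp
      then obtain u v where uv: "P d = {u, v}" "u \<in> nb E d" "v \<in> nb E d" "v \<in> nb E u" using P by blast
      have "u \<in> K" "v \<in> K" using fd uv unfolding full_def by auto
      then show ?thesis using d(2) uv nb_sym[of u v] K by auto
    qed
    obtain y where y: "y \<in> nb E x - B" "x \<in> nb E b" "y \<in> nb E b" "x \<in> K" using other[OF bc(1) x(1)] by blast
    obtain y' where y': "y' \<in> nb E x - B" "x \<in> nb E c" "y' \<in> nb E c" using other[OF bc(2) x(2)] by blast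
    have "y' = y" using mutual[OF y(4,1)] y' by auto
    then have "b \<in> nb E x \<inter> nb E y" "c \<in> nb E x \<inter> nb E y" using y y' nb_sym by blast+
    then show False using df bc(3) y unfolding diamond_free_def by blast
  qed
  have "card (\<Union>b\<in>Fb. P b) = (\<Sum>b\<in>Fb. card (P b))"
  proof (rule card_UN_disjoint)
    show "\<forall>b\<in>Fb. finite (P b)" using PL finL finite_subset by blast
    show "\<forall>b\<in>Fb. \<forall>c\<in>Fb. b \<noteq> c \<longrightarrow> P b \<inter> P c = {}" using Pdis by blast
  qed (rule finF)
  also have "\<dots> = 2 * card Fb" using PL by simp
  finally have "2 * card Fb \<le> card L"
    using card_mono[OF finL, of "\<Union>b\<in>Fb. P b"] PL by auto
  \<comment> \<open>Count the adjacencies between \<open>L\<close> and \<open>Fb\<close>: exactly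
    two at each vertex of \<open>L\<close>, at most three at each full vertex. With
    \<open>2 * card Fb \<le> card L\<close> this yields
    \<open>4 * card Fb \<le> 3 * card Fb\<close>.\<close>
  moreover have "2 * card L \<le> 3 * card Fb"
  proof -
    have "2 * card L = (\<Sum>v\<in>L. card (nb E v \<inter> Fb))"
    proof -
      have "card (nb E v \<inter> Fb) = 2" if "v \<in> L" for v
      proof -
        have "nb E v \<inter> Fb = nb E v \<inter> B" using leaf_full[OF that] unfolding Fb_def full_def by blast
        then show ?thesis using that unfolding L_def by simp
      qed
      then show ?thesis by simp
    qed
    also have "\<dots> = (\<Sum>v\<in>L. \<Sum>b\<in>Fb. if b \<in> nb E v then 1 else 0)"
      using finF by (intro sum.cong refl) (simp add: sum.If_cases Int_def conj_commute)
    also have "\<dots> = (\<Sum>b\<in>Fb. \<Sum>v\<in>L. if b \<in> nb E v then 1 else 0)" by (rule sum.swap)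
    also have "\<dots> \<le> (\<Sum>b\<in>Fb. 3)"
    proof (rule sum_mono)
      fix b assume "b \<in> Fb"
      have "(\<Sum>v\<in>L. if b \<in> nb E v then 1 else 0) = card {v \<in> L. b \<in> nb E v}"
        using finL by (simp add: sum.If_cases Int_def)
      also have "\<dots> \<le> 3" by (rule nb_card_le[of _ b]) (use nb_sym in blast)
      finally show "(\<Sum>v\<in>L. if b \<in> nb E v then 1 else 0) \<le> (3::nat)" .
    qed
    finally show ?thesis by simp
  qed
  ultimately have "card Fb = 0" by linarith
  then have "Fb = {}" using finF by simp
  then show False using some_full K unfolding Fb_def by blast
qed

section \<open>Maximum independent sets and induced linear forests\<close>


text \<open>Degrees at most 2 and a vertex of degree at most 1 in every nonempty subset make
  \<open>X\<close> a linear forest. The edge at an end vertex \<open>v\<close> conflicts only with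
  the edge two steps further along its path, so one of the two colours is free.\<close>

lemma linear_forest_injective_coloring:
  assumes "finite X" "\<And>v. v \<in> X \<Longrightarrow> card (nb E v \<inter> X) \<le> 2"
    "\<And>S. S \<subseteq> X \<Longrightarrow> S \<noteq> {} \<Longrightarrow> \<exists>v\<in>S. card (nb E v \<inter> S) \<le> 1"
  shows "\<exists>\<psi>. injective_edge_coloring (edges_within E X) \<psi> 2"
  using assms
proof (induction "card X" arbitrary: X)
  case 0
  then have "edges_within E X = {}" using empty_notin_E by (auto simp: edges_within_def)
  then show ?case by (simp add: injective_edge_coloring_def)
next
  case (Suc n)
  then have "X \<noteq> {}" by auto
  then obtain v where v: "v \<in> X" "card (nb E v \<inter> X) \<le> 1" using Suc.prems(3)[of X] by auto
  define Y where "Y = X - {v}"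
  have "\<exists>\<psi>. injective_edge_coloring (edges_within E Y) \<psi> 2"
  proof (rule Suc.hyps(1))
    show "n = card Y" using Suc.hyps(2) v Suc.prems(1) by (simp add: Y_def)
    show "card (nb E u \<inter> Y) \<le> 2" if "u \<in> Y" for u
      by (rule le_trans[OF card_mono Suc.prems(2)[of u]]) (use that in \<open>auto simp: Y_def\<close>)
    show "\<exists>v\<in>S. card (nb E v \<inter> S) \<le> 1" if "S \<subseteq> Y" "S \<noteq> {}" for S
      using Suc.prems(3)[of S] that by (auto simp: Y_def)
  qed (use Suc.prems in \<open>auto simp: Y_def\<close>)
  then obtain \<psi> where \<psi>: "injective_edge_coloring (edges_within E Y) \<psi> 2" by blast
  let ?F = "edges_within E X"
  have FE: "?F \<subseteq> E" by (auto simp: edges_within_def)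
  have F_nb: "y \<in> nb E x" "x \<in> X" "y \<in> X" if "{x, y} \<in> ?F" for x y
    using that by (auto simp: edges_within_def nb_def)
  have F_other: "\<exists>u. e = {w, u} \<and> u \<in> nb E w \<inter> X \<and> w \<in> X" if "e \<in> ?F" "w \<in> e" for e w
    using that edge_nb[of e w] by (auto simp: edges_within_def)
  have inY: "e \<in> edges_within E Y" if "e \<in> ?F" "v \<notin> e" for e using that by (auto simp: edges_within_def Y_def)
  have v_unique: "u = u'" if "u \<in> nb E v \<inter> X" "u' \<in> nb E v \<inter> X" for u u'
    using v(2) that by (metis card_le_Suc0_iff_eq One_nat_def finite_Int fin_nb)
  have third: "a = a'" if "u \<in> X" "w \<in> nb E u \<inter> X" "a \<in> nb E u \<inter> X" "a' \<in> nb E u \<inter> X" "a \<noteq> w" "a' \<noteq> w" for u w a a'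
  proof (rule ccontr)
    assume "a \<noteq> a'"
    then have "card {w, a, a'} = 3" using that by simp
    moreover have "card {w, a, a'} \<le> card (nb E u \<inter> X)" by (rule card_mono) (use that in auto)
    ultimately show False using Suc.prems(2)[OF that(1)] by simp
  qed
  have confl: "\<exists>u u'. u \<in> nb E v \<inter> X \<and> u' \<in> nb E u \<inter> X \<and> u' \<noteq> v \<and> u' \<in> f \<and> u \<notin> f"
    if e: "e \<in> ?F" "v \<in> e" and f: "f \<in> ?F" and c: "inj_conflict ?F e f" for e f
  proof -
    obtain u where u: "e = {v, u}" "u \<in> nb E v \<inter> X" using F_other[OF e] by blast
    show ?thesis
      using c e(1) f FE
    proof (cases rule: inj_conflict_cases)
      case (far x y)
      have "x \<noteq> v"
      proof
        assume "x = v"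
        then have "y = u" using v_unique[of y u] F_nb[OF far(4)] u by blast
        then show False using far u by auto
      qed
      then have "x = u" using far u by auto
      then show ?thesis using far u F_nb[OF far(4)] by blast
    next
      case (triangle p q r)
      have r: "r \<in> X" using F_nb[OF triangle(3)] by auto
      have "p = v \<and> q = u \<or> p = u \<and> q = v" using u triangle by (auto simp: doubleton_eq_iff)
      then have "r \<in> nb E v" using triangle F_nb[of p r] F_nb(1)[OF triangle(3)] f by auto
      then have "r = u" using v_unique[of r u] u r by blast
      then show ?thesis using triangle \<open>p = v \<and> q = u \<or> p = u \<and> q = v\<close> by auto
    qed
  qed
  have unique: "f = f'" if e: "e \<in> ?F" "v \<in> e" and f: "f \<in> ?F" "inj_conflict ?F e f" "f' \<in> ?F" "inj_conflict ?F e f'" for e f f'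
  proof -
    obtain u a where u: "u \<in> nb E v \<inter> X" "a \<in> nb E u \<inter> X" "a \<noteq> v" "a \<in> f" "u \<notin> f" using confl[OF e f(1,2)] by blast
    obtain u' a' where u': "u' \<in> nb E v \<inter> X" "a' \<in> nb E u' \<inter> X" "a' \<noteq> v" "a' \<in> f'" "u' \<notin> f'" using confl[OF e f(3,4)] by blast
    have uu: "u' = u" using v_unique u u' by blast
    have "a' = a" by (rule third[of u v]) (use u u' uu v nb_sym[of u v] in auto)
    obtain d where d: "f = {a, d}" "d \<in> nb E a \<inter> X" using F_other[OF f(1) u(4)] by blast
    obtain d' where d': "f' = {a, d'}" "d' \<in> nb E a \<inter> X" using F_other[OF f(3)] u'(4) \<open>a' = a\<close> by blast
    have "d = d'" by (rule third[of a u]) (use u u' uu d d' nb_sym[of u a] in auto)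
    then show ?thesis using d d' by simp
  qed
  \<comment> \<open>The chosen edge is the only one in conflict, by \<open>unique\<close>;
    subtracting from 1 takes the other colour, and 0 serves when there is no conflict.\<close>
  define col where "col e = (if \<exists>f\<in>?F. inj_conflict ?F e f then 1 - \<psi> (SOME f. f \<in> ?F \<and> inj_conflict ?F e f) else 0)" for e
  define \<psi>' where "\<psi>' e = (if v \<in> e then col e else \<psi> e)" for e
  have lt2: "\<psi> e < 2" if "e \<in> ?F" "v \<notin> e" for e using \<psi> inY[OF that] unfolding injective_edge_coloring_def by blast
  have e_unique: "e = e'" if "e \<in> ?F" "v \<in> e" "e' \<in> ?F" "v \<in> e'" for e e'
    using F_other[OF that(1,2)] F_other[OF that(3,4)] v_unique by blast
  have colne: "col e \<noteq> \<psi> f" if e: "e \<in> ?F" "v \<in> e" and f: "f \<in> ?F" "inj_conflict ?F e f" for e f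
  proof -
    have "(SOME f. f \<in> ?F \<and> inj_conflict ?F e f) = f" by (rule some_equality) (use unique[OF e] f in blast)+
    then have "col e = 1 - \<psi> f" using f unfolding col_def by auto
    moreover have "v \<notin> f" using e_unique[OF e f(1)] f(2) by (auto simp: inj_conflict_def)
    then have "\<psi> f < 2" using lt2 f by blast
    ultimately show ?thesis by (auto simp: less_2_cases_iff)
  qed
  have "injective_edge_coloring ?F \<psi>' 2"
    unfolding injective_edge_coloring_def
  proof (intro conjI ballI impI)
    fix e assume "e \<in> ?F"
    then show "\<psi>' e < 2" using lt2[of e] by (auto simp: \<psi>'_def col_def)
  next
    fix e f assume ef: "e \<in> ?F" "f \<in> ?F" "inj_conflict ?F e f"
    have ne: "e \<noteq> f" using ef(3) by (auto simp: inj_conflict_def)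
    consider "v \<in> e" | "v \<notin> e" "v \<in> f" | "v \<notin> e" "v \<notin> f" by blast
    then show "\<psi>' e \<noteq> \<psi>' f"
    proof cases
      case 1
      then show ?thesis using colne[of e f] e_unique[of e f] ef ne by (auto simp: \<psi>'_def)
    next
      case 2
      then show ?thesis using colne[of f e] inj_conflict_sym[OF ef(3)] ef by (auto simp: \<psi>'_def)
    next
      case 3
      have YX: "edges_within ?F Y = edges_within E Y" by (auto simp: edges_within_def Y_def)
      have "inj_conflict (edges_within E Y) e f"
        using inj_conflict_within[OF ef(3) FE, of Y] inY[OF ef(1) 3(1)] inY[OF ef(2) 3(2)] YX by simp
      then show ?thesis using \<psi> inY[OF ef(1) 3(1)] inY[OF ef(2) 3(2)] 3
        unfolding injective_edge_coloring_def \<psi>'_def by auto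
    qed
  qed
  then show ?case by blast
qed

lemma handshake: "finite D \<Longrightarrow> even (\<Sum>v\<in>D. card (nb E v \<inter> D))"
proof (induction rule: finite_induct)
  case (insert x D)
  have "card (nb E v \<inter> insert x D) = card (nb E v \<inter> D) + (if x \<in> nb E v then 1 else 0)" if "v \<in> D" for v
    using insert(2) by (simp add: Int_insert_right)
  then have "(\<Sum>v\<in>D. card (nb E v \<inter> insert x D)) = (\<Sum>v\<in>D. card (nb E v \<inter> D) + (if x \<in> nb E v then 1 else 0))"
    by simp
  also have "\<dots> = (\<Sum>v\<in>D. card (nb E v \<inter> D)) + card {v \<in> D. x \<in> nb E v}"
    using insert(1) by (simp add: sum.distrib sum.If_cases Int_def)
  also have "{v \<in> D. x \<in> nb E v} = nb E x \<inter> D" using nb_sym by auto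
  finally show ?case using insert by (simp add: Int_insert_right)
qed simp

section \<open>Maximum independent sets and the cycles of their complements\<close>

definition maxind :: "'a set \<Rightarrow> bool" where
  "maxind B \<longleftrightarrow> B \<subseteq> V \<and> (\<forall>b\<in>B. nb E b \<inter> B = {}) \<and>
     (\<forall>C. C \<subseteq> V \<longrightarrow> (\<forall>b\<in>C. nb E b \<inter> C = {}) \<longrightarrow> card C \<le> card B)"

text \<open>For a maximum independent \<open>B\<close> all degrees in \<open>G - B\<close> are at
  most 2, so this is the vertex set of the cycles of \<open>G - B\<close>. Stating it by degrees
  avoids handling cycles as sequences.\<close>

definition two_core :: "'a set \<Rightarrow> 'a set" where
  "two_core B = \<Union>{S. S \<subseteq> V - B \<and> (\<forall>v\<in>S. 2 \<le> card (nb E v \<inter> S))}"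

text \<open>The unions of components of \<open>G - B\<close>. Connectedness is expressed below by
  minimality among these sets, without paths.\<close>

definition closed_off :: "'a set \<Rightarrow> 'a set \<Rightarrow> bool" where
  "closed_off B Q \<longleftrightarrow> Q \<subseteq> V - B \<and> (\<forall>v\<in>Q. nb E v - B \<subseteq> Q)"

definition component_off :: "'a set \<Rightarrow> 'a set \<Rightarrow> bool" where
  "component_off B Q \<longleftrightarrow> closed_off B Q \<and> Q \<noteq> {} \<and> (\<forall>D\<subseteq>Q. closed_off B D \<longrightarrow> D = {} \<or> D = Q)"

lemma maxind_fin: "maxind B \<Longrightarrow> finite B"
  using finV finite_subset by (auto simp: maxind_def)

text \<open>Otherwise \<open>v\<close> could be added to \<open>B\<close>. So at least one of the at
  most three edges at \<open>v\<close> leads into \<open>B\<close>.\<close>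

lemma maxind_nb:
  assumes "maxind B" "v \<in> V - B"
  shows "nb E v \<inter> B \<noteq> {}" "card (nb E v - B) \<le> 2"
proof -
  show ne: "nb E v \<inter> B \<noteq> {}"
  proof
    assume e: "nb E v \<inter> B = {}"
    have "nb E b \<inter> insert v B = {}" if "b \<in> insert v B" for b
      using that e assms(1) nb_sym[of b v] by (auto simp: maxind_def)
    then have "card (insert v B) \<le> card B" using assms unfolding maxind_def by auto
    then show False using assms maxind_fin[OF assms(1)] by simp
  qed
  have "card (nb E v \<inter> B) \<noteq> 0" using ne by simp
  moreover have "card (nb E v) = card (nb E v - B) + card (nb E v \<inter> B)"
    by (metis card_Int_Diff fin_nb add.commute)
  ultimately show "card (nb E v - B) \<le> 2" using deg3[of v] by linarith
qed

lemma maxind_nb_unique: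
  assumes "maxind B" "card (nb E x - B) = 2" "b \<in> nb E x \<inter> B" "c \<in> nb E x \<inter> B"
  shows "b = c"
proof (rule ccontr)
  assume "b \<noteq> c"
  then have "card {b, c} = 2" by simp
  moreover have "card {b, c} \<le> card (nb E x \<inter> B)" by (rule card_mono) (use assms in auto)
  moreover have "card (nb E x) = card (nb E x - B) + card (nb E x \<inter> B)"
    by (metis card_Int_Diff fin_nb add.commute)
  ultimately show False using deg3[of x] assms(2) by linarith
qed

lemma maxind_swap:
  assumes B: "maxind B" and x: "x \<in> V - B" and b: "nb E x \<inter> B = {b}"
  shows "maxind (insert x (B - {b}))"
proof -
  have "card (insert x (B - {b})) = card B"
  proof -
    have "b \<in> B" "x \<notin> B - {b}" using x b by auto
    moreover have "card B > 0" using maxind_fin[OF B] \<open>b \<in> B\<close> card_gt_0_iff by blast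
    ultimately show ?thesis using maxind_fin[OF B] by simp
  qed
  moreover have "nb E c \<inter> insert x (B - {b}) = {}" if "c \<in> insert x (B - {b})" for c
    using that b B nb_sym[of x c] by (auto simp: maxind_def)
  ultimately show ?thesis using B x unfolding maxind_def by auto
qed

lemma two_core_subset: "two_core B \<subseteq> V - B"
  by (auto simp: two_core_def)

lemma two_core_upper: "S \<subseteq> V - B \<Longrightarrow> (\<And>v. v \<in> S \<Longrightarrow> 2 \<le> card (nb E v \<inter> S)) \<Longrightarrow> S \<subseteq> two_core B"
  by (auto simp: two_core_def)

lemma two_core_deg: "v \<in> two_core B \<Longrightarrow> 2 \<le> card (nb E v \<inter> two_core B)"
proof -
  assume "v \<in> two_core B"
  then obtain S where S: "S \<subseteq> V - B" "\<forall>v\<in>S. 2 \<le> card (nb E v \<inter> S)" "v \<in> S" by (auto simp: two_core_def)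
  then have "S \<subseteq> two_core B" by (auto simp: two_core_def)
  then have "card (nb E v \<inter> S) \<le> card (nb E v \<inter> two_core B)" by (intro card_mono) auto
  then show ?thesis using S by force
qed

text \<open>Two neighbours inside \<open>S\<close> are already all the neighbours outside
  \<open>B\<close>, so no edge of \<open>G - B\<close> leaves \<open>S\<close>.\<close>

lemma regular_closed:
  assumes B: "maxind B" and S: "S \<subseteq> V - B" "\<And>v. v \<in> S \<Longrightarrow> 2 \<le> card (nb E v \<inter> S)" and v: "v \<in> S"
  shows "nb E v - B = nb E v \<inter> S" "card (nb E v - B) = 2"
proof -
  have sub: "nb E v \<inter> S \<subseteq> nb E v - B" using S by auto
  have le: "card (nb E v - B) \<le> 2" using maxind_nb(2)[OF B] S v by blast
  then have "card (nb E v - B) \<le> card (nb E v \<inter> S)" using S(2)[OF v] by linarith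
  then show eq: "nb E v - B = nb E v \<inter> S" using card_seteq[OF _ sub] by auto
  then show "card (nb E v - B) = 2" using le S(2)[OF v] by simp
qed

lemma two_core_closed:
  assumes "maxind B"
  shows "closed_off B (two_core B)" "v \<in> two_core B \<Longrightarrow> card (nb E v - B) = 2"
  using regular_closed[OF assms two_core_subset two_core_deg] two_core_subset unfolding closed_off_def by blast+

lemma closed_off_Diff:
  assumes "closed_off B P" "closed_off B Q"
  shows "closed_off B (P - Q)"
  using assms nb_sym unfolding closed_off_def by fast

lemma component_exists:
  assumes "v \<in> V - B"
  shows "\<exists>Q. component_off B Q \<and> v \<in> Q \<and> (\<forall>P. closed_off B P \<longrightarrow> v \<in> P \<longrightarrow> Q \<subseteq> P)"
proof -
  define Q where "Q = \<Inter>{P. closed_off B P \<and> v \<in> P}"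
  have all: "closed_off B (V - B)" using nb_subset by (auto simp: closed_off_def)
  have least: "Q \<subseteq> P" if "closed_off B P" "v \<in> P" for P using that by (auto simp: Q_def)
  have vQ: "v \<in> Q" by (auto simp: Q_def)
  have cl: "closed_off B Q"
    unfolding closed_off_def
  proof (intro conjI ballI)
    show "Q \<subseteq> V - B" using least[OF all assms] .
    show "nb E u - B \<subseteq> Q" if u: "u \<in> Q" for u
      using u unfolding Q_def closed_off_def by blast
  qed
  have "D = {} \<or> D = Q" if D: "D \<subseteq> Q" "closed_off B D" for D
  proof (cases "v \<in> D")
    case True
    then show ?thesis using least[OF D(2)] D by blast
  next
    case False
    then show ?thesis using least[OF closed_off_Diff[OF cl D(2)]] vQ D by blast
  qed
  then show ?thesis using cl vQ least unfolding component_off_def by blast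
qed

text \<open>A cycle remains connected when one vertex is deleted. A part \<open>D\<close> split off
  would contain exactly one of the two neighbours of \<open>x\<close>, hence have one vertex of
  degree 1 and all others of degree 2, contrary to \<open>handshake\<close>.\<close>

lemma component_minus_vertex:
  assumes C: "component_off B C" and deg: "\<And>v. v \<in> C \<Longrightarrow> card (nb E v - B) = 2" and x: "x \<in> C"
  shows "component_off (insert x B) (C - {x})"
proof -
  have cl: "closed_off B C" and CV: "C \<subseteq> V - B" using C by (auto simp: component_off_def closed_off_def)
  have cl': "closed_off (insert x B) (C - {x})" using cl by (auto simp: closed_off_def)
  have nbx: "nb E x - B \<subseteq> C" using cl x by (auto simp: closed_off_def)
  obtain w w' where w: "nb E x - B = {w, w'}" "w \<noteq> w'" using deg[OF x] by (auto simp: card_2_iff)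
  have ww: "w \<in> C - {x}" "w' \<in> C - {x}" using w nbx by (metis DiffI insertI1 insertI2 nb_irrefl Diff_iff singletonD subsetD)+
  have meets: "D \<inter> {w, w'} \<noteq> {}" if D: "D \<subseteq> C - {x}" "closed_off (insert x B) D" "D \<noteq> {}" for D
  proof
    assume e: "D \<inter> {w, w'} = {}"
    have "x \<notin> nb E v" if "v \<in> D" for v
    proof
      assume "x \<in> nb E v"
      then have "v \<in> nb E x - B" using that D CV nb_sym[of v x] by auto
      then show False using w e that by auto
    qed
    then have "closed_off B D" using D(2) unfolding closed_off_def by blast
    then have "D = C" using C D unfolding component_off_def by blast
    then show False using D x by auto
  qed
  have "D = {} \<or> D = C - {x}" if D: "D \<subseteq> C - {x}" "closed_off (insert x B) D" for D
  proof (rule ccontr)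
    assume neg: "\<not> ?thesis"
    have D2: "closed_off (insert x B) (C - {x} - D)" by (rule closed_off_Diff[OF cl' D(2)])
    have m1: "D \<inter> {w, w'} \<noteq> {}" using meets[OF D] neg by blast
    have m2: "(C - {x} - D) \<inter> {w, w'} \<noteq> {}" using meets[OF _ D2] neg D by blast
    obtain d where d: "D \<inter> {w, w'} = {d}" using m1 m2 by auto
    have "D \<subseteq> V" using D(1) CV by auto
    then have finD: "finite D" using finV by (rule finite_subset)
    have "card (nb E v \<inter> D) = (if v = d then 1 else 2)" if v: "v \<in> D" for v
    proof -
      have "nb E v \<inter> D = (nb E v - B) - {x}" using D(2) v unfolding closed_off_def by auto
      moreover have "x \<in> nb E v - B \<longleftrightarrow> v = d"
      proof -
        have "x \<notin> B" "v \<notin> B" using x v D(1) CV by auto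
        then have "x \<in> nb E v - B \<longleftrightarrow> v \<in> nb E x - B" using nb_sym[of x v] by simp
        also have "\<dots> \<longleftrightarrow> v \<in> D \<inter> {w, w'}" using w v by simp
        finally show ?thesis using d by simp
      qed
      moreover have "card (nb E v - B) = 2" using deg[of v] v D(1) by blast
      ultimately show ?thesis by (cases "v = d") (simp_all add: card_Diff_singleton)
    qed
    then have "(\<Sum>v\<in>D. card (nb E v \<inter> D)) = (\<Sum>v\<in>D. if v = d then 1 else 2)" by simp
    also have "\<dots> = (\<Sum>v\<in>D - {d}. if v = d then 1 else 2) + 1"
      using d finD by (subst sum.remove[of D d]) auto
    also have "(\<Sum>v\<in>D - {d}. if v = d then 1 else 2) = (\<Sum>v\<in>D - {d}. 2::nat)" by (intro sum.cong) auto
    finally have "odd (\<Sum>v\<in>D. card (nb E v \<inter> D))" by simp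
    then show False using handshake[OF finD] by blast
  qed
  then show ?thesis using cl' ww unfolding component_off_def by blast
qed


section \<open>Swaps along a cycle of the complement\<close>

lemma component_closed:
  "component_off B C \<Longrightarrow> closed_off B C" "component_off B C \<Longrightarrow> C \<subseteq> V - B"
  "component_off B C \<Longrightarrow> v \<in> C \<Longrightarrow> nb E v - B \<subseteq> C"
  by (simp_all add: component_off_def closed_off_def)

text \<open>Opening the cycle \<open>C\<close> at \<open>x\<close> leaves no cycle inside
  \<open>C - {x}\<close>. But \<open>less\<close> demands a core with more vertices than
  \<open>R\<close>, so a new cycle must arise, and it can only pass through the returned vertex
  \<open>b\<close>.\<close>

lemma cycle_swap:
  assumes B: "maxind B" and C: "component_off B C" and RC: "two_core B = R \<union> C" "R \<inter> C = {}"
    and x: "x \<in> C" and b: "nb E x \<inter> B = {b}"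
    and less: "\<And>D. maxind D \<Longrightarrow> card R < card (two_core D)"
  shows "\<exists>D. component_off (insert x (B - {b})) D \<and> b \<in> D \<and>
    two_core (insert x (B - {b})) = R \<union> D \<and> R \<inter> D = {}"
proof -
  define B' where "B' = insert x (B - {b})"
  have bB: "b \<in> B" using b by auto
  have CV: "C \<subseteq> V - B" and clC: "closed_off B C" using C by (auto simp: component_off_def closed_off_def)
  then have xV: "x \<in> V - B" using x by auto
  have B': "maxind B'" unfolding B'_def by (rule maxind_swap[OF B xV b])
  have deg: "card (nb E v - B) = 2" if "v \<in> R \<union> C" for v using two_core_closed(2)[OF B] that RC by simp
  have clR: "closed_off B R"
  proof -
    have "two_core B - C = R" using RC by auto
    then show ?thesis using closed_off_Diff[OF two_core_closed(1)[OF B] clC] by simp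
  qed
  define S where "S = two_core B'"
  note regS = regular_closed[OF B' two_core_subset two_core_deg]
  have SV: "S \<subseteq> V - B'" unfolding S_def by (rule two_core_subset)
  have clS: "closed_off B' S" unfolding S_def by (rule two_core_closed(1)[OF B'])
  have empty: "D = {}" if D: "D \<subseteq> C - {x}" "\<And>v. v \<in> D \<Longrightarrow> 2 \<le> card (nb E v \<inter> D)" for D
  proof -
    have DV: "D \<subseteq> V - B" using D CV by auto
    have "nb E v - B \<subseteq> D" if "v \<in> D" for v using regular_closed(1)[OF B DV D(2) that] by auto
    then have "closed_off B D" using DV unfolding closed_off_def by auto
    then show ?thesis using C D(1) x unfolding component_off_def by blast
  qed
  have finR: "finite R" using RC(1) two_core_subset[of B] finV finite_subset by (metis finite_Diff finite_Un)
  have bS: "b \<in> S"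
  proof (rule ccontr)
    assume nb: "b \<notin> S"
    have SB: "S \<subseteq> V - B - {x}" using SV nb unfolding B'_def by auto
    have "S \<subseteq> two_core B" by (rule two_core_upper) (use SB two_core_deg S_def in auto)
    then have S_RC: "S \<subseteq> R \<union> C" using RC by simp
    have "S \<inter> C = {}"
    proof (rule empty)
      show "S \<inter> C \<subseteq> C - {x}" using SB by auto
      fix v assume v: "v \<in> S \<inter> C"
      have "nb E v \<inter> S \<subseteq> C" using v SB clC unfolding closed_off_def by blast
      then have "nb E v \<inter> S \<subseteq> nb E v \<inter> (S \<inter> C)" by auto
      then have "card (nb E v \<inter> S) \<le> card (nb E v \<inter> (S \<inter> C))" by (intro card_mono) auto
      then show "2 \<le> card (nb E v \<inter> (S \<inter> C))" using two_core_deg[of v B'] v unfolding S_def by auto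
    qed
    then have "S \<subseteq> R" using S_RC by auto
    then have "card S \<le> card R" using finR by (rule card_mono[rotated])
    then show False using less[OF B'] unfolding S_def by simp
  qed
  have bV: "b \<in> V - B'" using bS SV by auto
  obtain D where D: "component_off B' D" "b \<in> D" and least: "\<And>P. closed_off B' P \<Longrightarrow> b \<in> P \<Longrightarrow> D \<subseteq> P"
    using component_exists[OF bV] by blast
  have clD: "closed_off B' D" using D by (simp add: component_off_def)
  have DS: "D \<subseteq> S" by (rule least[OF clS bS])
  have RV: "R \<subseteq> V - B'" using clR RC(2) x unfolding closed_off_def B'_def by auto
  have Rdeg: "2 \<le> card (nb E v \<inter> R)" if "v \<in> R" for v
  proof -
    have "nb E v - B \<subseteq> nb E v \<inter> R" using clR that by (auto simp: closed_off_def)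
    then have "card (nb E v - B) \<le> card (nb E v \<inter> R)" by (intro card_mono) auto
    then show ?thesis using deg that by simp
  qed
  have RS: "R \<subseteq> S" unfolding S_def by (rule two_core_upper[OF RV Rdeg])
  have clR': "closed_off B' R"
    using regular_closed(1)[OF B' RV Rdeg] RV unfolding closed_off_def by blast
  have "b \<notin> R" using clR bB by (auto simp: closed_off_def)
  then have "D \<subseteq> D - R" using least[OF closed_off_Diff[OF clD clR']] D(2) by blast
  then have RD: "R \<inter> D = {}" by auto
  have "S - (R \<union> D) = {}"
  proof (rule empty)
    have clP: "closed_off B' (S - R - D)" by (rule closed_off_Diff[OF closed_off_Diff[OF clS clR'] clD])
    have deg': "2 \<le> card (nb E v \<inter> (S - (R \<union> D)))" if "v \<in> S - (R \<union> D)" for v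
    proof -
      have "nb E v - B' \<subseteq> nb E v \<inter> (S - (R \<union> D))" using clP that by (auto simp: closed_off_def)
      then have "card (nb E v - B') \<le> card (nb E v \<inter> (S - (R \<union> D)))" by (intro card_mono) auto
      then show ?thesis using regS(2)[of v] that unfolding S_def by simp
    qed
    then show "\<And>v. v \<in> S - (R \<union> D) \<Longrightarrow> 2 \<le> card (nb E v \<inter> (S - (R \<union> D)))" .
    have PV: "S - (R \<union> D) \<subseteq> V - B - {x}" using SV D(2) unfolding B'_def by auto
    then have "S - (R \<union> D) \<subseteq> two_core B" by (intro two_core_upper deg') auto
    then show "S - (R \<union> D) \<subseteq> C - {x}" using RC PV by auto
  qed
  then have "two_core B' = R \<union> D" using RS DS unfolding S_def by auto
  then show ?thesis using D RD unfolding B'_def by blast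
qed

text \<open>The independent set \<open>B0\<close> is changed by a sequence of swaps, each replacing \<open>b\<close> by a
  neighbour \<open>x\<close> on a cycle of \<open>G - B\<close>. The component \<open>Q\<close> is what is left of that cycle after the
  swap; its ends have too few neighbours for \<open>Q\<close> to become part of a cycle again.\<close>

definition deficient :: "'a set \<Rightarrow> 'a \<Rightarrow> 'a set \<Rightarrow> 'a \<Rightarrow> 'a set \<Rightarrow> bool" where
  "deficient B0 x0 B x Q \<longleftrightarrow> x = x0 \<and> (\<forall>w\<in>nb E x0 - B0. card (nb E w - B) \<le> 1) \<or>
     (\<exists>y\<in>Q \<inter> B0. card (nb E y - B) \<le> 1)"

text \<open>\<open>c\<close> is the vertex of \<open>B0\<close> that the last swap returned, and it
  lies on the cycle \<open>C\<close>. By the last clause the neighbours outside \<open>B0\<close> of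
  a vertex in \<open>B - B0\<close> are off \<open>C\<close>. Hence the next swap, at a neighbour of
  \<open>c\<close> on \<open>C\<close>, again takes a vertex of \<open>B0\<close> out of
  \<open>B\<close>.\<close>

definition swap_state :: "'a set \<Rightarrow> 'a \<Rightarrow> 'a set \<Rightarrow> 'a set \<Rightarrow> 'a set \<Rightarrow> 'a \<Rightarrow> bool" where
  "swap_state B0 x0 R B C c \<longleftrightarrow> maxind B \<and> component_off B C \<and> two_core B = R \<union> C \<and> R \<inter> C = {} \<and>
     c \<in> C \<inter> B0 \<and> x0 \<in> B \<and>
     (\<forall>x\<in>B - B0. \<exists>Q. component_off B Q \<and> Q \<inter> C = {} \<and> nb E x - B0 \<subseteq> Q \<and> deficient B0 x0 B x Q)"

text \<open>Degree 2 in the core forces every deficient vertex of \<open>Q\<close> to have gained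
  \<open>b\<close> as a neighbour. A vertex of \<open>B0\<close> cannot, as
  \<open>b \<in> B0\<close>. In the other case both cycle neighbours of \<open>x0\<close> are
  adjacent to \<open>b\<close> as well, and a diamond appears.\<close>

lemma deficient_not_in_core:
  assumes df: diamond_free and B0: "maxind B0" and x0: "x0 \<notin> B0" "card (nb E x0 - B0) = 2"
    and B': "maxind B'" "x0 \<in> B'" and b: "b \<in> B0" "b \<notin> B'"
    and Q: "Q \<subseteq> two_core B'" "nb E z - B0 \<subseteq> Q" "deficient B0 x0 B z Q"
    and nbQ: "\<And>w. w \<in> Q \<Longrightarrow> nb E w - B' \<subseteq> insert b (nb E w - B)"
  shows False
proof -
  have deg: "card (nb E w - B') = 2" if "w \<in> Q" for w using two_core_closed(2)[OF B'(1)] Q(1) that by blast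
  have gain: "b \<in> nb E w" if w: "w \<in> Q" "card (nb E w - B) \<le> 1" for w
  proof (rule ccontr)
    assume "b \<notin> nb E w"
    then have "nb E w - B' \<subseteq> nb E w - B" using nbQ[OF w(1)] by auto
    then have "card (nb E w - B') \<le> card (nb E w - B)" by (intro card_mono) auto
    then show False using deg w by force
  qed
  from Q(3) show False
    unfolding deficient_def
  proof
    assume "\<exists>y\<in>Q \<inter> B0. card (nb E y - B) \<le> 1"
    then obtain y where "y \<in> Q" "y \<in> B0" "card (nb E y - B) \<le> 1" by blast
    then show False using gain b(1) B0 unfolding maxind_def by blast
  next
    assume a: "z = x0 \<and> (\<forall>w\<in>nb E x0 - B0. card (nb E w - B) \<le> 1)"
    obtain w w' where w: "nb E x0 - B0 = {w, w'}" "w \<noteq> w'" using x0(2) by (auto simp: card_2_iff)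
    have wQ: "w \<in> Q" "w' \<in> Q" using w a Q(2) by auto
    have wb: "b \<in> nb E w" "b \<in> nb E w'" using gain wQ a w by auto
    have wx: "x0 \<in> nb E w" "x0 \<in> nb E w'" using w nb_sym[of x0] by auto
    have wV: "w \<in> V - B'" "w' \<in> V - B'" using wQ Q(1) two_core_subset by blast+
    have one: "nb E u \<inter> B' = {x0}" if u: "u \<in> Q" "x0 \<in> nb E u" for u
      using maxind_nb_unique[OF B'(1) deg[OF u(1)], of x0] u B'(2) by blast
    have w0: "w \<notin> B0" "w' \<notin> B0" "w \<noteq> x0" using w wx by auto
    \<comment> \<open>\<open>x0\<close> is the only neighbour of \<open>w\<close> and of
      \<open>w'\<close> in \<open>B'\<close>. After \<open>w\<close> has replaced \<open>x0\<close>,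
      maximality demands a neighbour of \<open>w'\<close> in the new set, and only \<open>w\<close>
      is left.\<close>
    have "maxind (insert w (B' - {x0}))" by (rule maxind_swap[OF B'(1) wV(1) one[OF wQ(1) wx(1)]])
    moreover have "w' \<in> V - insert w (B' - {x0})" using wV w by auto
    ultimately have "nb E w' \<inter> insert w (B' - {x0}) \<noteq> {}" by (rule maxind_nb)
    then have "w \<in> nb E w'" using one[OF wQ(2) wx(2)] by auto
    moreover have "x0 = b \<or> w \<notin> nb E w'" using df wb wx nb_sym[of w w'] unfolding diamond_free_def by blast
    ultimately show False using x0 b by blast
  qed
qed

text \<open>Covers the initial swap too, where \<open>B\<close> is \<open>B0\<close>,
  \<open>x\<close> is \<open>x0\<close> and \<open>old\<close> is vacuous.\<close>

lemma swap_state_extend: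
  assumes df: diamond_free and B0: "maxind B0" and x0: "x0 \<notin> B0" "card (nb E x0 - B0) = 2"
    and less: "\<And>D. maxind D \<Longrightarrow> card R < card (two_core D)"
    and B: "maxind B" and C: "component_off B C" and RC: "two_core B = R \<union> C" "R \<inter> C = {}"
    and x: "x \<in> C" "x \<notin> B0" "x0 \<in> insert x B" and b: "nb E x \<inter> B = {b}" "b \<in> B0"
    and old: "\<And>z. z \<in> B - B0 \<Longrightarrow> \<exists>Q. component_off B Q \<and> Q \<inter> C = {} \<and> nb E z - B0 \<subseteq> Q \<and> deficient B0 x0 B z Q"
    and new: "nb E x - B0 \<subseteq> C - {x}" "deficient B0 x0 (insert x B) x (C - {x})"
  shows "\<exists>D. swap_state B0 x0 R (insert x (B - {b})) D b"
proof -
  define B' where "B' = insert x (B - {b})"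
  have bB: "b \<in> B" using b by auto
  have CV: "C \<subseteq> V - B" and clC: "closed_off B C" using C by (auto simp: component_off_def closed_off_def)
  then have xV: "x \<in> V - B" using x by auto
  have xb: "x \<noteq> b" using xV bB by auto
  have B': "maxind B'" unfolding B'_def by (rule maxind_swap[OF B xV b(1)])
  have x0B: "x0 \<in> B'" using x(3) x0 b unfolding B'_def by auto
  have bB': "b \<notin> B'" using xb unfolding B'_def by auto
  obtain D where D: "component_off B' D" "b \<in> D" "two_core B' = R \<union> D" "R \<inter> D = {}"
    using cycle_swap[OF B C RC x(1) b(1) less] unfolding B'_def by blast
  have clD: "closed_off B' D" using D by (simp add: component_off_def)
  \<comment> \<open>Applied with \<open>A = B\<close> to the earlier components and with
    \<open>A = insert x B\<close> to the opened cycle. Only the return of \<open>b\<close> could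
    change \<open>Q\<close>. If \<open>b\<close> had a neighbour in \<open>Q\<close>, then
    \<open>Q\<close> would be absorbed by \<open>D\<close> and lie in the core, against
    \<open>deficient_not_in_core\<close>.\<close>
  have keep: "component_off B' Q \<and> Q \<inter> D = {} \<and> deficient B0 x0 B' z Q"
    if Q: "component_off A Q" "nb E z - B0 \<subseteq> Q" "deficient B0 x0 A z Q"
      and A: "\<And>v. v \<in> Q \<Longrightarrow> v \<notin> B' \<and> v \<noteq> b \<and> nb E v - B' \<subseteq> insert b (nb E v - A) \<and> nb E v - A \<subseteq> insert b (nb E v - B')"
      and bA: "Q \<subseteq> V - A"
    for A Q z
  proof -
    have clQ: "closed_off A Q" using Q by (simp add: component_off_def)
    have minQ: "\<And>P. P \<subseteq> Q \<Longrightarrow> closed_off A P \<Longrightarrow> P = {} \<or> P = Q" using Q(1) by (auto simp: component_off_def)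
    have bQ: "b \<notin> Q" using A by blast
    have noadj: "b \<notin> nb E v" if v: "v \<in> Q" for v
    proof
      assume bv: "b \<in> nb E v"
      have vD: "v \<in> D" using clD D(2) bv A[OF v] nb_sym[of b v] unfolding closed_off_def by blast
      have "closed_off A (Q - D)"
        unfolding closed_off_def
      proof (intro conjI ballI)
        show "Q - D \<subseteq> V - A" using bA by auto
        show "nb E u - A \<subseteq> Q - D" if u: "u \<in> Q - D" for u
        proof
          fix w assume w: "w \<in> nb E u - A"
          then have wQ: "w \<in> Q" using clQ u unfolding closed_off_def by blast
          have "w \<notin> D"
          proof
            assume "w \<in> D"
            then have "nb E w - B' \<subseteq> D" using clD unfolding closed_off_def by blast
            then show False using w u A[of u] nb_sym[of u w] by blast
          qed
          then show "w \<in> Q - D" using wQ by blast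
        qed
      qed
      then have "Q - D = {} \<or> Q - D = Q" by (intro minQ) auto
      then have "Q \<subseteq> D" using v vD by blast
      then have QS: "Q \<subseteq> two_core B'" using D(3) by auto
      show False
        by (rule deficient_not_in_core[OF df B0 x0 B' x0B b(2) bB' QS Q(2,3)]) (use A in blast)
    qed
    have same: "nb E v - B' = nb E v - A" if v: "v \<in> Q" for v
      using A[OF v] noadj[OF v] by blast
    have QV: "Q \<subseteq> V - B'" using bA A by blast
    have "closed_off B' P \<longleftrightarrow> closed_off A P" if "P \<subseteq> Q" for P
      using same QV bA that unfolding closed_off_def by (metis subset_iff)
    then have comp: "component_off B' Q" using Q(1) unfolding component_off_def by blast
    then have clQ': "closed_off B' Q" by (simp add: component_off_def)
    have "D - Q = {} \<or> D - Q = D" using D(1) closed_off_Diff[OF clD clQ'] unfolding component_off_def by blast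
    then have "Q \<inter> D = {}" using D(2) bQ by blast
    moreover have "deficient B0 x0 B' z Q"
      using Q(3) unfolding deficient_def
    proof
      assume "z = x0 \<and> (\<forall>w\<in>nb E x0 - B0. card (nb E w - A) \<le> 1)"
      then show "z = x0 \<and> (\<forall>w\<in>nb E x0 - B0. card (nb E w - B') \<le> 1) \<or> (\<exists>y\<in>Q \<inter> B0. card (nb E y - B') \<le> 1)"
        using same Q(2) by (metis subsetD)
    next
      assume "\<exists>y\<in>Q \<inter> B0. card (nb E y - A) \<le> 1"
      then show "z = x0 \<and> (\<forall>w\<in>nb E x0 - B0. card (nb E w - B') \<le> 1) \<or> (\<exists>y\<in>Q \<inter> B0. card (nb E y - B') \<le> 1)"
        using same by (metis IntD1)
    qed
    ultimately show ?thesis using comp by blast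
  qed
  have "\<exists>Q. component_off B' Q \<and> Q \<inter> D = {} \<and> nb E z - B0 \<subseteq> Q \<and> deficient B0 x0 B' z Q" if z: "z \<in> B' - B0" for z
  proof (cases "z = x")
    case True
    have degC: "\<And>v. v \<in> C \<Longrightarrow> card (nb E v - B) = 2" using two_core_closed(2)[OF B] RC by auto
    note cm = component_minus_vertex[OF C degC x(1)]
    have "component_off B' (C - {x}) \<and> (C - {x}) \<inter> D = {} \<and> deficient B0 x0 B' x (C - {x})"
      by (rule keep[OF cm new]) (use CV bB in \<open>auto simp: B'_def\<close>)
    then show ?thesis using new(1) True by blast
  next
    case False
    then have "z \<in> B - B0" using z unfolding B'_def by auto
    then obtain Q where Q: "component_off B Q" "Q \<inter> C = {}" "nb E z - B0 \<subseteq> Q" "deficient B0 x0 B z Q"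
      using old by blast
    have QB: "Q \<subseteq> V - B" and clQ: "closed_off B Q" using Q by (auto simp: component_off_def closed_off_def)
    have xQ: "x \<notin> nb E v" if "v \<in> Q" for v
      using clQ that xV Q(2) x(1) unfolding closed_off_def by blast
    have "component_off B' Q \<and> Q \<inter> D = {} \<and> deficient B0 x0 B' z Q"
      by (rule keep[OF Q(1,3,4)]) (use QB bB xQ Q(2) x(1) in \<open>auto simp: B'_def\<close>)
    then show ?thesis using Q by blast
  qed
  then have "swap_state B0 x0 R B' D b"
    unfolding swap_state_def using B' D b x0B by blast
  then show ?thesis unfolding B'_def by blast
qed

text \<open>\<open>B0\<close> has the smallest core among all maximum independent sets. If this core
  is nonempty, opening a cycle always creates another one, so the swaps never stop; yet each further
  swap trades a vertex of \<open>B0\<close> for one outside, so \<open>card (B \<inter> B0)\<close>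
  decreases.\<close>

lemma diamond_free_two_core_empty:
  assumes df: diamond_free
  shows "\<exists>B. maxind B \<and> two_core B = {}"
proof (rule ccontr)
  assume none: "\<not> ?thesis"
  define ind where "ind B \<longleftrightarrow> B \<subseteq> V \<and> (\<forall>b\<in>B. nb E b \<inter> B = {})" for B
  have "ind {}" by (simp add: ind_def)
  moreover have "\<forall>B. ind B \<longrightarrow> card B < Suc (card V)"
    using card_mono[OF finV] by (auto simp: ind_def less_Suc_eq_le)
  ultimately have "\<exists>B. ind B \<and> (\<forall>C. ind C \<longrightarrow> card C \<le> card B)" by (rule ex_has_greatest_nat)
  then obtain B1 where "ind B1" "\<forall>C. ind C \<longrightarrow> card C \<le> card B1" by blast
  then have "maxind B1" by (simp add: maxind_def ind_def)
  then obtain B0 where B0: "maxind B0" and least: "\<And>B. maxind B \<Longrightarrow> card (two_core B0) \<le> card (two_core B)"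
    using ex_has_least_nat[of maxind B1 "\<lambda>B. card (two_core B)"] by blast
  obtain x0 where x0C: "x0 \<in> two_core B0" using none B0 by auto
  then have x0V: "x0 \<in> V - B0" using two_core_subset by auto
  have deg0: "card (nb E v - B0) = 2" if "v \<in> two_core B0" for v using two_core_closed(2)[OF B0 that] .
  obtain C0 where C0: "component_off B0 C0" "x0 \<in> C0" and C0least: "\<And>P. closed_off B0 P \<Longrightarrow> x0 \<in> P \<Longrightarrow> C0 \<subseteq> P"
    using component_exists[OF x0V] by blast
  have C0sub: "C0 \<subseteq> two_core B0" by (rule C0least[OF two_core_closed(1)[OF B0] x0C])
  define R where "R = two_core B0 - C0"
  have RC0: "two_core B0 = R \<union> C0" "R \<inter> C0 = {}" using C0sub by (auto simp: R_def)
  have fin_core: "finite (two_core B0)" using two_core_subset finV finite_subset by (metis finite_Diff)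
  have "R \<subset> two_core B0" using x0C C0(2) by (auto simp: R_def)
  then have Rless: "card R < card (two_core B0)" by (rule psubset_card_mono[OF fin_core])
  have less: "card R < card (two_core D)" if "maxind D" for D using Rless least[OF that] by linarith
  obtain b0 where b0: "nb E x0 \<inter> B0 = {b0}"
  proof -
    obtain b where "b \<in> nb E x0 \<inter> B0" using maxind_nb(1)[OF B0 x0V] by blast
    then show ?thesis using that[of b] maxind_nb_unique[OF B0 deg0[OF x0C]] by blast
  qed
  have x0n: "x0 \<notin> B0" using x0V by auto
  have clC0: "nb E v - B0 \<subseteq> C0" if "v \<in> C0" for v
    by (rule component_closed(3)[OF C0(1) that])
  have new0: "nb E x0 - B0 \<subseteq> C0 - {x0}" using clC0[OF C0(2)] by auto
  have def0: "deficient B0 x0 (insert x0 B0) x0 (C0 - {x0})"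
    unfolding deficient_def
  proof (intro disjI1 conjI ballI refl)
    fix w assume w: "w \<in> nb E x0 - B0"
    then have "card (nb E w - B0) = 2" using deg0 new0 C0sub by blast
    moreover have "x0 \<in> nb E w - B0" using w x0n nb_sym[of w x0] by auto
    moreover have "nb E w - insert x0 B0 = (nb E w - B0) - {x0}" by auto
    ultimately show "card (nb E w - insert x0 B0) \<le> 1" by simp
  qed
  have start: "\<exists>B C c. swap_state B0 x0 R B C c"
    using swap_state_extend[OF df B0 x0n deg0[OF x0C] less B0 C0(1) RC0 C0(2) x0n _ b0 _ _ new0 def0] b0 by blast
  have step: "\<exists>B' C' c'. swap_state B0 x0 R B' C' c' \<and> card (B' \<inter> B0) < card (B \<inter> B0)"
    if st: "swap_state B0 x0 R B C c" for B C c
  proof -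
    have B: "maxind B" and C: "component_off B C" and RC: "two_core B = R \<union> C" "R \<inter> C = {}"
      and c: "c \<in> C" "c \<in> B0" and x0B: "x0 \<in> B"
      and old: "\<And>z. z \<in> B - B0 \<Longrightarrow> \<exists>Q. component_off B Q \<and> Q \<inter> C = {} \<and> nb E z - B0 \<subseteq> Q \<and> deficient B0 x0 B z Q"
      using st unfolding swap_state_def by auto
    have clC: "\<And>v. v \<in> C \<Longrightarrow> nb E v - B \<subseteq> C" and CV: "C \<subseteq> V - B" using component_closed[OF C] by auto
    have deg: "card (nb E v - B) = 2" if "v \<in> C" for v using two_core_closed(2)[OF B] RC that by auto
    have "nb E c - B \<noteq> {}" using deg[OF c(1)] by (metis card.empty zero_neq_numeral)
    then obtain x where xc: "x \<in> nb E c - B" by blast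
    then have x: "x \<in> C" "x \<notin> B0" using clC[OF c(1)] c B0 by (auto simp: maxind_def)
    have xV: "x \<in> V - B" using x CV by auto
    obtain b where b: "nb E x \<inter> B = {b}"
    proof -
      obtain b where "b \<in> nb E x \<inter> B" using maxind_nb(1)[OF B xV] by blast
      then show ?thesis using that[of b] maxind_nb_unique[OF B deg[OF x(1)]] by blast
    qed
    have bB: "b \<in> B" using b by auto
    have b0: "b \<in> B0"
    proof (rule ccontr)
      assume "b \<notin> B0"
      then obtain Q where Q: "Q \<inter> C = {}" "nb E b - B0 \<subseteq> Q" using old[of b] bB by blast
      have "x \<in> nb E b - B0" using b x nb_sym[of x b] by auto
      then show False using Q x by blast
    qed
    have new: "nb E x - B0 \<subseteq> C - {x}" using clC[OF x(1)] b b0 by fastforce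
    \<comment> \<open>The witness is \<open>c\<close>: it belongs to \<open>B0\<close> and has just
      lost one of its two neighbours on \<open>C\<close>.\<close>
    have "deficient B0 x0 (insert x B) x (C - {x})"
      unfolding deficient_def
    proof (intro disjI2 bexI[of _ c])
      have "nb E c - insert x B = (nb E c - B) - {x}" by auto
      then show "card (nb E c - insert x B) \<le> 1" using deg[OF c(1)] xc by simp
      show "c \<in> (C - {x}) \<inter> B0" using c x by auto
    qed
    then obtain D where "swap_state B0 x0 R (insert x (B - {b})) D b"
      using swap_state_extend[OF df B0 x0n deg0[OF x0C] less B C RC x _ b b0 old new] x0B by blast
    moreover have "insert x (B - {b}) \<inter> B0 = B \<inter> B0 - {b}" using x by auto
    then have "card (insert x (B - {b}) \<inter> B0) < card (B \<inter> B0)"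
      using bB b0 maxind_fin[OF B] by (metis card_Diff1_less finite_Int IntI)
    ultimately show ?thesis by blast
  qed
  have "\<not> swap_state B0 x0 R B C c" for B C c
  proof (induction "card (B \<inter> B0)" arbitrary: B C c rule: less_induct)
    case less
    then show ?case using step by blast
  qed
  then show False using start by blast
qed

lemma diamond_free_good:
  assumes df: diamond_free
  shows "\<exists>B. good B"
proof -
  obtain B where B: "maxind B" "two_core B = {}" using diamond_free_two_core_empty[OF df] by blast
  have "\<exists>\<psi>. injective_edge_coloring (edges_within E (V - B)) \<psi> 2"
  proof (rule linear_forest_injective_coloring)
    show "finite (V - B)" using finV by simp
    show "card (nb E v \<inter> (V - B)) \<le> 2" if "v \<in> V - B" for v
    proof -
      have "nb E v \<inter> (V - B) = nb E v - B" using nb_subset by auto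
      then show ?thesis using maxind_nb(2)[OF B(1) that] by simp
    qed
    show "\<exists>v\<in>S. card (nb E v \<inter> S) \<le> 1" if S: "S \<subseteq> V - B" "S \<noteq> {}" for S
    proof (rule ccontr)
      assume "\<not> ?thesis"
      then have "2 \<le> card (nb E v \<inter> S)" if "v \<in> S" for v using that by force
      then have "S \<subseteq> two_core B" using two_core_upper[OF S(1)] by blast
      then show False using S B(2) by blast
    qed
  qed
  then show ?thesis using B(1) unfolding good_def maxind_def by blast
qed

end

section \<open>Diamonds\<close>

lemma planar_edges_within: "planar V E \<Longrightarrow> W \<subseteq> V \<Longrightarrow> planar W (edges_within E W)"
proof -
  assume "planar V E" and W: "W \<subseteq> V"
  then obtain p \<gamma> where d: "drawing V E p \<gamma>" by (auto simp: planar_drawing)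
  have img: "path_image (\<gamma> e) \<inter> p ` W = p ` e" if e: "e \<in> edges_within E W" for e
  proof -
    have eq: "path_image (\<gamma> e) \<inter> p ` V = p ` e" using d e by (simp add: drawing_def edges_within_def)
    have "e \<subseteq> W" using e by (simp add: edges_within_def)
    then have sub: "p ` e \<subseteq> p ` W" "p ` W \<subseteq> p ` V" using W by auto
    have "path_image (\<gamma> e) \<inter> p ` W = (path_image (\<gamma> e) \<inter> p ` V) \<inter> p ` W" using sub by blast
    then show ?thesis by (simp only: eq Int_absorb2[OF sub(1)])
  qed
  have sub: "e \<in> E" if "e \<in> edges_within E W" for e using that by (simp add: edges_within_def)
  have "drawing W (edges_within E W) p \<gamma>"
    unfolding drawing_def
  proof (intro conjI ballI allI impI)
    show "inj_on p W" using d W inj_on_subset by (auto simp: drawing_def)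
  next
    fix e u v assume "e \<in> edges_within E W" "e = {u, v}"
    then show "arc (\<gamma> e)" "{pathstart (\<gamma> e), pathfinish (\<gamma> e)} = {p u, p v}"
      using drawing_arc[OF d] sub by blast+
  next
    fix e f assume "e \<in> edges_within E W" "f \<in> edges_within E W" "e \<noteq> f"
    then show "path_image (\<gamma> e) \<inter> path_image (\<gamma> f) \<subseteq> p ` (e \<inter> f)"
      using drawing_meet[OF d] sub by blast
  qed (rule img)
  then show ?thesis by (auto simp: planar_drawing)
qed

section \<open>Colours for the edges of a diamond\<close>

lemma fresh_color:
  assumes "finite X" "card X < 6"
  shows "\<exists>c::nat. c < 6 \<and> c \<notin> X"
proof (rule ccontr)
  assume "\<not> ?thesis"
  then have "{..<6} \<subseteq> X" by auto
  then have "card {..<6::nat} \<le> card X" using assms by (intro card_mono)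
  then show False using assms by simp
qed

text \<open>For a diamond \<open>x y b b'\<close> the colours are \<open>p\<close>, \<open>q\<close> for \<open>b x\<close>, \<open>b y\<close>, \<open>r\<close>, \<open>s\<close> for \<open>b' x\<close>, \<open>b' y\<close>,
  \<open>t\<close> for \<open>x y\<close>, and \<open>k\<close>, \<open>k'\<close> for the third edges at \<open>b\<close> and \<open>b'\<close>; the sets are the colours
  forbidden by the rest of the graph.\<close>

lemma diamond_colors:
  assumes fin: "finite S" "finite S'" "finite M" "finite M'"
    and card: "card S \<le> 4" "card S' \<le> 4" "card M \<le> 2" "card M' \<le> (2::nat)"
  obtains k k' p q r s t :: nat where "k < 6" "k' < 6" "p < 6" "q < 6" "r < 6" "s < 6" "t < 6"
     "k \<notin> S" "k' \<notin> S'" "k \<noteq> k'" "p \<notin> M" "q \<notin> M" "r \<notin> M'" "s \<notin> M'"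
     "p \<noteq> q" "p \<noteq> s" "q \<noteq> r" "r \<noteq> s" "p \<noteq> k'" "q \<noteq> k'" "r \<noteq> k" "s \<noteq> k" "t \<notin> {k, k', p, q, r, s}"
proof -
  have ins: "card (insert a X) \<le> Suc (card X)" for a :: nat and X by (rule card_insert_le_m1) auto
  \<comment> \<open>At most four of the six colours are forbidden for \<open>k\<close>, and then at
    most five for \<open>k'\<close>.\<close>
  obtain k where k: "k < 6" "k \<notin> S" using fresh_color[of S] fin card by auto
  obtain k' where k': "k' < 6" "k' \<notin> insert k S'" using fresh_color[of "insert k S'"] fin card ins[of k S'] by auto
  have kk': "k \<noteq> k'" using k' by auto
  \<comment> \<open>The colours open to \<open>p\<close>, \<open>q\<close> and to \<open>r\<close>,
    \<open>s\<close>, at least 6 - 3 in each list. What remains is to repeat a colour among the six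
    edges, so that one is left for \<open>t\<close>.\<close>
  define L where "L = {..<6} - insert k' M"
  define L' where "L' = {..<6} - insert k M'"
  have fL: "finite L" "finite L'" by (auto simp: L_def L'_def)
  have big: "card ({..<6} - insert a X) \<ge> 3" if "finite X" "card X \<le> 2" for a and X :: "nat set"
    using diff_card_le_card_Diff[of "insert a X" "{..<6}"] that ins[of a X] by simp
  have cL: "card L \<ge> 3" "card L' \<ge> 3" using big fin card unfolding L_def L'_def by auto
  have pick: "\<exists>v\<in>X. v \<noteq> a" if "card X \<ge> 3" for a :: nat and X
  proof (rule ccontr)
    assume "\<not> ?thesis"
    then have "X \<subseteq> {a}" by auto
    then have "card X \<le> card {a}" by (intro card_mono) auto
    then show False using that by simp
  qed
  have last: "\<exists>t<6. t \<notin> {k, k', p, q, r, s}" if "card {k, k', p, q, r, s} < 6" for p q r s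
    using fresh_color[of "{k, k', p, q, r, s}"] that by auto
  show ?thesis
  proof (cases "L \<inter> L' = {}")
    \<comment> \<open>A colour in both lists serves as \<open>p\<close> and as
      \<open>r\<close>.\<close>
    case False
    then obtain c where c: "c \<in> L" "c \<in> L'" by auto
    obtain q where q: "q \<in> L" "q \<noteq> c" using pick cL by blast
    obtain s where s: "s \<in> L'" "s \<noteq> c" using pick cL by blast
    have "card {k, k', c, q, c, s} < 6" by (auto simp: card_insert_if)
    then obtain t where "t < 6" "t \<notin> {k, k', c, q, c, s}" using last by blast
    moreover have "c < 6" "c \<notin> M" "c \<noteq> k'" "c \<notin> M'" "c \<noteq> k" "q < 6" "q \<notin> M" "q \<noteq> k'" "s < 6" "s \<notin> M'" "s \<noteq> k"
      using c q s by (auto simp: L_def L'_def)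
    ultimately show ?thesis using [[linarith_neq_limit = 0]] k k' kk' q(2) s(2)
      by (intro that[of k k' c q c s t]) simp_all
  next
    \<comment> \<open>Disjoint lists partition the six colours. As \<open>k\<close> is not in
      \<open>L'\<close>, it lies in \<open>L\<close>, so \<open>p\<close> can repeat
      \<open>k\<close>; likewise \<open>r\<close> can repeat \<open>k'\<close>.\<close>
    case True
    have "card (L \<union> L') = card L + card L'" by (rule card_Un_disjoint[OF fL True])
    moreover have sub: "L \<union> L' \<subseteq> {..<6}" by (auto simp: L_def L'_def)
    ultimately have "card (L \<union> L') = 6" using cL card_mono[OF _ sub] by simp
    then have eq: "L \<union> L' = {..<6}" using card_subset_eq[OF _ sub] by simp
    have kk: "k \<in> L" "k' \<in> L'" using eq k k' by (auto simp: L_def L'_def)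
    obtain q where q: "q \<in> L" "q \<noteq> k" using pick cL by blast
    obtain s where s: "s \<in> L'" "s \<noteq> k'" using pick cL by blast
    have "card {k, k', k, q, k', s} < 6" by (auto simp: card_insert_if)
    then obtain t where "t < 6" "t \<notin> {k, k', k, q, k', s}" using last by blast
    moreover have "k \<noteq> s" "q \<noteq> k'" "q \<noteq> s" using True kk q s by auto
    moreover have "k \<notin> M" "k' \<notin> M'" "q < 6" "q \<notin> M" "q \<noteq> k'" "s < 6" "s \<notin> M'" "s \<noteq> k"
      using kk q s by (auto simp: L_def L'_def)
    ultimately show ?thesis using [[linarith_neq_limit = 0]] k k' kk' q(2) s(2)
      by (intro that[of k k' k q k' s t]) simp_all
  qed
qed

context subcubic_graph
begin

lemma subcubic_edges_within: "W \<subseteq> V \<Longrightarrow> subcubic_graph W (edges_within E W)"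
proof
  assume W: "W \<subseteq> V"
  show "finite W" using W finV finite_subset by blast
  show "\<exists>u v. u \<in> W \<and> v \<in> W \<and> u \<noteq> v \<and> e = {u, v}" if "e \<in> edges_within E W" for e
    using that edgeE[of e] by (auto simp: edges_within_def)
  show "card (nb (edges_within E W) v) \<le> 3" for v
    by (rule nb_card_le[of _ v]) (auto simp: nb_def edges_within_def)
qed

lemma conflict_share:
  assumes "inj_conflict E {u, v} {u, w}" "{u, v} \<in> E" "{u, w} \<in> E"
  shows "w \<in> nb E v"
  using assms order_refl
proof (cases rule: inj_conflict_cases)
  case (triangle a b c)
  have "v \<in> nb E u" "w \<in> nb E u" using nbI assms(2,3) by auto
  then have "u \<noteq> v" "u \<noteq> w" by auto
  moreover have "v \<noteq> w" using assms(1) by (auto simp: inj_conflict_def)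
  ultimately have "b = v" "c = w" using triangle by (auto simp: doubleton_eq_iff)
  then show ?thesis using triangle(3) nbI by blast
qed auto

lemma conflict_disjoint:
  assumes "inj_conflict E e f" "e \<in> E" "f \<in> E" "e \<inter> f = {}"
  shows "\<exists>x\<in>e. \<exists>y\<in>f. y \<in> nb E x"
  using assms(1-3) order_refl
proof (cases rule: inj_conflict_cases)
  case (far x y)
  then show ?thesis using nbI by blast
next
  case (triangle a b c)
  then show ?thesis using assms(4) by auto
qed

lemma edges_at_card:
  assumes "z \<in> nb E v"
  shows "card {e \<in> E. v \<in> e \<and> z \<notin> e} \<le> 2"
proof -
  have "{e \<in> E. v \<in> e \<and> z \<notin> e} \<subseteq> (\<lambda>u. {v, u}) ` (nb E v - {z})"
    using edge_nb by fastforce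
  then have "card {e \<in> E. v \<in> e \<and> z \<notin> e} \<le> card ((\<lambda>u. {v, u}) ` (nb E v - {z}))"
    by (intro card_mono) auto
  also have "\<dots> \<le> card (nb E v - {z})" by (rule card_image_le) simp
  finally show ?thesis using assms deg3[of v] by simp
qed

lemma finE: "finite E"
  by (rule finite_subset[of _ "Pow V"]) (use edge_subset_V finV in auto)

text \<open>All neighbours of \<open>x\<close> and \<open>y\<close> lie in the diamond. If
  \<open>b\<close> and \<open>b'\<close> are adjacent, it is a whole component with six edges, and
  they get six colours. Otherwise at most one further edge leaves each of \<open>b\<close> and
  \<open>b'\<close>, so few old edges restrict the new ones.\<close>

lemma diamond_extend:
  assumes xy: "y \<in> nb E x" and b: "b \<in> nb E x" "b \<in> nb E y" and b': "b' \<in> nb E x" "b' \<in> nb E y" and bb: "b \<noteq> b'"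
    and c': "injective_edge_coloring (edges_within E (V - {x, y, b, b'})) c' 6"
  shows "\<exists>c. injective_edge_coloring E c 6"
proof -
  define W where "W = V - {x, y, b, b'}"
  define F where "F = edges_within E W"
  have dist: "x \<noteq> y" "b \<noteq> x" "b \<noteq> y" "b' \<noteq> x" "b' \<noteq> y" using xy b b' by auto
  have sy: "x \<in> nb E y" "x \<in> nb E b" "y \<in> nb E b" "x \<in> nb E b'" "y \<in> nb E b'"
    using xy b b' nb_sym by blast+
  have nbx: "nb E x = {y, b, b'}" using nb_le_3[of y x b b'] xy b b' bb dist by blast
  have nby: "nb E y = {x, b, b'}" using nb_le_3[of x y b b'] sy b b' bb dist by blast
  have c'F: "c' e < 6" if "e \<in> F" for e using c' that unfolding F_def W_def injective_edge_coloring_def by blast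
  have old: "c' e \<noteq> c' f" if ef: "e \<in> F" "f \<in> F" "inj_conflict E e f" for e f
  proof -
    have "inj_conflict F e f" using inj_conflict_within[OF ef(3) order_refl] ef unfolding F_def by blast
    then show ?thesis using c' ef unfolding F_def W_def injective_edge_coloring_def by blast
  qed
  have FE: "F \<subseteq> E" and FW: "e \<subseteq> W" if "e \<in> F" for e using that by (auto simp: F_def edges_within_def)
  show ?thesis
  proof (cases "b' \<in> nb E b")
    case True
    have nbb: "nb E b = {x, y, b'}" using nb_le_3[of x b y b'] sy True bb dist by blast
    have nbb': "nb E b' = {x, y, b}" using nb_le_3[of x b' y b] sy True bb dist nb_sym[of b b'] by blast
    let ?D = "{x, y, b, b'}"
    have closed: "nb E v \<subseteq> ?D" if "v \<in> ?D" for v using that nbx nby nbb nbb' by auto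
    have cls: "e \<in> F \<or> e \<in> {{x, y}, {x, b}, {x, b'}, {y, b}, {y, b'}, {b, b'}}" if e: "e \<in> E" for e
    proof (cases "e \<inter> ?D = {}")
      case True
      then have "e \<subseteq> W" using edge_subset_V[OF e] by (auto simp: W_def)
      then show ?thesis using e by (simp add: F_def edges_within_def)
    next
      case False
      then obtain v where v: "v \<in> e" "v \<in> ?D" by auto
      then obtain u where u: "e = {v, u}" "u \<in> nb E v" "u \<noteq> v" using edge_nb[OF e] by blast
      have "u \<in> ?D" using closed[OF v(2)] u(2) by (rule subsetD)
      then have "{v, u} \<in> {{x, y}, {x, b}, {x, b'}, {y, b}, {y, b'}, {b, b'}}"
        using v(2) u(3) by (auto simp: doubleton_eq_iff)
      then show ?thesis using u(1) by simp
    qed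
    define c where "c e = (if e = {x, y} then 0 else if e = {x, b} then 1 else if e = {x, b'} then 2
      else if e = {y, b} then 3 else if e = {y, b'} then 4 else if e = {b, b'} then 5 else c' e)" for e
    have cF: "c e = c' e" if "e \<in> F" for e
    proof -
      have "x \<notin> e" "y \<notin> e" "b \<notin> e" "b' \<notin> e" using FW[OF that] by (auto simp: W_def)
      then have "e \<noteq> {x, y}" "e \<noteq> {x, b}" "e \<noteq> {x, b'}" "e \<noteq> {y, b}" "e \<noteq> {y, b'}" "e \<noteq> {b, b'}" "b \<notin> e" "b' \<notin> e" by blast+
      then show ?thesis by (simp add: c_def)
    qed
    have c6: "c {x, y} = 0" "c {x, b} = 1" "c {x, b'} = 2" "c {y, b} = 3" "c {y, b'} = 4" "c {b, b'} = 5"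
      by (simp_all add: c_def doubleton_eq_iff dist dist[symmetric] bb bb[symmetric])
    have sep: "\<not> inj_conflict E e f" if h: "e \<in> F" "f \<in> E" "f \<notin> F" for e f
    proof
      assume co: "inj_conflict E e f"
      have fD: "f \<subseteq> ?D" using cls[OF h(2)] h(3) by auto
      have eW: "e \<subseteq> W" using FW h(1) .
      have "e \<inter> f = {}" using fD eW by (auto simp: W_def)
      then obtain u v where "u \<in> e" "v \<in> f" "v \<in> nb E u" using conflict_disjoint[OF co] h(1,2) FE by blast
      then have "u \<in> ?D" using closed[of v] nb_sym[of v u] fD by blast
      then show False using \<open>u \<in> e\<close> eW by (auto simp: W_def)
    qed
    have "injective_edge_coloring E c 6"
      unfolding injective_edge_coloring_def
    proof (intro conjI ballI impI)
      fix e assume "e \<in> E"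
      then show "c e < 6" using cls[of e] cF[of e] c'F[of e] by (auto simp: c6)
    next
      fix e f assume ef: "e \<in> E" "f \<in> E" "inj_conflict E e f"
      have ne: "e \<noteq> f" using ef(3) by (auto simp: inj_conflict_def)
      show "c e \<noteq> c f"
      proof (cases "e \<in> F")
        case True
        then have "f \<in> F" using sep ef by blast
        then show ?thesis using True old ef cF by auto
      next
        case False
        then have "f \<notin> F" using sep[of f e] ef inj_conflict_sym by blast
        then show ?thesis using False cls[OF ef(1)] cls[OF ef(2)] ne
          by (auto simp: c6)
      qed
    qed
    then show ?thesis by blast
  next
    case nadj: False
    then have nadj': "b \<notin> nb E b'" using nb_sym by blast
    \<comment> \<open>Let \<open>a\<close> be the neighbour of \<open>d\<close> outside the diamond.
      \<open>SS d\<close> holds the old edges in conflict with \<open>d a\<close>: they meet a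
      further neighbour of \<open>a\<close> but not \<open>a\<close>, so there are at most 2 * 2.
      \<open>MM d\<close>, next, holds the at most two old edges at \<open>a\<close>, which conflict
      with \<open>x d\<close> and \<open>y d\<close>.\<close>
    define SS where "SS d = {e \<in> F. e \<inter> nb E d = {} \<and> (\<exists>w\<in>nb E d \<inter> W. \<exists>u\<in>e. u \<in> nb E w)}" for d
    define MM where "MM d = {e \<in> F. e \<inter> nb E d \<noteq> {}}" for d
    have unique: "u = v" if "d = b \<or> d = b'" "u \<in> nb E d \<inter> W" "v \<in> nb E d \<inter> W" for d u v
    proof -
      have "x \<in> nb E d" "y \<in> nb E d" "u \<noteq> x" "u \<noteq> y" "v \<noteq> x" "v \<noteq> y" using that sy by (auto simp: W_def)
      then show ?thesis using nb_le_3[of x d y u v] that dist by blast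
    qed
    have finSM: "finite (c' ` SS d)" "finite (c' ` MM d)" for d
      using finE FE by (auto simp: SS_def MM_def F_def edges_within_def)
    have MMc: "card (c' ` MM d) \<le> 2" if d: "d = b \<or> d = b'" for d
    proof (cases "nb E d \<inter> W = {}")
      case True
      then have "MM d = {}" using FW by (auto simp: MM_def)
      then show ?thesis by simp
    next
      case False
      then obtain a where a: "a \<in> nb E d \<inter> W" by blast
      have "MM d \<subseteq> {e \<in> E. a \<in> e \<and> d \<notin> e}"
      proof
        fix e assume e: "e \<in> MM d"
        then obtain u where u: "u \<in> e" "u \<in> nb E d" "e \<in> F" by (auto simp: MM_def)
        then have "u = a" using unique[OF d _ a] FW by blast
        moreover have "d \<notin> e" using FW[OF u(3)] d by (auto simp: W_def)
        ultimately show "e \<in> {e \<in> E. a \<in> e \<and> d \<notin> e}" using u FE by blast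
      qed
      then have "card (MM d) \<le> card {e \<in> E. a \<in> e \<and> d \<notin> e}" using finE by (intro card_mono) auto
      also have "\<dots> \<le> 2" by (rule edges_at_card) (use a nb_sym in blast)
      finally show ?thesis using card_image_le[of "MM d" c'] finE by (auto simp: MM_def F_def edges_within_def intro: le_trans)
    qed
    have SSc: "card (c' ` SS d) \<le> 4" if d: "d = b \<or> d = b'" for d
    proof (cases "nb E d \<inter> W = {}")
      case True
      then have "SS d = {}" by (auto simp: SS_def)
      then show ?thesis by simp
    next
      case False
      then obtain a where a: "a \<in> nb E d \<inter> W" by blast
      have da: "d \<in> nb E a" using a nb_sym by blast
      have "SS d \<subseteq> (\<Union>u\<in>nb E a - {d}. {e \<in> E. u \<in> e \<and> a \<notin> e})"
      proof
        fix e assume "e \<in> SS d"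
        then obtain w u where wu: "e \<in> F" "e \<inter> nb E d = {}" "w \<in> nb E d \<inter> W" "u \<in> e" "u \<in> nb E w" by (auto simp: SS_def)
        have "w = a" using unique[OF d wu(3) a] .
        moreover have "u \<noteq> d" using FW[OF wu(1)] wu(4) d by (auto simp: W_def)
        ultimately show "e \<in> (\<Union>u\<in>nb E a - {d}. {e \<in> E. u \<in> e \<and> a \<notin> e})" using wu a FE by blast
      qed
      then have "card (SS d) \<le> card (\<Union>u\<in>nb E a - {d}. {e \<in> E. u \<in> e \<and> a \<notin> e})" using finE by (intro card_mono) auto
      also have "\<dots> \<le> (\<Sum>u\<in>nb E a - {d}. card {e \<in> E. u \<in> e \<and> a \<notin> e})" by (rule card_UN_le) simp
      also have "\<dots> \<le> (\<Sum>u\<in>nb E a - {d}. 2)" by (rule sum_mono, rule edges_at_card) (use nb_sym in blast)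
      also have "\<dots> \<le> 4" using da deg3[of a] by simp
      finally show ?thesis using card_image_le[of "SS d" c'] finE by (auto simp: SS_def F_def edges_within_def intro: le_trans)
    qed
    have cSM: "card (c' ` SS b) \<le> 4" "card (c' ` SS b') \<le> 4" "card (c' ` MM b) \<le> 2" "card (c' ` MM b') \<le> 2"
      using SSc MMc by auto
    obtain k k' p q r s t :: nat where lt: "k < 6" "k' < 6" "p < 6" "q < 6" "r < 6" "s < 6" "t < 6"
      and kS: "k \<notin> c' ` SS b" "k' \<notin> c' ` SS b'" and ne1: "k \<noteq> k'"
      and pM: "p \<notin> c' ` MM b" "q \<notin> c' ` MM b" "r \<notin> c' ` MM b'" "s \<notin> c' ` MM b'"
      and ne2: "p \<noteq> q" "p \<noteq> s" "q \<noteq> r" "r \<noteq> s" "p \<noteq> k'" "q \<noteq> k'" "r \<noteq> k" "s \<noteq> k" "t \<notin> {k, k', p, q, r, s}"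
      by (rule diamond_colors[OF finSM(1)[of b] finSM(1)[of b'] finSM(2)[of b] finSM(2)[of b'] cSM])
    note ne = ne1 ne2
    note [[linarith_neq_limit = 0]] \<comment> \<open>otherwise the simplifier splits each disequality of \<open>ne\<close> into two inequalities\<close>
    define c where "c e = (if e = {x, y} then t else if e = {x, b} then p else if e = {y, b} then q
      else if e = {x, b'} then r else if e = {y, b'} then s else if b \<in> e then k else if b' \<in> e then k' else c' e)" for e
    have c5: "c {x, y} = t" "c {x, b} = p" "c {y, b} = q" "c {x, b'} = r" "c {y, b'} = s"
      by (simp_all add: c_def doubleton_eq_iff dist dist[symmetric] bb bb[symmetric])
    have c_off: "c e = (if b \<in> e then k else if b' \<in> e then k' else c' e)" if "x \<notin> e" "y \<notin> e" for e
    proof -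
      have "e \<noteq> {x, y}" "e \<noteq> {x, b}" "e \<noteq> {y, b}" "e \<noteq> {x, b'}" "e \<noteq> {y, b'}" using that by blast+
      then show ?thesis by (simp add: c_def)
    qed
    have cls: "e = {x, y} \<and> c e = t \<or> e = {x, b} \<and> c e = p \<or> e = {y, b} \<and> c e = q \<or> e = {x, b'} \<and> c e = r \<or>
       e = {y, b'} \<and> c e = s \<or> (\<exists>a\<in>nb E b \<inter> W. e = {b, a} \<and> c e = k) \<or> (\<exists>a\<in>nb E b' \<inter> W. e = {b', a} \<and> c e = k') \<or>
       e \<in> F \<and> c e = c' e" if e: "e \<in> E" for e
    proof -
      consider "x \<in> e \<or> y \<in> e" | "x \<notin> e" "y \<notin> e" "b \<in> e" | "x \<notin> e" "y \<notin> e" "b \<notin> e" "b' \<in> e"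
        | "x \<notin> e" "y \<notin> e" "b \<notin> e" "b' \<notin> e" by blast
      then show ?thesis
      proof cases
        case 1
        then obtain v u where u: "v = x \<or> v = y" "e = {v, u}" "u \<in> nb E v"
          using edge_nb[OF e, of x] edge_nb[OF e, of y] by blast
        then have "u \<in> {x, y, b, b'}" "u \<noteq> v" using nbx nby by auto
        then have "e \<in> {{x, y}, {x, b}, {y, b}, {x, b'}, {y, b'}}"
          unfolding u(2) using u(1) by (auto simp: doubleton_eq_iff)
        then have "e = {x, y} \<or> e = {x, b} \<or> e = {y, b} \<or> e = {x, b'} \<or> e = {y, b'}" by simp
        then show ?thesis by (elim disjE) (simp_all add: c5)
      next
        case 2
        then obtain a where a: "e = {b, a}" "a \<in> nb E b" using edge_nb[OF e] by blast
        then have "a \<in> W" using 2 nadj nb_V[of a b] by (auto simp: W_def)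
        moreover have "c e = k" using c_off[OF 2(1,2)] 2(3) by simp
        ultimately have "\<exists>a\<in>nb E b \<inter> W. e = {b, a} \<and> c e = k" using a by blast
        then show ?thesis by simp
      next
        case 3
        then obtain a where a: "e = {b', a}" "a \<in> nb E b'" using edge_nb[OF e] by blast
        then have "a \<in> W" using 3 nadj' nb_V[of a b'] by (auto simp: W_def)
        moreover have "c e = k'" using c_off[OF 3(1,2)] 3(3,4) by simp
        ultimately have "\<exists>a\<in>nb E b' \<inter> W. e = {b', a} \<and> c e = k'" using a by blast
        then show ?thesis by simp
      next
        case 4
        then have "e \<subseteq> W" using edge_subset_V[OF e] by (auto simp: W_def)
        then have "e \<in> F" using e by (simp add: F_def edges_within_def)
        moreover have "c e = c' e" using c_off[OF 4(1,2)] 4(3,4) by simp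
        ultimately show ?thesis by (intro disjI2 conjI)
      qed
    qed
    have share: "\<not> inj_conflict E {u, v} {u, w}" if "{u, v} \<in> E" "{u, w} \<in> E" "w \<notin> nb E v" for u v w
      using conflict_share that by blast
    have new_old: "c e \<noteq> c' f" if e: "e \<in> E" "e \<notin> F" and f: "f \<in> F" and co: "inj_conflict E e f" for e f
    proof -
      have fW: "f \<subseteq> W" "f \<in> E" using FW FE f by auto
      have noW: "nb E x \<inter> W = {}" "nb E y \<inter> W = {}" using nbx nby by (auto simp: W_def)
      have far: "\<exists>d\<in>{u, v} \<inter> {b, b'}. f \<inter> nb E d \<noteq> {}" if uv: "e = {u, v}" "{u, v} \<subseteq> {x, y, b, b'}" for u v
      proof -
        have "e \<inter> f = {}" using uv fW by (auto simp: W_def)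
        then obtain z w where "z \<in> e" "w \<in> f" "w \<in> nb E z" using conflict_disjoint[OF co e(1) fW(2)] by blast
        then show ?thesis using uv noW fW by auto
      qed
      have pend: "f \<in> SS d" if d: "d = b \<or> d = b'" and a: "a \<in> nb E d \<inter> W" "e = {d, a}" for d a
      proof -
        have dW: "d \<notin> W" using d by (auto simp: W_def)
        have "a \<notin> f"
        proof
          assume "a \<in> f"
          then obtain w where w: "f = {a, w}" using edge_nb[OF fW(2)] by blast
          have "e = {a, d}" using a by auto
          then have "w \<in> nb E d" using conflict_share[of a d w] co e w fW(2) by auto
          then have "w = a" using unique[OF d _ a(1)] w fW by auto
          then show False using w nb_irrefl[of a] fW(2) by (auto simp: nb_def)
        qed
        then have disj: "e \<inter> f = {}" using a dW fW by auto
        have fd: "f \<inter> nb E d = {}" using unique[OF d _ a(1)] fW \<open>a \<notin> f\<close> by blast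
        obtain z w where "z \<in> e" "w \<in> f" "w \<in> nb E z" using conflict_disjoint[OF co e(1) fW(2) disj] by blast
        then have "\<exists>u\<in>f. u \<in> nb E a" using a fd by auto
        then show ?thesis using f fd a unfolding SS_def by blast
      qed
      from cls[OF e(1)] e(2) show ?thesis
      proof (elim disjE conjE bexE)
        assume "e = {x, y}"
        then show ?thesis using far[of x y] dist by auto
      next
        assume "e = {x, b}" "c e = p"
        then show ?thesis using far[of x b] dist pM(1) f bb by (auto simp: MM_def)
      next
        assume "e = {y, b}" "c e = q"
        then show ?thesis using far[of y b] dist pM(2) f bb by (auto simp: MM_def)
      next
        assume "e = {x, b'}" "c e = r"
        then show ?thesis using far[of x b'] dist pM(3) f bb by (auto simp: MM_def)
      next
        assume "e = {y, b'}" "c e = s"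
        then show ?thesis using far[of y b'] dist pM(4) f bb by (auto simp: MM_def)
      next
        fix a assume "a \<in> nb E b \<inter> W" "e = {b, a}" "c e = k"
        then show ?thesis using pend[of b a] kS(1) by auto
      next
        fix a assume "a \<in> nb E b' \<inter> W" "e = {b', a}" "c e = k'"
        then show ?thesis using pend[of b' a] kS(2) by auto
      qed auto
    qed
    have new_new: "c e \<noteq> c f" if e: "e \<in> E" "e \<notin> F" and f: "f \<in> E" "f \<notin> F" and co: "inj_conflict E e f" for e f
    proof
      assume eq: "c e = c f"
      have nf: "e \<noteq> f" using co by (auto simp: inj_conflict_def)
      have nW: "a \<notin> nb E x" "a \<notin> nb E y" if "a \<in> W" for a using that nbx nby by (auto simp: W_def)
      \<comment> \<open>Equal colours are left possible only for edges that share a vertex and do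
        not lie in a common triangle; \<open>N\<close> and \<open>P\<close> check these
        pairs.\<close>
      have N: "\<not> inj_conflict E {x, b} {x, b'}" "\<not> inj_conflict E {x, b'} {x, b}"
        "\<not> inj_conflict E {y, b} {y, b'}" "\<not> inj_conflict E {y, b'} {y, b}"
        using share[of x b b'] share[of x b' b] share[of y b b'] share[of y b' b] b b' nadj nadj'
        by (auto simp: nb_def)
      have P: "\<not> inj_conflict E {z, d} {d, a} \<and> \<not> inj_conflict E {d, a} {z, d}"
        if "d = b \<or> d = b'" "z = x \<or> z = y" "a \<in> nb E d \<inter> W" for d z a
      proof -
        have zd: "{d, z} \<in> E" "{d, a} \<in> E" using that b b' by (auto simp: nb_def insert_commute)
        have az: "a \<notin> nb E z" "z \<notin> nb E a" using that nW nb_sym by blast+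
        show ?thesis using share[OF zd az(1)] share[OF zd(2,1) az(2)] by (simp add: insert_commute)
      qed
      have Pb: "\<not> inj_conflict E {x, b} {b, a}" "\<not> inj_conflict E {b, a} {x, b}"
          "\<not> inj_conflict E {y, b} {b, a}" "\<not> inj_conflict E {b, a} {y, b}" if "a \<in> nb E b \<inter> W" for a
        using P[OF _ _ that] by auto
      have Pb': "\<not> inj_conflict E {x, b'} {b', a}" "\<not> inj_conflict E {b', a} {x, b'}"
          "\<not> inj_conflict E {y, b'} {b', a}" "\<not> inj_conflict E {b', a} {y, b'}" if "a \<in> nb E b' \<inter> W" for a
        using P[OF _ _ that] by auto
      from cls[OF e(1)] show False
      proof (elim disjE conjE bexE)
        assume "e = {x, y}" "c e = t"
        then show False using cls[OF f(1)] f(2) eq nf ne by (elim disjE conjE bexE) simp_all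
      next
        assume "e = {x, b}" "c e = p"
        then show False using cls[OF f(1)] f(2) eq nf ne co N Pb by (elim disjE conjE bexE) simp_all
      next
        assume "e = {y, b}" "c e = q"
        then show False using cls[OF f(1)] f(2) eq nf ne co N Pb by (elim disjE conjE bexE) simp_all
      next
        assume "e = {x, b'}" "c e = r"
        then show False using cls[OF f(1)] f(2) eq nf ne co N Pb' by (elim disjE conjE bexE) simp_all
      next
        assume "e = {y, b'}" "c e = s"
        then show False using cls[OF f(1)] f(2) eq nf ne co N Pb' by (elim disjE conjE bexE) simp_all
      next
        fix a assume "a \<in> nb E b \<inter> W" "e = {b, a}" "c e = k"
        then have a: "a \<in> nb E b \<inter> W" "e = {b, a}" "c e = k" by simp_all
        have cf: "c f = k" using eq a(3) by simp
        from cls[OF f(1)] show False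
        proof (elim disjE conjE bexE)
          fix a' assume "a' \<in> nb E b \<inter> W" "f = {b, a'}"
          then show False using unique[OF _ a(1), of a'] a(2) nf by simp
        qed (use Pb[OF a(1)] co a(2) cf ne f(2) in simp_all)
      next
        fix a assume "a \<in> nb E b' \<inter> W" "e = {b', a}" "c e = k'"
        then have a: "a \<in> nb E b' \<inter> W" "e = {b', a}" "c e = k'" by simp_all
        have cf: "c f = k'" using eq a(3) by simp
        from cls[OF f(1)] show False
        proof (elim disjE conjE bexE)
          fix a' assume "a' \<in> nb E b' \<inter> W" "f = {b', a'}"
          then show False using unique[OF _ a(1), of a'] a(2) nf by simp
        qed (use Pb'[OF a(1)] co a(2) cf ne f(2) in simp_all)
      next
        assume "e \<in> F"
        then show False using e(2) by simp
      qed
    qed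
    have "injective_edge_coloring E c 6"
      unfolding injective_edge_coloring_def
    proof (intro conjI ballI impI)
      fix e assume "e \<in> E"
      then show "c e < 6" using cls[of e] lt c'F[of e] by auto
    next
      fix e f assume ef: "e \<in> E" "f \<in> E" "inj_conflict E e f"
      have cF: "c e = c' e" if "e \<in> F" for e
      proof -
        have "x \<notin> e" "y \<notin> e" "b \<notin> e" "b' \<notin> e" using FW[OF that] by (auto simp: W_def)
        then have "e \<noteq> {x, y}" "e \<noteq> {x, b}" "e \<noteq> {x, b'}" "e \<noteq> {y, b}" "e \<noteq> {y, b'}" "e \<noteq> {b, b'}" "b \<notin> e" "b' \<notin> e" by blast+
        then show ?thesis by (simp add: c_def)
      qed
      show "c e \<noteq> c f"
        using new_old[of e f] new_old[of f e] new_new[of e f] old[of e f] ef inj_conflict_sym[OF ef(3)] cF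
        by (cases "e \<in> F"; cases "f \<in> F") auto
    qed
    then show ?thesis by blast
  qed
qed

section \<open>The six colours of a diamond-free graph\<close>

lemma good_coloring:
  assumes pl: "planar V E" and df: diamond_free
  shows "\<exists>c. injective_edge_coloring E c 6"
proof -
  obtain B where B: "good B" and min: "\<And>C. good C \<Longrightarrow> card B \<le> card C"
    using diamond_free_good[OF df] ex_has_least_nat[of good _ card] by blast
  have ind: "\<And>b. b \<in> B \<Longrightarrow> nb E b \<inter> B = {}" using B by (auto simp: good_def)
  obtain \<psi> where \<psi>: "injective_edge_coloring (edges_within E (V - B)) \<psi> 2" using B by (auto simp: good_def)
  have "\<exists>\<phi>. hcoloring E B (V - B) \<phi>"
    by (rule degenerate_hcoloring[OF pl]) (use ind finV minimal_good_degenerate[OF df B min] in auto)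
  then obtain \<phi> where \<phi>: "hcoloring E B (V - B) \<phi>" by blast
  \<comment> \<open>An edge that meets the independent set \<open>B\<close> has exactly one end
    outside it, so the description is well defined. Adding 4 separates the colours of
    \<open>G - B\<close> from those of H.\<close>
  define c where "c e = (if e \<inter> B = {} then 4 + \<psi> e else \<phi> (THE a. a \<in> e - B))" for e
  have within: "e \<in> edges_within E (V - B)" if "e \<in> E" "e \<inter> B = {}" for e
    using that edge_subset_V[OF that(1)] by (auto simp: edges_within_def)
  have cross: "\<exists>a b. e = {a, b} \<and> a \<in> V - B \<and> b \<in> B \<and> b \<in> nb E a \<and> c e = \<phi> a" if e: "e \<in> E" "e \<inter> B \<noteq> {}" for e
  proof -
    obtain b where b: "b \<in> e" "b \<in> B" using e by auto
    then obtain a where a: "e = {b, a}" "a \<in> nb E b" using edge_nb[OF e(1)] by blast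
    then have aB: "a \<in> V - B" using ind[OF b(2)] nb_V[of a b] by auto
    have "(THE u. u \<in> e - B) = a" using a b aB by (intro the_equality) auto
    then have "c e = \<phi> a" using e(2) by (simp add: c_def)
    then show ?thesis using a b aB nb_sym[of a b] by blast
  qed
  have \<phi>4: "\<phi> a < 4" if "a \<in> V - B" for a using \<phi> that by (auto simp: hcoloring_def)
  have hne: "\<phi> a \<noteq> \<phi> a'" if "a \<in> V - B" "a' \<in> V - B" "a' \<in> hnb E B a" for a a'
    using \<phi> that unfolding hcoloring_def by (metis IntI)
  have two: "c e < 6" if "e \<in> E" for e
  proof (cases "e \<inter> B = {}")
    case True
    then show ?thesis using \<psi> within[OF that True] by (auto simp: c_def injective_edge_coloring_def)
  next
    case False
    then show ?thesis using cross[OF that False] \<phi>4 by fastforce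
  qed
  have "injective_edge_coloring E c 6"
    unfolding injective_edge_coloring_def
  proof (intro conjI ballI impI)
    fix e assume "e \<in> E"
    then show "c e < 6" by (rule two)
  next
    fix e f assume ef: "e \<in> E" "f \<in> E" "inj_conflict E e f"
    have mixed: "c e' \<noteq> c f'" if h: "e' \<in> E" "e' \<inter> B = {}" "f' \<in> E" "f' \<inter> B \<noteq> {}" for e' f'
    proof -
      obtain a where "a \<in> V - B" "c f' = \<phi> a" using cross[OF h(3,4)] by blast
      then show ?thesis using \<phi>4[of a] h(2) by (simp add: c_def)
    qed
    consider "e \<inter> B = {}" "f \<inter> B = {}" | "e \<inter> B = {}" "f \<inter> B \<noteq> {}" | "e \<inter> B \<noteq> {}" "f \<inter> B = {}"
      | "e \<inter> B \<noteq> {}" "f \<inter> B \<noteq> {}" by blast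
    then show "c e \<noteq> c f"
    proof cases
      case 1
      have w: "e \<in> edges_within E (V - B)" "f \<in> edges_within E (V - B)" using within ef 1 by auto
      then have "inj_conflict (edges_within E (V - B)) e f" using inj_conflict_within[OF ef(3) order_refl] by blast
      then show ?thesis using \<psi> w 1 by (simp add: c_def injective_edge_coloring_def)
    next
      case 2
      then show ?thesis using mixed ef by blast
    next
      case 3
      then show ?thesis using mixed[of f e] ef by metis
    next
      case 4
      obtain a b where a: "e = {a, b}" "a \<in> V - B" "b \<in> B" "b \<in> nb E a" "c e = \<phi> a" using cross ef 4 by blast
      obtain a' b' where a': "f = {a', b'}" "a' \<in> V - B" "b' \<in> B" "b' \<in> nb E a'" "c f = \<phi> a'" using cross ef 4 by blast
      have bb: "b' \<notin> nb E b" using ind[OF a(3)] a'(3) by blast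
      \<comment> \<open>\<open>b\<close> and \<open>b'\<close> are not adjacent. So a conflict of
        disjoint edges comes from \<open>a a'\<close>, or from \<open>b\<close> or \<open>b'\<close>
        being adjacent to both \<open>a\<close> and \<open>a'\<close>; in a triangle the shared
        vertex cannot be \<open>a\<close>, so it is \<open>b\<close>.\<close>
      have "a' \<noteq> a \<and> a' \<in> hnb E B a"
        using ef(3,1,2) order_refl
      proof (cases rule: inj_conflict_cases)
        case (far u v)
        then have vu: "v \<in> nb E u" using nbI by blast
        have ne: "a' \<noteq> a" "b' \<noteq> b" using far a a' by auto
        have "a' \<in> nb E a \<or> b' \<in> nb E a \<or> a' \<in> nb E b" using far vu a a' bb by auto
        then have "a' \<in> hnb E B a"
          unfolding hnb_def using ne a a' nb_sym[of a' b'] nb_sym[of a' b] by auto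
        then show ?thesis using ne by blast
      next
        case (triangle u v w)
        then have wv: "w \<in> nb E v" using nbI by blast
        have aa: "a' \<noteq> a"
        proof
          assume "a' = a"
          then have "v = b" "w = b'" using triangle a a' by (auto simp: doubleton_eq_iff)
          then show False using wv bb by blast
        qed
        then have "b' = b" using triangle a a' by (auto simp: doubleton_eq_iff)
        then have "a' \<in> hnb E B a" unfolding hnb_def using aa a a' nb_sym[of a' b] by auto
        then show ?thesis using aa by blast
      qed
      then show ?thesis using hne a a' by metis
    qed
  qed
  then show ?thesis by blast
qed

end

text \<open>Deleting the vertices of a diamond keeps the graph planar and subcubic, and deleted
  edges are exactly those that \<open>diamond_extend\<close> colours.\<close>

lemma planar_subcubic_injective_coloring:
  "subcubic_graph V E \<Longrightarrow> planar V E \<Longrightarrow> \<exists>c. injective_edge_coloring E c 6"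
proof (induction "card V" arbitrary: V E rule: less_induct)
  case less
  interpret subcubic_graph V E by fact
  show ?case
  proof (cases diamond_free)
    case True
    then show ?thesis using good_coloring less.prems by blast
  next
    case False
    then obtain x y b b' where d: "y \<in> nb E x" "b \<in> nb E x" "b \<in> nb E y" "b' \<in> nb E x" "b' \<in> nb E y" "b \<noteq> b'"
      unfolding diamond_free_def by blast
    let ?W = "V - {x, y, b, b'}"
    have "x \<in> V" using d nb_V by blast
    then have "card ?W < card V" using finV by (intro psubset_card_mono) auto
    then have "\<exists>c. injective_edge_coloring (edges_within E ?W) c 6"
      using less.hyps subcubic_edges_within[of ?W] planar_edges_within[OF less.prems(2), of ?W] by blast
    then show ?thesis using diamond_extend[OF d] by blast
  qed
qed

theorem theorem1p5:
  fixes V :: "'a set" and E :: "'a set set"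
  assumes "simple_graph V E" and "planar V E" and "max_degree_le V E 3"
  shows "inj_chromatic_index E \<le> 6"
proof -
  have "subcubic_graph V E"
  proof
    show "finite V" using assms(1) by (simp add: simple_graph_def)
    show edge: "\<exists>u v. u \<in> V \<and> v \<in> V \<and> u \<noteq> v \<and> e = {u, v}" if "e \<in> E" for e
      using assms(1) that by (simp add: simple_graph_def)
    \<comment> \<open>The locale bounds the degree at every element of the type, so vertices outside
      \<open>V\<close> are treated too.\<close>
    show "card (nb E v) \<le> 3" for v
    proof (cases "v \<in> V")
      case True
      have "(\<lambda>u. {v, u}) ` nb E v \<subseteq> {e \<in> E. v \<in> e}" by (auto simp: nb_def)
      moreover have "E \<subseteq> Pow V" using edge by blast
      then have "finite {e \<in> E. v \<in> e}" using \<open>finite V\<close> by (metis (no_types, lifting) finite_Pow_iff finite_subset mem_Collect_eq subsetI)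
      ultimately have "card ((\<lambda>u. {v, u}) ` nb E v) \<le> degree E v"
        unfolding degree_def by (intro card_mono)
      moreover have "inj_on (\<lambda>u. {v, u}) (nb E v)" by (auto simp: inj_on_def doubleton_eq_iff)
      ultimately have "card (nb E v) \<le> degree E v" by (simp add: card_image)
      then show ?thesis using assms(3) True unfolding max_degree_le_def by (meson le_trans)
    next
      case False
      then have "nb E v = {}" using edge unfolding nb_def by (auto simp: doubleton_eq_iff) (metis insertI1 insert_commute doubleton_eq_iff)
      then show ?thesis by simp
    qed
  qed
  then have "\<exists>c. injective_edge_coloring E c 6" using planar_subcubic_injective_coloring assms(2) by blast
  then show ?thesis unfolding inj_chromatic_index_def by (rule Least_le)
qed

end
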